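(* Let $\mathcal{F}$ be a weakly idempotent complete Frobenius category, equipped with its canonical model structure, and let $A$ be a nonzero projective-injective object of $\mathcal{F}$. Then the homotopy category $\mathrm{Ho}(A\downarrow\mathcal{F})$ of the coslice category $(A\downarrow\mathcal{F})$ is a triangulated category.
   Context: A Frobenius category is an exact category (in the sense of Quillen) with enough projectives and enough injectives in which the projective objects coincide with the injective objects. It is weakly idempotent complete if every split monomorphism has a cokernel (equivalently, every split epimorphism has a kernel). The stable category $\underline{\mathcal{F}}$ has the same objects as $\mathcal{F}$, and morphisms are morphisms of $\mathcal{F}$ modulo those factoring through a projective-injective object. A morphism of $\mathcal{F}$ is a stable equivalence if it becomes an isomorphism in $\underline{\mathcal{F}}$. The canonical model structure on $\mathcal{F}$ has as cofibrations the (admissible) monomorphisms, as fibrations the (admissible) epimorphisms, and as weak equivalences the stable equivalences. The coslice category $(A\downarrow\mathcal{F})$ has as objects the morphisms $A\to C$ in $\mathcal{F}$ and as morphisms from $f:A\to C$ to $f':A\to C'$ the morphisms $\alpha:C\to C'$ with $f'=\alpha f$. It carries the model structure in which a map is a weak equivalence, cofibration or fibration if and only if its underlying map in $\mathcal{F}$ is one. Its homotopy category $\mathrm{Ho}(A\downarrow\mathcal{F})$ is the localization of $(A\downarrow\mathcal{F})$ at the weak equivalences. *)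

theory Defs
  imports "HOL-Algebra.Group"
begin

record ('o, 'm) category_data =
  Obj :: "'o set"
  Arr :: "'m set"
  Dom :: "'m \<Rightarrow> 'o"
  Cod :: "'m \<Rightarrow> 'o"
  Idt :: "'o \<Rightarrow> 'm"
  Comp :: "'m \<Rightarrow> 'm \<Rightarrow> 'm" (infixr "\<cdot>\<index>" 70)

definition Hom :: "('o, 'm, 'z) category_data_scheme \<Rightarrow> 'o \<Rightarrow> 'o \<Rightarrow> 'm set" where
  "Hom C x y = {f \<in> Arr C. Dom C f = x \<and> Cod C f = y}"

locale category =
  fixes C :: "('o, 'm, 'z) category_data_scheme" (structure)
  assumes Dom_in_Obj: "f \<in> Arr C \<Longrightarrow> Dom C f \<in> Obj C"
    and Cod_in_Obj: "f \<in> Arr C \<Longrightarrow> Cod C f \<in> Obj C"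
    and Idt_in_Hom: "x \<in> Obj C \<Longrightarrow> Idt C x \<in> Hom C x x"
    and Comp_in_Hom: "\<lbrakk>f \<in> Hom C x y; g \<in> Hom C y z\<rbrakk> \<Longrightarrow> g \<cdot> f \<in> Hom C x z"
    and Idt_right: "f \<in> Hom C x y \<Longrightarrow> f \<cdot> Idt C x = f"
    and Idt_left: "f \<in> Hom C x y \<Longrightarrow> Idt C y \<cdot> f = f"
    and Comp_assoc: "\<lbrakk>f \<in> Hom C w x; g \<in> Hom C x y; h \<in> Hom C y z\<rbrakk>
      \<Longrightarrow> (h \<cdot> g) \<cdot> f = h \<cdot> (g \<cdot> f)"

definition is_iso :: "('o, 'm, 'z) category_data_scheme \<Rightarrow> 'm \<Rightarrow> bool" where
  "is_iso C f \<longleftrightarrow> f \<in> Arr C \<and>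
    (\<exists>g \<in> Hom C (Cod C f) (Dom C f).
      g \<cdot>\<^bsub>C\<^esub> f = Idt C (Dom C f) \<and> f \<cdot>\<^bsub>C\<^esub> g = Idt C (Cod C f))"

definition split_mono :: "('o, 'm, 'z) category_data_scheme \<Rightarrow> 'm \<Rightarrow> bool" where
  "split_mono C s \<longleftrightarrow> s \<in> Arr C \<and>
    (\<exists>r \<in> Hom C (Cod C s) (Dom C s). r \<cdot>\<^bsub>C\<^esub> s = Idt C (Dom C s))"

definition zero_object :: "('o, 'm, 'z) category_data_scheme \<Rightarrow> 'o \<Rightarrow> bool" where
  "zero_object C z \<longleftrightarrow> z \<in> Obj C \<and>
    (\<forall>x \<in> Obj C. (\<exists>!f. f \<in> Hom C z x) \<and> (\<exists>!f. f \<in> Hom C x z))"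

text \<open>In a pushout or pullback square, \<open>f'\<close> is the edge parallel to \<open>f\<close> and \<open>g'\<close> the one parallel
  to \<open>g\<close>.\<close>

definition is_pushout ::
  "('o, 'm, 'z) category_data_scheme \<Rightarrow> 'm \<Rightarrow> 'm \<Rightarrow> 'm \<Rightarrow> 'm \<Rightarrow> bool" where
  "is_pushout C f g f' g' \<longleftrightarrow>
    f \<in> Arr C \<and> g \<in> Hom C (Dom C f) (Dom C f') \<and>
    f' \<in> Arr C \<and> g' \<in> Hom C (Cod C f) (Cod C f') \<and>
    g' \<cdot>\<^bsub>C\<^esub> f = f' \<cdot>\<^bsub>C\<^esub> g \<and>
    (\<forall>w. \<forall>u \<in> Hom C (Cod C f) w. \<forall>v \<in> Hom C (Cod C g) w.
      u \<cdot>\<^bsub>C\<^esub> f = v \<cdot>\<^bsub>C\<^esub> g \<longrightarrow>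
      (\<exists>!t. t \<in> Hom C (Cod C f') w \<and> t \<cdot>\<^bsub>C\<^esub> g' = u \<and> t \<cdot>\<^bsub>C\<^esub> f' = v))"

definition is_pullback ::
  "('o, 'm, 'z) category_data_scheme \<Rightarrow> 'm \<Rightarrow> 'm \<Rightarrow> 'm \<Rightarrow> 'm \<Rightarrow> bool" where
  "is_pullback C f g f' g' \<longleftrightarrow>
    f \<in> Arr C \<and> g \<in> Hom C (Cod C f') (Cod C f) \<and>
    f' \<in> Arr C \<and> g' \<in> Hom C (Dom C f') (Dom C f) \<and>
    f \<cdot>\<^bsub>C\<^esub> g' = g \<cdot>\<^bsub>C\<^esub> f' \<and>
    (\<forall>w. \<forall>u \<in> Hom C w (Dom C f). \<forall>v \<in> Hom C w (Dom C g).
      f \<cdot>\<^bsub>C\<^esub> u = g \<cdot>\<^bsub>C\<^esub> v \<longrightarrow>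
      (\<exists>!t. t \<in> Hom C w (Dom C f') \<and> g' \<cdot>\<^bsub>C\<^esub> t = u \<and> f' \<cdot>\<^bsub>C\<^esub> t = v))"

record ('o, 'm, 'p, 'n) functor_data =
  on_obj :: "'o \<Rightarrow> 'p"
  on_arr :: "'m \<Rightarrow> 'n"

definition is_functor ::
  "('o, 'm, 'y) category_data_scheme \<Rightarrow> ('p, 'n, 'z) category_data_scheme \<Rightarrow>
    ('o, 'm, 'p, 'n) functor_data \<Rightarrow> bool" where
  "is_functor C D \<Phi> \<longleftrightarrow>
    (\<forall>x \<in> Obj C. on_obj \<Phi> x \<in> Obj D \<and> on_arr \<Phi> (Idt C x) = Idt D (on_obj \<Phi> x)) \<and>
    (\<forall>f \<in> Arr C. on_arr \<Phi> f \<in> Hom D (on_obj \<Phi> (Dom C f)) (on_obj \<Phi> (Cod C f))) \<and>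
    (\<forall>f \<in> Arr C. \<forall>g \<in> Arr C. Cod C f = Dom C g \<longrightarrow>
      on_arr \<Phi> (g \<cdot>\<^bsub>C\<^esub> f) = on_arr \<Phi> g \<cdot>\<^bsub>D\<^esub> on_arr \<Phi> f)"

definition id_functor :: "('o, 'm, 'o, 'm) functor_data" where
  "id_functor = \<lparr>on_obj = (\<lambda>x. x), on_arr = (\<lambda>f. f)\<rparr>"

definition comp_functor ::
  "('p, 'n, 'q, 'k) functor_data \<Rightarrow> ('o, 'm, 'p, 'n) functor_data \<Rightarrow>
    ('o, 'm, 'q, 'k) functor_data" where
  "comp_functor \<Psi> \<Phi> = \<lparr>on_obj = on_obj \<Psi> \<circ> on_obj \<Phi>, on_arr = on_arr \<Psi> \<circ> on_arr \<Phi>\<rparr>"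

definition naturally_isomorphic ::
  "('o, 'm, 'y) category_data_scheme \<Rightarrow> ('p, 'n, 'z) category_data_scheme \<Rightarrow>
    ('o, 'm, 'p, 'n) functor_data \<Rightarrow> ('o, 'm, 'p, 'n) functor_data \<Rightarrow> bool" where
  "naturally_isomorphic C D \<Phi> \<Psi> \<longleftrightarrow>
    (\<exists>\<eta>. (\<forall>x \<in> Obj C. \<eta> x \<in> Hom D (on_obj \<Phi> x) (on_obj \<Psi> x) \<and> is_iso D (\<eta> x)) \<and>
      (\<forall>f \<in> Arr C. \<eta> (Cod C f) \<cdot>\<^bsub>D\<^esub> on_arr \<Phi> f = on_arr \<Psi> f \<cdot>\<^bsub>D\<^esub> \<eta> (Dom C f)))"

definition is_equivalence ::
  "('o, 'm, 'y) category_data_scheme \<Rightarrow> ('p, 'n, 'z) category_data_scheme \<Rightarrow>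
    ('o, 'm, 'p, 'n) functor_data \<Rightarrow> bool" where
  "is_equivalence C D \<Phi> \<longleftrightarrow> is_functor C D \<Phi> \<and>
    (\<exists>\<Psi>. is_functor D C \<Psi> \<and>
      naturally_isomorphic C C id_functor (comp_functor \<Psi> \<Phi>) \<and>
      naturally_isomorphic D D (comp_functor \<Phi> \<Psi>) id_functor)"

record ('o, 'm) preadditive_data = "('o, 'm) category_data" +
  Add :: "'m \<Rightarrow> 'm \<Rightarrow> 'm" (infixl "\<oplus>\<index>" 65)
  Zero :: "'o \<Rightarrow> 'o \<Rightarrow> 'm"

definition hom_group :: "('o, 'm, 'z) preadditive_data_scheme \<Rightarrow> 'o \<Rightarrow> 'o \<Rightarrow> 'm monoid" where
  "hom_group C x y = \<lparr>carrier = Hom C x y, mult = Add C, one = Zero C x y\<rparr>"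

definition Neg :: "('o, 'm, 'z) preadditive_data_scheme \<Rightarrow> 'm \<Rightarrow> 'm" where
  "Neg C f = inv\<^bsub>hom_group C (Dom C f) (Cod C f)\<^esub> f"

locale preadditive_category = category C
  for C :: "('o, 'm, 'z) preadditive_data_scheme" (structure) +
  assumes hom_group_comm: "\<lbrakk>x \<in> Obj C; y \<in> Obj C\<rbrakk> \<Longrightarrow> comm_group (hom_group C x y)"
    and Comp_Add_right: "\<lbrakk>f \<in> Hom C x y; f' \<in> Hom C x y; g \<in> Hom C y z\<rbrakk>
      \<Longrightarrow> g \<cdot> (f \<oplus> f') = (g \<cdot> f) \<oplus> (g \<cdot> f')"
    and Comp_Add_left: "\<lbrakk>f \<in> Hom C x y; g \<in> Hom C y z; g' \<in> Hom C y z\<rbrakk>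
      \<Longrightarrow> (g \<oplus> g') \<cdot> f = (g \<cdot> f) \<oplus> (g' \<cdot> f)"

locale additive_category = preadditive_category C
  for C :: "('o, 'm, 'z) preadditive_data_scheme" (structure) +
  assumes ex_zero_object: "\<exists>z. zero_object C z"
    and ex_biproduct: "\<lbrakk>x \<in> Obj C; y \<in> Obj C\<rbrakk> \<Longrightarrow>
      \<exists>b. \<exists>i \<in> Hom C x b. \<exists>j \<in> Hom C y b. \<exists>p \<in> Hom C b x. \<exists>q \<in> Hom C b y.
        p \<cdot> i = Idt C x \<and> q \<cdot> j = Idt C y \<and>
        p \<cdot> j = Zero C y x \<and> q \<cdot> i = Zero C x y \<and>
        (i \<cdot> p) \<oplus> (j \<cdot> q) = Idt C b"

definition is_kernel :: "('o, 'm, 'z) preadditive_data_scheme \<Rightarrow> 'm \<Rightarrow> 'm \<Rightarrow> bool" where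
  "is_kernel C i p \<longleftrightarrow> i \<in> Arr C \<and> p \<in> Arr C \<and> Cod C i = Dom C p \<and>
    p \<cdot>\<^bsub>C\<^esub> i = Zero C (Dom C i) (Cod C p) \<and>
    (\<forall>w. \<forall>u \<in> Hom C w (Dom C p). p \<cdot>\<^bsub>C\<^esub> u = Zero C w (Cod C p) \<longrightarrow>
      (\<exists>!t. t \<in> Hom C w (Dom C i) \<and> i \<cdot>\<^bsub>C\<^esub> t = u))"

definition is_cokernel :: "('o, 'm, 'z) preadditive_data_scheme \<Rightarrow> 'm \<Rightarrow> 'm \<Rightarrow> bool" where
  "is_cokernel C p i \<longleftrightarrow> i \<in> Arr C \<and> p \<in> Arr C \<and> Cod C i = Dom C p \<and>
    p \<cdot>\<^bsub>C\<^esub> i = Zero C (Dom C i) (Cod C p) \<and>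
    (\<forall>w. \<forall>u \<in> Hom C (Cod C i) w. u \<cdot>\<^bsub>C\<^esub> i = Zero C (Dom C i) w \<longrightarrow>
      (\<exists>!t. t \<in> Hom C (Cod C p) w \<and> t \<cdot>\<^bsub>C\<^esub> p = u))"

definition weakly_idempotent_complete :: "('o, 'm, 'z) preadditive_data_scheme \<Rightarrow> bool" where
  "weakly_idempotent_complete C \<longleftrightarrow> (\<forall>s. split_mono C s \<longrightarrow> (\<exists>p. is_cokernel C p s))"

definition is_additive_functor ::
  "('o, 'm, 'y) preadditive_data_scheme \<Rightarrow> ('p, 'n, 'z) preadditive_data_scheme \<Rightarrow>
    ('o, 'm, 'p, 'n) functor_data \<Rightarrow> bool" where
  "is_additive_functor C D \<Phi> \<longleftrightarrow> is_functor C D \<Phi> \<and>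
    (\<forall>x \<in> Obj C. \<forall>y \<in> Obj C. \<forall>f \<in> Hom C x y. \<forall>g \<in> Hom C x y.
      on_arr \<Phi> (f \<oplus>\<^bsub>C\<^esub> g) = on_arr \<Phi> f \<oplus>\<^bsub>D\<^esub> on_arr \<Phi> g)"

record ('o, 'm) exact_data = "('o, 'm) preadditive_data" +
  Conf :: "('m \<times> 'm) set"  \<comment> \<open>the admissible short exact sequences \<open>(i, p)\<close>\<close>

definition adm_mono :: "('o, 'm, 'z) exact_data_scheme \<Rightarrow> 'm \<Rightarrow> bool" where
  "adm_mono E i \<longleftrightarrow> (\<exists>p. (i, p) \<in> Conf E)"

definition adm_epi :: "('o, 'm, 'z) exact_data_scheme \<Rightarrow> 'm \<Rightarrow> bool" where
  "adm_epi E p \<longleftrightarrow> (\<exists>i. (i, p) \<in> Conf E)"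

text \<open>
  Quillen's axioms in the usual self-dual form; Quillen's additional ``obscure axiom'' is a
  consequence of these by a theorem of Keller.
\<close>

locale exact_category = additive_category E
  for E :: "('o, 'm, 'z) exact_data_scheme" (structure) +
  assumes Conf_kernel_cokernel: "(i, p) \<in> Conf E \<Longrightarrow> is_kernel E i p \<and> is_cokernel E p i"
    and Conf_iso_closed:
      "\<lbrakk>(i, p) \<in> Conf E; i' \<in> Arr E; p' \<in> Arr E; Cod E i' = Dom E p';
        is_iso E a; a \<in> Hom E (Dom E i) (Dom E i');
        is_iso E b; b \<in> Hom E (Cod E i) (Cod E i');
        is_iso E c; c \<in> Hom E (Cod E p) (Cod E p');
        b \<cdot> i = i' \<cdot> a; c \<cdot> p = p' \<cdot> b\<rbrakk> \<Longrightarrow> (i', p') \<in> Conf E"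
    and adm_mono_Idt: "x \<in> Obj E \<Longrightarrow> adm_mono E (Idt E x)"
    and adm_epi_Idt: "x \<in> Obj E \<Longrightarrow> adm_epi E (Idt E x)"
    and adm_mono_Comp: "\<lbrakk>adm_mono E i; adm_mono E j; Cod E i = Dom E j\<rbrakk> \<Longrightarrow> adm_mono E (j \<cdot> i)"
    and adm_epi_Comp: "\<lbrakk>adm_epi E p; adm_epi E q; Cod E p = Dom E q\<rbrakk> \<Longrightarrow> adm_epi E (q \<cdot> p)"
    and adm_mono_pushout: "\<lbrakk>adm_mono E i; f \<in> Arr E; Dom E f = Dom E i\<rbrakk>
      \<Longrightarrow> \<exists>i' f'. is_pushout E i f i' f' \<and> adm_mono E i'"
    and adm_epi_pullback: "\<lbrakk>adm_epi E p; f \<in> Arr E; Cod E f = Cod E p\<rbrakk>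
      \<Longrightarrow> \<exists>p' f'. is_pullback E p f p' f' \<and> adm_epi E p'"

definition projective :: "('o, 'm, 'z) exact_data_scheme \<Rightarrow> 'o \<Rightarrow> bool" where
  "projective E P \<longleftrightarrow> P \<in> Obj E \<and>
    (\<forall>p. adm_epi E p \<longrightarrow>
      (\<forall>f \<in> Hom E P (Cod E p). \<exists>g \<in> Hom E P (Dom E p). p \<cdot>\<^bsub>E\<^esub> g = f))"

definition injective :: "('o, 'm, 'z) exact_data_scheme \<Rightarrow> 'o \<Rightarrow> bool" where
  "injective E I \<longleftrightarrow> I \<in> Obj E \<and>
    (\<forall>i. adm_mono E i \<longrightarrow>
      (\<forall>f \<in> Hom E (Dom E i) I. \<exists>g \<in> Hom E (Cod E i) I. g \<cdot>\<^bsub>E\<^esub> i = f))"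

locale frobenius_category = exact_category E
  for E :: "('o, 'm, 'z) exact_data_scheme" (structure) +
  assumes enough_projectives:
      "x \<in> Obj E \<Longrightarrow> \<exists>p. adm_epi E p \<and> Cod E p = x \<and> projective E (Dom E p)"
    and enough_injectives:
      "x \<in> Obj E \<Longrightarrow> \<exists>i. adm_mono E i \<and> Dom E i = x \<and> injective E (Cod E i)"
    and projective_iff_injective: "projective E x \<longleftrightarrow> injective E x"

definition null_maps :: "('o, 'm, 'z) exact_data_scheme \<Rightarrow> 'o \<Rightarrow> 'o \<Rightarrow> 'm set" where
  "null_maps E x y = {v \<cdot>\<^bsub>E\<^esub> u | u v P.
    projective E P \<and> injective E P \<and> u \<in> Hom E x P \<and> v \<in> Hom E P y}"

definition stable_class :: "('o, 'm, 'z) exact_data_scheme \<Rightarrow> 'm \<Rightarrow> 'm set" where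
  "stable_class E f = {f \<oplus>\<^bsub>E\<^esub> n | n. n \<in> null_maps E (Dom E f) (Cod E f)}"

text \<open>Stable morphisms carry their source and target, so that \<open>Dom\<close> and \<open>Cod\<close> are functions of the
  morphism; the same encoding is used for the localization below.\<close>

definition stable_arr :: "('o, 'm, 'z) exact_data_scheme \<Rightarrow> 'm \<Rightarrow> 'o \<times> 'm set \<times> 'o" where
  "stable_arr E f = (Dom E f, stable_class E f, Cod E f)"

definition stable_category ::
  "('o, 'm, 'z) exact_data_scheme \<Rightarrow> ('o, 'o \<times> 'm set \<times> 'o) category_data" where
  "stable_category E =
    \<lparr>Obj = Obj E,
     Arr = stable_arr E ` Arr E,
     Dom = (\<lambda>(x, F, y). x),
     Cod = (\<lambda>(x, F, y). y),
     Idt = (\<lambda>x. stable_arr E (Idt E x)),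
     Comp = (\<lambda>(y', G, z) (x, F, y). (x, \<Union>g \<in> G. \<Union>f \<in> F. stable_class E (g \<cdot>\<^bsub>E\<^esub> f), z))\<rparr>"

definition stable_equivalence :: "('o, 'm, 'z) exact_data_scheme \<Rightarrow> 'm \<Rightarrow> bool" where
  "stable_equivalence E f \<longleftrightarrow> f \<in> Arr E \<and> is_iso (stable_category E) (stable_arr E f)"

record 'm model_data =
  Weq :: "'m set"
  Cofib :: "'m set"
  Fib :: "'m set"

definition canonical_model :: "('o, 'm, 'z) exact_data_scheme \<Rightarrow> 'm model_data" where
  "canonical_model E =
    \<lparr>Weq = {f. stable_equivalence E f}, Cofib = {i. adm_mono E i}, Fib = {p. adm_epi E p}\<rparr>"

text \<open>A morphism \<open>(f, \<alpha>, f')\<close> of the coslice category carries its source and target, since the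
  underlying morphism \<open>\<alpha>\<close> does not determine \<open>f\<close>.\<close>

definition coslice ::
  "('o, 'm, 'z) category_data_scheme \<Rightarrow> 'o \<Rightarrow> ('m, 'm \<times> 'm \<times> 'm) category_data" where
  "coslice C A =
    \<lparr>Obj = {f \<in> Arr C. Dom C f = A},
     Arr = {(f, \<alpha>, f'). f \<in> Arr C \<and> Dom C f = A \<and> f' \<in> Arr C \<and> Dom C f' = A \<and>
       \<alpha> \<in> Hom C (Cod C f) (Cod C f') \<and> f' = \<alpha> \<cdot>\<^bsub>C\<^esub> f},
     Dom = (\<lambda>(f, \<alpha>, f'). f),
     Cod = (\<lambda>(f, \<alpha>, f'). f'),
     Idt = (\<lambda>f. (f, Idt C (Cod C f), f)),
     Comp = (\<lambda>(g, \<beta>, g') (f, \<alpha>, f'). (f, \<beta> \<cdot>\<^bsub>C\<^esub> \<alpha>, g'))\<rparr>"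

definition coslice_model ::
  "('o, 'm, 'z) category_data_scheme \<Rightarrow> 'o \<Rightarrow> 'm model_data \<Rightarrow> ('m \<times> 'm \<times> 'm) model_data" where
  "coslice_model C A M =
    \<lparr>Weq = {(f, \<alpha>, f') \<in> Arr (coslice C A). \<alpha> \<in> Weq M},
     Cofib = {(f, \<alpha>, f') \<in> Arr (coslice C A). \<alpha> \<in> Cofib M},
     Fib = {(f, \<alpha>, f') \<in> Arr (coslice C A). \<alpha> \<in> Fib M}\<rparr>"

text \<open>
  The Gabriel--Zisman localization of \<open>C\<close> at a class \<open>W\<close> of morphisms: its morphisms are zigzags
  of morphisms of \<open>C\<close> and formal inverses of elements of \<open>W\<close>, modulo the congruence generated by
  the relations of \<open>C\<close> and the inversion relations. Zigzags are written in diagrammatic order.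
\<close>

datatype 'm step = Fwd 'm | Inv 'm

fun step_in :: "('o, 'm, 'z) category_data_scheme \<Rightarrow> 'm set \<Rightarrow> 'o \<Rightarrow> 'm step \<Rightarrow> 'o \<Rightarrow> bool" where
  "step_in C W x (Fwd f) y \<longleftrightarrow> f \<in> Hom C x y"
| "step_in C W x (Inv w) y \<longleftrightarrow> w \<in> W \<and> w \<in> Hom C y x"

fun zigzag ::
  "('o, 'm, 'z) category_data_scheme \<Rightarrow> 'm set \<Rightarrow> 'o \<Rightarrow> 'm step list \<Rightarrow> 'o \<Rightarrow> bool" where
  "zigzag C W x [] y \<longleftrightarrow> x \<in> Obj C \<and> x = y"
| "zigzag C W x (s # p) y \<longleftrightarrow> (\<exists>z. step_in C W x s z \<and> zigzag C W z p y)"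

inductive zigzag_equiv ::
  "('o, 'm, 'z) category_data_scheme \<Rightarrow> 'm set \<Rightarrow>
    'o \<Rightarrow> 'm step list \<Rightarrow> 'm step list \<Rightarrow> 'o \<Rightarrow> bool"
  for C W where
  zz_refl: "zigzag C W x p y \<Longrightarrow> zigzag_equiv C W x p p y"
| zz_sym: "zigzag_equiv C W x p q y \<Longrightarrow> zigzag_equiv C W x q p y"
| zz_trans: "\<lbrakk>zigzag_equiv C W x p q y; zigzag_equiv C W x q r y\<rbrakk> \<Longrightarrow> zigzag_equiv C W x p r y"
| zz_append: "\<lbrakk>zigzag_equiv C W x p q y; zigzag_equiv C W y p' q' z\<rbrakk>
    \<Longrightarrow> zigzag_equiv C W x (p @ p') (q @ q') z"
| zz_Idt: "x \<in> Obj C \<Longrightarrow> zigzag_equiv C W x [Fwd (Idt C x)] [] x"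
| zz_Comp: "\<lbrakk>f \<in> Hom C x y; g \<in> Hom C y z\<rbrakk>
    \<Longrightarrow> zigzag_equiv C W x [Fwd f, Fwd g] [Fwd (g \<cdot>\<^bsub>C\<^esub> f)] z"
| zz_Fwd_Inv: "\<lbrakk>w \<in> W; w \<in> Hom C x y\<rbrakk> \<Longrightarrow> zigzag_equiv C W x [Fwd w, Inv w] [] x"
| zz_Inv_Fwd: "\<lbrakk>w \<in> W; w \<in> Hom C x y\<rbrakk> \<Longrightarrow> zigzag_equiv C W y [Inv w, Fwd w] [] y"

definition zigzag_class ::
  "('o, 'm, 'z) category_data_scheme \<Rightarrow> 'm set \<Rightarrow> 'o \<Rightarrow> 'm step list \<Rightarrow> 'o \<Rightarrow>
    'o \<times> 'm step list set \<times> 'o" where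
  "zigzag_class C W x p y = (x, {q. zigzag_equiv C W x p q y}, y)"

definition localization ::
  "('o, 'm, 'z) category_data_scheme \<Rightarrow> 'm set \<Rightarrow>
    ('o, 'o \<times> 'm step list set \<times> 'o) category_data" where
  "localization C W =
    \<lparr>Obj = Obj C,
     Arr = {zigzag_class C W x p y | x p y. zigzag C W x p y},
     Dom = (\<lambda>(x, P, y). x),
     Cod = (\<lambda>(x, P, y). y),
     Idt = (\<lambda>x. zigzag_class C W x [] x),
     Comp = (\<lambda>(y', Q, z) (x, P, y).
       (x, {r. \<exists>p \<in> P. \<exists>q \<in> Q. zigzag_equiv C W x (p @ q) r z}, z))\<rparr>"

definition Ho ::
  "('o, 'm, 'z) category_data_scheme \<Rightarrow> 'm model_data \<Rightarrow>
    ('o, 'o \<times> 'm step list set \<times> 'o) category_data" where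
  "Ho C M = localization C (Weq M)"

type_synonym 'm triangle = "'m \<times> 'm \<times> 'm"

definition is_triangle ::
  "('o, 'm, 'z) preadditive_data_scheme \<Rightarrow> ('o, 'm, 'o, 'm) functor_data \<Rightarrow> 'm triangle \<Rightarrow> bool"
  where
  "is_triangle T S = (\<lambda>(f, g, h). f \<in> Arr T \<and> g \<in> Arr T \<and> h \<in> Arr T \<and>
    Cod T f = Dom T g \<and> Cod T g = Dom T h \<and> Cod T h = on_obj S (Dom T f))"

definition triangle_morphism ::
  "('o, 'm, 'z) preadditive_data_scheme \<Rightarrow> ('o, 'm, 'o, 'm) functor_data \<Rightarrow>
    'm triangle \<Rightarrow> 'm triangle \<Rightarrow> 'm \<Rightarrow> 'm \<Rightarrow> 'm \<Rightarrow> bool" where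
  "triangle_morphism T S = (\<lambda>(f, g, h) (f', g', h') a b c.
    a \<in> Hom T (Dom T f) (Dom T f') \<and>
    b \<in> Hom T (Dom T g) (Dom T g') \<and>
    c \<in> Hom T (Dom T h) (Dom T h') \<and>
    b \<cdot>\<^bsub>T\<^esub> f = f' \<cdot>\<^bsub>T\<^esub> a \<and>
    c \<cdot>\<^bsub>T\<^esub> g = g' \<cdot>\<^bsub>T\<^esub> b \<and>
    on_arr S a \<cdot>\<^bsub>T\<^esub> h = h' \<cdot>\<^bsub>T\<^esub> c)"

locale triangulated_category = additive_category T
  for T :: "('o, 'm, 'z) preadditive_data_scheme" (structure)
    and S :: "('o, 'm, 'o, 'm) functor_data"
    and \<Delta> :: "'m triangle set" +
  assumes shift_additive: "is_additive_functor T T S"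
    and shift_equivalence: "is_equivalence T T S"
    and TR0: "t \<in> \<Delta> \<Longrightarrow> is_triangle T S t"
    and TR1_iso: "\<lbrakk>t \<in> \<Delta>; is_triangle T S t'; triangle_morphism T S t t' a b c;
      is_iso T a; is_iso T b; is_iso T c\<rbrakk> \<Longrightarrow> t' \<in> \<Delta>"
    and TR1_Idt: "\<lbrakk>x \<in> Obj T; zero_object T z\<rbrakk>
      \<Longrightarrow> (Idt T x, Zero T x z, Zero T z (on_obj S x)) \<in> \<Delta>"
    and TR1_cone: "f \<in> Arr T \<Longrightarrow> \<exists>g h. (f, g, h) \<in> \<Delta>"
    and TR2: "is_triangle T S (f, g, h)
      \<Longrightarrow> (f, g, h) \<in> \<Delta> \<longleftrightarrow> (g, h, Neg T (on_arr S f)) \<in> \<Delta>"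
    and TR3: "\<lbrakk>(f, g, h) \<in> \<Delta>; (f', g', h') \<in> \<Delta>;
      a \<in> Hom T (Dom T f) (Dom T f'); b \<in> Hom T (Cod T f) (Cod T f'); b \<cdot> f = f' \<cdot> a\<rbrakk>
      \<Longrightarrow> \<exists>c. triangle_morphism T S (f, g, h) (f', g', h') a b c"
    and TR4: "\<lbrakk>(u, i, i') \<in> \<Delta>; (v, j, j') \<in> \<Delta>; (v \<cdot> u, k, k') \<in> \<Delta>; Cod T u = Dom T v\<rbrakk>
      \<Longrightarrow> \<exists>f g. (f, g, on_arr S i \<cdot> j') \<in> \<Delta> \<and>
        triangle_morphism T S (u, i, i') (v \<cdot> u, k, k') (Idt T (Dom T u)) v f \<and>
        triangle_morphism T S (v \<cdot> u, k, k') (v, j, j') u (Idt T (Cod T v)) g"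

text \<open>A category is called triangulated if it carries the structure of a triangulated category;
  the additive structure is part of that structure.\<close>

definition is_triangulated_category :: "('o, 'm) category_data \<Rightarrow> bool" where
  "is_triangulated_category C \<longleftrightarrow>
    (\<exists>(T :: ('o, 'm) preadditive_data) S \<Delta>.
      category_data.truncate T = C \<and> triangulated_category T S \<Delta>)"

end

theory Submission
  imports Defs
begin

text \<open>
  The stable category of a Frobenius category is triangulated (Happel): the suspension of \<open>X\<close> is the
  cokernel of an inflation \<open>X \<rightarrow> I(X)\<close> into an injective object, and the standard triangle on
  \<open>u : X \<rightarrow> Y\<close> is \<open>X \<rightarrow> Y \<rightarrow> C \<rightarrow> \<Sigma>X\<close> with \<open>C\<close> the pushout of \<open>X \<rightarrow> I(X)\<close> along \<open>u\<close>. Everything that is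
  needed of these triangles follows from the universal property of \<open>C\<close> and injectivity.

  Since \<open>A\<close> vanishes in the stable category, \<open>Ho(A \<down> \<F>)\<close> is the stable category up to equivalence:
  every \<open>x : A \<rightarrow> C\<close> is weakly equivalent to the coproduct inclusion \<open>A \<rightarrow> A \<oplus> C\<close>, out of which
  morphisms under \<open>A\<close> are the same as arbitrary morphisms out of \<open>C\<close>. Hence morphisms \<open>x \<rightarrow> y\<close> of
  \<open>Ho(A \<down> \<F>)\<close> are stable classes of morphisms between the codomains of \<open>x\<close> and \<open>y\<close>, and the
  triangulated structure is pulled back along the codomain functor.
\<close>

section \<open>Preadditive categories\<close>

text \<open>Two obstacles shape the proof. A suspension of a morphism is determined only up to
  stable equality, and a pushout only up to isomorphism. So \<open>shift\<close> and
  \<open>cone\<close> are relations, facts about them are proved for all their values, and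
  representatives are selected only once morphisms have become classes. The other obstacle is that a
  morphism of the localization is an arbitrary zigzag. It is controlled from two sides:
  \<open>zz_val\<close> sends zigzags to morphisms and respects the congruence up to \<approx>,
  while \<open>roof\<close> turns a morphism into a zigzag of length two. That these are mutually
  inverse is the claimed description of the Hom sets. The delicate direction must derive, from the
  inversion relations alone, that stably equal morphisms have equivalent roofs.

  The codomain functor hits every object (the zero map from \<open>A\<close> lies over
  \<open>c\<close>), but many objects share a codomain. Suspensions and cones therefore return to
  the localization along a chosen section, and the locale \<open>stable_quotient\<close> records
  exactly this situation. The axioms are verified on standard triangles only;
  \<open>standard_triangles\<close> transports them to the closure under isomorphism.\<close>

lemma Hom_iff: "f \<in> Hom C x y \<longleftrightarrow> f \<in> Arr C \<and> Dom C f = x \<and> Cod C f = y"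
  by (auto simp: Hom_def)

context category
begin

lemma Comp_simps [simp]:
  assumes "f \<in> Arr C" "g \<in> Arr C" "Dom C g = Cod C f"
  shows "g \<cdot> f \<in> Arr C" "Dom C (g \<cdot> f) = Dom C f" "Cod C (g \<cdot> f) = Cod C g"
  using Comp_in_Hom[of f "Dom C f" "Cod C f" g "Cod C g"] assms by (auto simp: Hom_iff)

lemma Idt_simps [simp]:
  assumes "x \<in> Obj C"
  shows "Idt C x \<in> Arr C" "Dom C (Idt C x) = x" "Cod C (Idt C x) = x"
  using Idt_in_Hom[OF assms] by (auto simp: Hom_iff)

lemma Comp_Idt [simp]:
  "f \<in> Arr C \<Longrightarrow> Dom C f = x \<Longrightarrow> f \<cdot> Idt C x = f"
  "f \<in> Arr C \<Longrightarrow> Cod C f = y \<Longrightarrow> Idt C y \<cdot> f = f"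
  using Idt_right Idt_left by (auto simp: Hom_iff)

lemma Comp_Comp [simp]:
  "\<lbrakk>f \<in> Arr C; g \<in> Arr C; h \<in> Arr C; Dom C g = Cod C f; Dom C h = Cod C g\<rbrakk>
    \<Longrightarrow> (h \<cdot> g) \<cdot> f = h \<cdot> (g \<cdot> f)"
  using Comp_assoc[of f "Dom C f" "Cod C f" g "Cod C g" h "Cod C h"] by (auto simp: Hom_iff)

declare Dom_in_Obj [simp] Cod_in_Obj [simp]

lemma Hom_Obj: "f \<in> Hom C x y \<Longrightarrow> x \<in> Obj C" "f \<in> Hom C x y \<Longrightarrow> y \<in> Obj C"
  by (auto simp: Hom_iff)

text \<open>The simplifier associates composites to the right, so an equation between binary
  composites no longer matches inside a longer one. This rule and \<open>Comp_eq_Arr\<close> append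
  a tail \<open>e\<close> to such an equation; later proofs obtain the needed rewrite rules by
  \<open>THEN\<close>.\<close>

lemma Comp_eq_Comp:
  assumes "g \<cdot> f = h \<cdot> k" "f \<in> Arr C" "g \<in> Arr C" "h \<in> Arr C" "k \<in> Arr C"
    "Dom C g = Cod C f" "Dom C h = Cod C k" "e \<in> Arr C" "Cod C e = Dom C f"
  shows "g \<cdot> (f \<cdot> e) = h \<cdot> (k \<cdot> e)"
proof -
  have "Dom C k = Dom C f" using assms by (metis Comp_simps(2))
  have "g \<cdot> (f \<cdot> e) = (g \<cdot> f) \<cdot> e" using assms(2-) by simp
  also have "\<dots> = (h \<cdot> k) \<cdot> e" by (simp only: assms(1))
  also have "\<dots> = h \<cdot> (k \<cdot> e)" using assms(2-) \<open>Dom C k = Dom C f\<close> by simp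
  finally show ?thesis .
qed

lemma Comp_eq_Arr:
  assumes "g \<cdot> f = h" "f \<in> Arr C" "g \<in> Arr C" "Dom C g = Cod C f" "e \<in> Arr C" "Cod C e = Dom C f"
  shows "g \<cdot> (f \<cdot> e) = h \<cdot> e"
  using assms by auto

end

context preadditive_category
begin

section \<open>The abelian group calculus on Hom sets\<close>

lemma Zero_simps [simp]:
  assumes "x \<in> Obj C" "y \<in> Obj C"
  shows "Zero C x y \<in> Arr C" "Dom C (Zero C x y) = x" "Cod C (Zero C x y) = y"
proof -
  interpret comm_group "hom_group C x y" using assms by (rule hom_group_comm)
  show "Zero C x y \<in> Arr C" "Dom C (Zero C x y) = x" "Cod C (Zero C x y) = y"
    using one_closed by (auto simp: hom_group_def Hom_iff)
qed

lemma Add_simps [simp]: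
  assumes "f \<in> Arr C" "g \<in> Arr C" "Dom C g = Dom C f" "Cod C g = Cod C f"
  shows "f \<oplus> g \<in> Arr C" "Dom C (f \<oplus> g) = Dom C f" "Cod C (f \<oplus> g) = Cod C f"
proof -
  interpret comm_group "hom_group C (Dom C f) (Cod C f)" using assms by (intro hom_group_comm) auto
  show "f \<oplus> g \<in> Arr C" "Dom C (f \<oplus> g) = Dom C f" "Cod C (f \<oplus> g) = Cod C f"
    using m_closed[of f g] assms by (auto simp: hom_group_def Hom_iff)
qed

lemma Neg_simps [simp]:
  assumes "f \<in> Arr C"
  shows "Neg C f \<in> Arr C" "Dom C (Neg C f) = Dom C f" "Cod C (Neg C f) = Cod C f"
proof -
  interpret comm_group "hom_group C (Dom C f) (Cod C f)" using assms by (intro hom_group_comm) auto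
  have "f \<in> carrier (hom_group C (Dom C f) (Cod C f))" using assms by (simp add: hom_group_def Hom_iff)
  then show "Neg C f \<in> Arr C" "Dom C (Neg C f) = Dom C f" "Cod C (Neg C f) = Cod C f"
    using inv_closed[of f] by (auto simp: hom_group_def Hom_iff Neg_def)
qed

lemma Add_assoc:
  assumes "f \<in> Arr C" "g \<in> Arr C" "h \<in> Arr C" "Dom C g = Dom C f" "Cod C g = Cod C f"
    "Dom C h = Dom C f" "Cod C h = Cod C f"
  shows "(f \<oplus> g) \<oplus> h = f \<oplus> (g \<oplus> h)"
proof -
  interpret comm_group "hom_group C (Dom C f) (Cod C f)" using assms by (intro hom_group_comm) auto
  show ?thesis using m_assoc[of f g h] assms by (auto simp: hom_group_def Hom_iff)
qed

lemma Add_commute: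
  assumes "f \<in> Arr C" "g \<in> Arr C" "Dom C g = Dom C f" "Cod C g = Cod C f"
  shows "f \<oplus> g = g \<oplus> f"
proof -
  interpret comm_group "hom_group C (Dom C f) (Cod C f)" using assms by (intro hom_group_comm) auto
  show ?thesis using m_comm[of f g] assms by (auto simp: hom_group_def Hom_iff)
qed

lemma Add_left_commute:
  assumes "f \<in> Arr C" "g \<in> Arr C" "h \<in> Arr C" "Dom C g = Dom C f" "Cod C g = Cod C f"
    "Dom C h = Dom C f" "Cod C h = Cod C f"
  shows "f \<oplus> (g \<oplus> h) = g \<oplus> (f \<oplus> h)"
  using Add_assoc[of f g h] Add_assoc[of g f h] Add_commute[of f g] assms by simp

lemmas Add_ac = Add_assoc Add_commute Add_left_commute

lemma Add_Zero [simp]: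
  assumes "f \<in> Arr C" "Dom C f = x" "Cod C f = y"
  shows "f \<oplus> Zero C x y = f" "Zero C x y \<oplus> f = f"
proof -
  interpret comm_group "hom_group C (Dom C f) (Cod C f)" using assms by (intro hom_group_comm) auto
  show "f \<oplus> Zero C x y = f" "Zero C x y \<oplus> f = f"
    using r_one[of f] l_one[of f] assms by (auto simp: hom_group_def Hom_iff)
qed

lemma Add_Neg [simp]:
  assumes "f \<in> Arr C"
  shows "f \<oplus> Neg C f = Zero C (Dom C f) (Cod C f)" "Neg C f \<oplus> f = Zero C (Dom C f) (Cod C f)"
proof -
  interpret comm_group "hom_group C (Dom C f) (Cod C f)" using assms by (intro hom_group_comm) auto
  show "f \<oplus> Neg C f = Zero C (Dom C f) (Cod C f)" "Neg C f \<oplus> f = Zero C (Dom C f) (Cod C f)"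
    using r_inv[of f] l_inv[of f] assms by (auto simp: hom_group_def Hom_iff Neg_def)
qed

lemma Add_Neg_cancel [simp]:
  assumes "f \<in> Arr C" "g \<in> Arr C" "Dom C g = Dom C f" "Cod C g = Cod C f"
  shows "f \<oplus> (Neg C f \<oplus> g) = g" "Neg C f \<oplus> (f \<oplus> g) = g"
  using Add_assoc[of f "Neg C f" g] Add_assoc[of "Neg C f" f g] assms by simp_all

lemma Add_left_cancel:
  assumes "f \<oplus> g = f \<oplus> h" "f \<in> Arr C" "g \<in> Arr C" "h \<in> Arr C" "Dom C g = Dom C f"
    "Cod C g = Cod C f" "Dom C h = Dom C f" "Cod C h = Cod C f"
  shows "g = h"
proof -
  have "g = Neg C f \<oplus> (f \<oplus> g)" using assms(2-) by simp
  also have "\<dots> = Neg C f \<oplus> (f \<oplus> h)" by (simp only: assms(1))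
  also have "\<dots> = h" using assms(2-) by simp
  finally show ?thesis .
qed

lemma Neg_unique:
  assumes "f \<oplus> g = Zero C (Dom C f) (Cod C f)" "f \<in> Arr C" "g \<in> Arr C" "Dom C g = Dom C f"
    "Cod C g = Cod C f"
  shows "g = Neg C f"
  using Add_left_cancel[of f g "Neg C f"] assms by simp

lemma Comp_Add:
  "\<lbrakk>f \<in> Arr C; f' \<in> Arr C; g \<in> Arr C; Dom C f' = Dom C f; Cod C f' = Cod C f; Dom C g = Cod C f\<rbrakk>
    \<Longrightarrow> g \<cdot> (f \<oplus> f') = (g \<cdot> f) \<oplus> (g \<cdot> f')"
  "\<lbrakk>f \<in> Arr C; g \<in> Arr C; g' \<in> Arr C; Dom C g = Cod C f; Dom C g' = Cod C f; Cod C g' = Cod C g\<rbrakk>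
    \<Longrightarrow> (g \<oplus> g') \<cdot> f = (g \<cdot> f) \<oplus> (g' \<cdot> f)"
  using Comp_Add_right[of f "Dom C f" "Cod C f" f' g "Cod C g"]
    Comp_Add_left[of f "Dom C f" "Cod C f" g "Cod C g" g'] by (auto simp: Hom_iff)

lemma Comp_Zero [simp]:
  assumes "f \<in> Arr C"
  shows "Dom C f = y \<Longrightarrow> x \<in> Obj C \<Longrightarrow> f \<cdot> Zero C x y = Zero C x (Cod C f)"
    "Cod C f = y \<Longrightarrow> z \<in> Obj C \<Longrightarrow> Zero C y z \<cdot> f = Zero C (Dom C f) z"
proof -
  show "f \<cdot> Zero C x y = Zero C x (Cod C f)" if [simp]: "Dom C f = y" "x \<in> Obj C"
  proof -
    have [simp]: "y \<in> Obj C" using that assms Dom_in_Obj by blast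
    let ?z = "f \<cdot> Zero C x y"
    have "?z = f \<cdot> (Zero C x y \<oplus> Zero C x y)" by simp
    also have "\<dots> = ?z \<oplus> ?z" using assms by (subst Comp_Add) auto
    finally have "?z \<oplus> ?z = ?z \<oplus> Zero C x (Cod C f)" using assms by simp
    then show ?thesis using assms by (intro Add_left_cancel[of ?z ?z]) auto
  qed
  show "Zero C y z \<cdot> f = Zero C (Dom C f) z" if [simp]: "Cod C f = y" "z \<in> Obj C"
  proof -
    have [simp]: "y \<in> Obj C" using that assms Cod_in_Obj by blast
    let ?z = "Zero C y z \<cdot> f"
    have "?z = (Zero C y z \<oplus> Zero C y z) \<cdot> f" by simp
    also have "\<dots> = ?z \<oplus> ?z" using assms by (subst Comp_Add) auto
    finally have "?z \<oplus> ?z = ?z \<oplus> Zero C (Dom C f) z" using assms by simp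
    then show ?thesis using assms by (intro Add_left_cancel[of ?z ?z]) auto
  qed
qed

lemma Comp_Neg [simp]:
  assumes "f \<in> Arr C" "g \<in> Arr C" "Dom C g = Cod C f"
  shows "g \<cdot> Neg C f = Neg C (g \<cdot> f)" "Neg C g \<cdot> f = Neg C (g \<cdot> f)"
proof -
  show "g \<cdot> Neg C f = Neg C (g \<cdot> f)"
    by (rule Neg_unique) (use assms in \<open>auto simp: Comp_Add(1)[symmetric]\<close>)
  show "Neg C g \<cdot> f = Neg C (g \<cdot> f)"
    by (rule Neg_unique) (use assms in \<open>auto simp: Comp_Add(2)[symmetric]\<close>)
qed

lemma Neg_Zero [simp]: "x \<in> Obj C \<Longrightarrow> y \<in> Obj C \<Longrightarrow> Neg C (Zero C x y) = Zero C x y"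
  by (rule Neg_unique[symmetric]) auto

lemma Neg_Neg [simp]: "f \<in> Arr C \<Longrightarrow> Neg C (Neg C f) = f"
  by (rule Neg_unique[symmetric]) auto

lemma Neg_Add:
  assumes "f \<in> Arr C" "g \<in> Arr C" "Dom C g = Dom C f" "Cod C g = Cod C f"
  shows "Neg C (f \<oplus> g) = Neg C f \<oplus> Neg C g"
  by (rule Neg_unique[symmetric]) (use assms in \<open>auto simp: Add_ac\<close>)

end

lemma (in preadditive_category) Neg_inject:
  "\<lbrakk>Neg C f = Neg C g; f \<in> Arr C; g \<in> Arr C\<rbrakk> \<Longrightarrow> f = g"
  by (metis Neg_Neg)

text \<open>Sorting by \<open>Add_ac\<close> can leave a foreign summand between a morphism and its
  negative, where \<open>Add_Neg_cancel\<close> does not apply.\<close>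

lemma (in preadditive_category) Add_Neg_cancel_left_commute:
  assumes "f \<in> Arr C" "g \<in> Arr C" "h \<in> Arr C" "Dom C g = Dom C f" "Cod C g = Cod C f"
    "Dom C h = Dom C f" "Cod C h = Cod C f"
  shows "f \<oplus> (g \<oplus> (Neg C f \<oplus> h)) = g \<oplus> h"
  using Add_left_commute[of f g "Neg C f \<oplus> h"] assms by simp

section \<open>Isomorphisms and equivalences of categories\<close>

lemma is_isoE:
  assumes "is_iso C f" "f \<in> Hom C x y"
  obtains g where "g \<in> Hom C y x" "g \<cdot>\<^bsub>C\<^esub> f = Idt C x" "f \<cdot>\<^bsub>C\<^esub> g = Idt C y"
  using assms by (auto simp: is_iso_def Hom_iff)

lemma is_isoI:
  assumes "f \<in> Hom C x y" "g \<in> Hom C y x" "g \<cdot>\<^bsub>C\<^esub> f = Idt C x" "f \<cdot>\<^bsub>C\<^esub> g = Idt C y"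
  shows "is_iso C f"
  using assms by (auto simp: is_iso_def Hom_iff)

context category
begin

lemma is_iso_Idt: "x \<in> Obj C \<Longrightarrow> is_iso C (Idt C x)"
  by (rule is_isoI[of _ _ x x "Idt C x"]) (auto simp: Hom_iff)

lemma is_iso_Comp:
  assumes "is_iso C f" "is_iso C g" "f \<in> Hom C x y" "g \<in> Hom C y z"
  shows "is_iso C (g \<cdot> f)"
proof -
  obtain f' where f': "f' \<in> Hom C y x" "f' \<cdot> f = Idt C x" "f \<cdot> f' = Idt C y"
    using is_isoE[OF assms(1,3)] .
  obtain g' where g': "g' \<in> Hom C z y" "g' \<cdot> g = Idt C y" "g \<cdot> g' = Idt C z"
    using is_isoE[OF assms(2,4)] .
  note ty = assms(3,4)[unfolded Hom_iff] f'(1)[unfolded Hom_iff] g'(1)[unfolded Hom_iff] Hom_Obj[OF f'(1)] Hom_Obj[OF g'(1)]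
  show ?thesis
    by (rule is_isoI[of _ _ x z "f' \<cdot> g'"])
      (use ty in \<open>simp_all add: Hom_iff f'(2,3) g'(2,3) f'(2)[THEN Comp_eq_Arr] g'(3)[THEN Comp_eq_Arr]
        g'(2)[THEN Comp_eq_Arr] f'(3)[THEN Comp_eq_Arr]\<close>)
qed

text \<open>If \<open>l\<close> inverts \<open>g \<cdot> f\<close> on the left and \<open>r\<close>
  inverts \<open>f \<cdot> g\<close> on the right, then \<open>l \<cdot> g\<close> is a left inverse
  and \<open>g \<cdot> r\<close> a right inverse of \<open>f\<close>, and the two agree.\<close>

lemma is_iso_of_two_sided:
  assumes "is_iso C (g \<cdot> f)" "is_iso C (f \<cdot> g)" "f \<in> Hom C x y" "g \<in> Hom C y x"
  shows "is_iso C f"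
proof -
  have "g \<cdot> f \<in> Hom C x x" "f \<cdot> g \<in> Hom C y y" using assms by (auto simp: Hom_iff)
  note h = this
  obtain l where l: "l \<in> Hom C x x" "l \<cdot> g \<cdot> f = Idt C x" using is_isoE[OF assms(1) h(1)] .
  obtain r where r: "r \<in> Hom C y y" "(f \<cdot> g) \<cdot> r = Idt C y" using is_isoE[OF assms(2) h(2)] .
  have ty: "l \<in> Arr C" "Dom C l = x" "Cod C l = x" "r \<in> Arr C" "Dom C r = y" "Cod C r = y"
    "f \<in> Arr C" "Dom C f = x" "Cod C f = y" "g \<in> Arr C" "Dom C g = y" "Cod C g = x"
    using assms l r by (auto simp: Hom_iff)
  have fgr: "f \<cdot> g \<cdot> r = Idt C y" using r(2) ty by simp
  have "l \<cdot> g = (l \<cdot> g) \<cdot> (f \<cdot> g \<cdot> r)" using fgr ty by auto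
  also have "\<dots> = (l \<cdot> g \<cdot> f) \<cdot> g \<cdot> r" using ty by simp
  also have "\<dots> = g \<cdot> r" unfolding l(2) using ty by auto
  finally have lg: "l \<cdot> g = g \<cdot> r" .
  have "(l \<cdot> g) \<cdot> f = Idt C x" "f \<cdot> l \<cdot> g = Idt C y" using l(2) ty fgr by (simp, simp add: lg)
  then show ?thesis
    by (intro is_isoI[of _ _ x y "l \<cdot> g"]) (use ty in \<open>auto simp: Hom_iff\<close>)
qed

text \<open>Inserts \<open>a \<cdot> a'\<close> on the right of \<open>f'\<close> and cancels
  \<open>b' \<cdot> b\<close> on the left. It serves to turn isomorphisms of triangles
  around.\<close>

lemma inverse_square:
  assumes "b \<cdot> f = f' \<cdot> a" "f \<in> Hom C x y" "f' \<in> Hom C x' y'" "a \<in> Hom C x x'" "b \<in> Hom C y y'"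
    "a' \<in> Hom C x' x" "b' \<in> Hom C y' y" "a \<cdot> a' = Idt C x'" "b' \<cdot> b = Idt C y"
  shows "b' \<cdot> f' = f \<cdot> a'"
proof -
  note ty = assms(2-7)[unfolded Hom_iff]
  have "b' \<cdot> f' = b' \<cdot> (f' \<cdot> a) \<cdot> a'" using ty assms(8) Hom_Obj[OF assms(3)] by simp
  also have "\<dots> = (b' \<cdot> b) \<cdot> f \<cdot> a'" unfolding assms(1)[symmetric] using ty by simp
  also have "\<dots> = f \<cdot> a'" unfolding assms(9) using ty Hom_Obj[OF assms(2)] by simp
  finally show ?thesis .
qed

end

section \<open>Functors and equivalences\<close>

lemma is_functorD:
  assumes "is_functor C D \<Phi>"
  shows "x \<in> Obj C \<Longrightarrow> on_obj \<Phi> x \<in> Obj D"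
    "x \<in> Obj C \<Longrightarrow> on_arr \<Phi> (Idt C x) = Idt D (on_obj \<Phi> x)"
    "f \<in> Arr C \<Longrightarrow> on_arr \<Phi> f \<in> Arr D"
    "f \<in> Arr C \<Longrightarrow> Dom D (on_arr \<Phi> f) = on_obj \<Phi> (Dom C f)"
    "f \<in> Arr C \<Longrightarrow> Cod D (on_arr \<Phi> f) = on_obj \<Phi> (Cod C f)"
    "f \<in> Arr C \<Longrightarrow> g \<in> Arr C \<Longrightarrow> Dom C g = Cod C f \<Longrightarrow>
      on_arr \<Phi> (g \<cdot>\<^bsub>C\<^esub> f) = on_arr \<Phi> g \<cdot>\<^bsub>D\<^esub> on_arr \<Phi> f"
  using assms by (auto simp: is_functor_def Hom_iff)

text \<open>\<open>is_equivalence\<close> asks for an explicit quasi-inverse. Choice supplies an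
  object \<open>X z\<close> with an isomorphism \<open>e z\<close> from its image to
  \<open>z\<close>, and fullness supplies \<open>P g\<close> over the conjugate of \<open>g\<close>
  by these isomorphisms.\<close>

lemma is_equivalenceI:
  assumes "category C" "category D" "is_functor C D \<Phi>"
    and full: "\<And>x y g. \<lbrakk>x \<in> Obj C; y \<in> Obj C; g \<in> Hom D (on_obj \<Phi> x) (on_obj \<Phi> y)\<rbrakk>
      \<Longrightarrow> \<exists>f \<in> Hom C x y. on_arr \<Phi> f = g"
    and faithful: "\<And>x y f g. \<lbrakk>f \<in> Hom C x y; g \<in> Hom C x y; on_arr \<Phi> f = on_arr \<Phi> g\<rbrakk> \<Longrightarrow> f = g"
    and dense: "\<And>z. z \<in> Obj D \<Longrightarrow> \<exists>x \<in> Obj C. \<exists>f \<in> Hom D (on_obj \<Phi> x) z. is_iso D f"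
  shows "is_equivalence C D \<Phi>"
proof -
  interpret C: category C by fact
  interpret D: category D by fact
  note F = is_functorD[OF assms(3)]
  have "\<forall>z \<in> Obj D. \<exists>x e e'. x \<in> Obj C \<and> e \<in> Hom D (on_obj \<Phi> x) z \<and> e' \<in> Hom D z (on_obj \<Phi> x) \<and>
      e' \<cdot>\<^bsub>D\<^esub> e = Idt D (on_obj \<Phi> x) \<and> e \<cdot>\<^bsub>D\<^esub> e' = Idt D z"
    using dense is_isoE by metis
  then obtain X e e' where X: "\<And>z. z \<in> Obj D \<Longrightarrow> X z \<in> Obj C"
    and e: "\<And>z. z \<in> Obj D \<Longrightarrow> e z \<in> Hom D (on_obj \<Phi> (X z)) z"
    and e': "\<And>z. z \<in> Obj D \<Longrightarrow> e' z \<in> Hom D z (on_obj \<Phi> (X z))"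
    and ee: "\<And>z. z \<in> Obj D \<Longrightarrow> e' z \<cdot>\<^bsub>D\<^esub> e z = Idt D (on_obj \<Phi> (X z))"
      "\<And>z. z \<in> Obj D \<Longrightarrow> e z \<cdot>\<^bsub>D\<^esub> e' z = Idt D z"
    by metis
  have ety: "e z \<in> Arr D" "Dom D (e z) = on_obj \<Phi> (X z)" "Cod D (e z) = z"
    "e' z \<in> Arr D" "Dom D (e' z) = z" "Cod D (e' z) = on_obj \<Phi> (X z)" if "z \<in> Obj D" for z
    using e[OF that] e'[OF that] by (auto simp: Hom_iff)
  have "\<forall>g \<in> Arr D. \<exists>f. f \<in> Hom C (X (Dom D g)) (X (Cod D g)) \<and>
      on_arr \<Phi> f = e' (Cod D g) \<cdot>\<^bsub>D\<^esub> g \<cdot>\<^bsub>D\<^esub> e (Dom D g)"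
  proof
    fix g assume g: "g \<in> Arr D"
    show "\<exists>f. f \<in> Hom C (X (Dom D g)) (X (Cod D g)) \<and>
      on_arr \<Phi> f = e' (Cod D g) \<cdot>\<^bsub>D\<^esub> g \<cdot>\<^bsub>D\<^esub> e (Dom D g)"
      using full[of "X (Dom D g)" "X (Cod D g)" "e' (Cod D g) \<cdot>\<^bsub>D\<^esub> g \<cdot>\<^bsub>D\<^esub> e (Dom D g)"] X ety g
      by (auto simp: Hom_iff)
  qed
  then obtain P where P: "\<And>g. g \<in> Arr D \<Longrightarrow> P g \<in> Hom C (X (Dom D g)) (X (Cod D g))"
      "\<And>g. g \<in> Arr D \<Longrightarrow> on_arr \<Phi> (P g) = e' (Cod D g) \<cdot>\<^bsub>D\<^esub> g \<cdot>\<^bsub>D\<^esub> e (Dom D g)"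
    by metis
  have Pty: "P g \<in> Arr C" "Dom C (P g) = X (Dom D g)" "Cod C (P g) = X (Cod D g)" if "g \<in> Arr D" for g
    using P(1)[OF that] by (auto simp: Hom_iff)
  define \<Psi> where "\<Psi> = \<lparr>on_obj = X, on_arr = P\<rparr>"
  have [simp]: "on_obj \<Psi> = X" "on_arr \<Psi> = P" by (auto simp: \<Psi>_def)
  \<comment> \<open>Functoriality of \<open>P\<close> is checked after applying
    \<open>\<Phi>\<close>, where the inner factors \<open>e\<close> and \<open>e'\<close>
    cancel.\<close>
  have "P (Idt D z) = Idt C (X z)" if z: "z \<in> Obj D" for z
    by (rule faithful[of _ "X z" "X z"]) (use z X Pty P(2) ety ee F in \<open>auto simp: Hom_iff\<close>)
  moreover have "P (g \<cdot>\<^bsub>D\<^esub> f) = P g \<cdot>\<^bsub>C\<^esub> P f" if z: "f \<in> Arr D" "g \<in> Arr D" "Dom D g = Cod D f" for f g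
    by (rule faithful[of _ "X (Dom D f)" "X (Cod D g)"])
      (use z X Pty P(2) ety ee F in \<open>auto simp: Hom_iff ee(2)[THEN D.Comp_eq_Arr]\<close>)
  ultimately have \<Psi>: "is_functor D C \<Psi>"
    using X Pty unfolding is_functor_def by (auto simp: Hom_iff)
  \<comment> \<open>The unit at \<open>x\<close> is the preimage of \<open>e'\<close> at the image
    of \<open>x\<close>; it is invertible because the preimage of \<open>e\<close> there is inverse
    to it, again by faithfulness.\<close>
  have "\<forall>x \<in> Obj C. \<exists>h. h \<in> Hom C x (X (on_obj \<Phi> x)) \<and> on_arr \<Phi> h = e' (on_obj \<Phi> x)"
  proof
    fix x assume x: "x \<in> Obj C"
    show "\<exists>h. h \<in> Hom C x (X (on_obj \<Phi> x)) \<and> on_arr \<Phi> h = e' (on_obj \<Phi> x)"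
      using full[of x "X (on_obj \<Phi> x)" "e' (on_obj \<Phi> x)"] x X F(1)[OF x] e' by auto
  qed
  then obtain h where h: "\<And>x. x \<in> Obj C \<Longrightarrow> h x \<in> Hom C x (X (on_obj \<Phi> x))"
    "\<And>x. x \<in> Obj C \<Longrightarrow> on_arr \<Phi> (h x) = e' (on_obj \<Phi> x)" by metis
  have hty: "h x \<in> Arr C" "Dom C (h x) = x" "Cod C (h x) = X (on_obj \<Phi> x)" if "x \<in> Obj C" for x
    using h(1)[OF that] by (auto simp: Hom_iff)
  have "is_iso C (h x)" if x: "x \<in> Obj C" for x
  proof -
    have o: "on_obj \<Phi> x \<in> Obj D" using F x by auto
    obtain k where k: "k \<in> Hom C (X (on_obj \<Phi> x)) x" "on_arr \<Phi> k = e (on_obj \<Phi> x)"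
      using full[OF X[OF o] x e[OF o]] by blast
    have "k \<cdot>\<^bsub>C\<^esub> h x = Idt C x"
      by (rule faithful[of _ x x]) (use k x o hty[OF x] h(2)[OF x] F ee[OF o] in \<open>auto simp: Hom_iff\<close>)
    moreover have "h x \<cdot>\<^bsub>C\<^esub> k = Idt C (X (on_obj \<Phi> x))"
      by (rule faithful[of _ "X (on_obj \<Phi> x)" "X (on_obj \<Phi> x)"])
        (use k x o hty[OF x] h(2)[OF x] F ee[OF o] X[OF o] in \<open>auto simp: Hom_iff\<close>)
    ultimately show ?thesis using is_isoI[OF h(1)[OF x] k(1)] by blast
  qed
  moreover have "h (Cod C f) \<cdot>\<^bsub>C\<^esub> f = P (on_arr \<Phi> f) \<cdot>\<^bsub>C\<^esub> h (Dom C f)" if f: "f \<in> Arr C" for f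
    by (rule faithful[of _ "Dom C f" "X (on_obj \<Phi> (Cod C f))"])
      (use f hty Pty h(2) F P(2) ety ee in \<open>auto simp: Hom_iff\<close>)
  ultimately have 1: "naturally_isomorphic C C id_functor (comp_functor \<Psi> \<Phi>)"
    using h(1) unfolding naturally_isomorphic_def id_functor_def comp_functor_def
    by (intro exI[of _ h]) auto
  have "is_iso D (e z)" if "z \<in> Obj D" for z
    using is_isoI[OF e[OF that] e'[OF that] ee(1,2)[OF that]] .
  moreover have "e (Cod D f) \<cdot>\<^bsub>D\<^esub> on_arr \<Phi> (P f) = f \<cdot>\<^bsub>D\<^esub> e (Dom D f)" if f: "f \<in> Arr D" for f
    using f ety P(2) ee(2)[THEN D.Comp_eq_Arr] by auto
  ultimately have 2: "naturally_isomorphic D D (comp_functor \<Phi> \<Psi>) id_functor"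
    using e unfolding naturally_isomorphic_def id_functor_def comp_functor_def
    by (intro exI[of _ e]) auto
  show ?thesis unfolding is_equivalence_def using assms(3) \<Psi> 1 2 by blast
qed

context category
begin

lemma zero_object_iso:
  assumes "zero_object C z" "zero_object C z'" "f \<in> Hom C z z'"
  shows "is_iso C f"
proof -
  obtain g where g: "g \<in> Hom C z' z" using assms(1,2) by (auto simp: zero_object_def)
  have o: "z \<in> Obj C" "z' \<in> Obj C" using assms by (auto simp: zero_object_def)
  have "g \<cdot> f \<in> Hom C z z" "f \<cdot> g \<in> Hom C z' z'" "Idt C z \<in> Hom C z z" "Idt C z' \<in> Hom C z' z'"
    using assms(3) g o by (auto simp: Hom_iff)
  then have "g \<cdot> f = Idt C z" "f \<cdot> g = Idt C z'"
    using assms(1,2) o unfolding zero_object_def by metis+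
  then show ?thesis using is_isoI[OF assms(3) g] by blast
qed

lemma zero_object_unique_from:
  "\<lbrakk>zero_object C z; f \<in> Hom C z x; g \<in> Hom C z x\<rbrakk> \<Longrightarrow> f = g"
  using Hom_Obj(2) unfolding zero_object_def by metis

end

section \<open>The stable equality of a Frobenius category\<close>

context frobenius_category
begin

section \<open>Conflations and the chosen injective hulls\<close>

lemma Conf_simps:
  assumes "(i, p) \<in> Conf E"
  shows "i \<in> Arr E" "p \<in> Arr E" "Dom E p = Cod E i" "p \<cdot> i = Zero E (Dom E i) (Cod E p)"
  using Conf_kernel_cokernel[OF assms] by (auto simp: is_kernel_def)

lemma Conf_cokernel:
  assumes "(i, p) \<in> Conf E" "u \<in> Hom E (Cod E i) w" "u \<cdot> i = Zero E (Dom E i) w"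
  obtains t where "t \<in> Hom E (Cod E p) w" "t \<cdot> p = u"
  using Conf_kernel_cokernel[OF assms(1)] assms(2,3) unfolding is_cokernel_def by metis

lemma Conf_epi:
  assumes "(i, p) \<in> Conf E" "s \<in> Hom E (Cod E p) w" "t \<in> Hom E (Cod E p) w" "s \<cdot> p = t \<cdot> p"
  shows "s = t"
proof -
  note C = Conf_simps[OF assms(1)]
  have o: "w \<in> Obj E" using assms(2) by (rule Hom_Obj)
  have s: "s \<in> Arr E" "Dom E s = Cod E p" "Cod E s = w" "t \<in> Arr E" "Dom E t = Cod E p" "Cod E t = w"
    using assms(2,3) by (auto simp: Hom_iff)
  have "(s \<cdot> p) \<cdot> i = Zero E (Dom E i) w" using C s o by simp
  moreover have "s \<cdot> p \<in> Hom E (Cod E i) w" using C s by (simp add: Hom_iff)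
  ultimately have "\<exists>!r. r \<in> Hom E (Cod E p) w \<and> r \<cdot> p = s \<cdot> p"
    using Conf_kernel_cokernel[OF assms(1)] unfolding is_cokernel_def by blast
  then show ?thesis using assms by metis
qed

text \<open>The difference of \<open>g\<close> and \<open>h\<close> vanishes on \<open>i\<close> and
  so descends along the cokernel \<open>p\<close>. This produces the correction terms in most
  homotopy computations below.\<close>

lemma Conf_diff:
  assumes "(i, p) \<in> Conf E" "g \<in> Hom E (Cod E i) w" "h \<in> Hom E (Cod E i) w" "g \<cdot> i = h \<cdot> i"
  obtains t where "t \<in> Hom E (Cod E p) w" "g = h \<oplus> t \<cdot> p"
proof -
  note C = Conf_simps[OF assms(1)]
  have s: "g \<in> Arr E" "Dom E g = Cod E i" "Cod E g = w" "h \<in> Arr E" "Dom E h = Cod E i" "Cod E h = w"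
    using assms(2,3) by (auto simp: Hom_iff)
  obtain t where t: "t \<in> Hom E (Cod E p) w" "t \<cdot> p = g \<oplus> Neg E h"
    using Conf_cokernel[OF assms(1), of "g \<oplus> Neg E h" w] C s assms(4)
    by (auto simp: Hom_iff Comp_Add)
  show ?thesis
    by (rule that[OF t(1)]) (use s in \<open>simp add: t(2) Add_ac\<close>)
qed

lemma Conf_kernel:
  assumes "(i, p) \<in> Conf E" "u \<in> Hom E w (Dom E p)" "p \<cdot> u = Zero E w (Cod E p)"
  obtains t where "t \<in> Hom E w (Dom E i)" "i \<cdot> t = u"
  using Conf_kernel_cokernel[OF assms(1)] assms(2,3) unfolding is_kernel_def by metis

lemma Conf_mono:
  assumes "(i, p) \<in> Conf E" "s \<in> Hom E w (Dom E i)" "t \<in> Hom E w (Dom E i)" "i \<cdot> s = i \<cdot> t"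
  shows "s = t"
proof -
  note C = Conf_simps[OF assms(1)]
  have o: "w \<in> Obj E" using assms(2) by (rule Hom_Obj)
  have s: "s \<in> Arr E" "Cod E s = Dom E i" "Dom E s = w" "t \<in> Arr E" "Cod E t = Dom E i" "Dom E t = w"
    using assms(2,3) by (auto simp: Hom_iff)
  have "p \<cdot> (i \<cdot> s) = Zero E w (Cod E p)"
    using C s o Comp_eq_Arr[of p i _ s] by simp
  moreover have "i \<cdot> s \<in> Hom E w (Dom E p)" using C s by (simp add: Hom_iff)
  ultimately have "\<exists>!r. r \<in> Hom E w (Dom E i) \<and> i \<cdot> r = i \<cdot> s"
    using Conf_kernel_cokernel[OF assms(1)] unfolding is_kernel_def by blast
  then show ?thesis using assms by metis
qed

lemma injective_extend:
  assumes "(i, p) \<in> Conf E" "injective E J" "f \<in> Hom E (Dom E i) J"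
  obtains g where "g \<in> Hom E (Cod E i) J" "g \<cdot> i = f"
  using assms unfolding injective_def adm_mono_def by metis

lemma projective_lift:
  assumes "(i, p) \<in> Conf E" "projective E P" "f \<in> Hom E P (Cod E p)"
  obtains g where "g \<in> Hom E P (Dom E p)" "p \<cdot> g = f"
  using assms unfolding projective_def adm_epi_def by metis

text \<open>A whole conflation is chosen once for each object, so that the suspension is a function
  on objects and \<open>inc\<close> and \<open>prj\<close> are sure to belong to the same
  conflation.\<close>

definition hull :: "'o \<Rightarrow> 'm \<times> 'm" where
  "hull x = (SOME t. t \<in> Conf E \<and> Dom E (fst t) = x \<and> injective E (Cod E (fst t)))"

definition inc :: "'o \<Rightarrow> 'm" where "inc x = fst (hull x)"
definition prj :: "'o \<Rightarrow> 'm" where "prj x = snd (hull x)"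
definition inj_obj :: "'o \<Rightarrow> 'o" where "inj_obj x = Cod E (inc x)"
definition susp :: "'o \<Rightarrow> 'o" where "susp x = Cod E (prj x)"

lemma hull_Conf:
  assumes "x \<in> Obj E"
  shows "(inc x, prj x) \<in> Conf E" "Dom E (inc x) = x" "injective E (inj_obj x)"
proof -
  obtain i p where "(i, p) \<in> Conf E" "Dom E i = x" "injective E (Cod E i)"
    using enough_injectives[OF assms] by (auto simp: adm_mono_def)
  then have "\<exists>t. t \<in> Conf E \<and> Dom E (fst t) = x \<and> injective E (Cod E (fst t))"
    by (intro exI[of _ "(i, p)"]) simp
  from someI_ex[OF this] show "(inc x, prj x) \<in> Conf E" "Dom E (inc x) = x" "injective E (inj_obj x)"
    unfolding inc_def prj_def inj_obj_def by (simp_all add: hull_def)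
qed

lemma hull_simps [simp]:
  assumes "x \<in> Obj E"
  shows "inc x \<in> Arr E" "Dom E (inc x) = x" "Cod E (inc x) = inj_obj x"
    "prj x \<in> Arr E" "Dom E (prj x) = inj_obj x" "Cod E (prj x) = susp x"
    "inj_obj x \<in> Obj E" "susp x \<in> Obj E"
    "prj x \<cdot> inc x = Zero E x (susp x)"
  using hull_Conf[OF assms] Conf_simps[OF hull_Conf(1)[OF assms]] Cod_in_Obj[of "inc x"] Cod_in_Obj[of "prj x"]
  by (auto simp: inj_obj_def susp_def)

lemma injective_inj_obj [simp]: "x \<in> Obj E \<Longrightarrow> injective E (inj_obj x)"
  and projective_inj_obj [simp]: "x \<in> Obj E \<Longrightarrow> projective E (inj_obj x)"
  using hull_Conf(3) projective_iff_injective by auto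

lemma inc_extend:
  assumes "x \<in> Obj E" "injective E J" "f \<in> Hom E x J"
  obtains g where "g \<in> Hom E (inj_obj x) J" "g \<cdot> inc x = f"
  using injective_extend[OF hull_Conf(1)[OF assms(1)], of J f] assms by auto

lemma prj_desc:
  assumes "x \<in> Obj E" "g \<in> Hom E (inj_obj x) w" "g \<cdot> inc x = Zero E x w"
  obtains t where "t \<in> Hom E (susp x) w" "t \<cdot> prj x = g"
  using Conf_cokernel[OF hull_Conf(1)[OF assms(1)], of g w] assms by auto

lemma prj_epi:
  assumes "x \<in> Obj E" "s \<in> Hom E (susp x) w" "t \<in> Hom E (susp x) w" "s \<cdot> prj x = t \<cdot> prj x"
  shows "s = t"
  using Conf_epi[OF hull_Conf(1)[OF assms(1)], of s w t] assms by auto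

lemma prj_diff:
  assumes "x \<in> Obj E" "g \<in> Hom E (inj_obj x) w" "h \<in> Hom E (inj_obj x) w" "g \<cdot> inc x = h \<cdot> inc x"
  obtains t where "t \<in> Hom E (susp x) w" "g = h \<oplus> t \<cdot> prj x"
  using Conf_diff[OF hull_Conf(1)[OF assms(1)], of g w h] assms by auto

lemma inc_lift:
  assumes "x \<in> Obj E" "u \<in> Hom E w (inj_obj x)" "prj x \<cdot> u = Zero E w (susp x)"
  obtains t where "t \<in> Hom E w x" "inc x \<cdot> t = u"
  using Conf_kernel[OF hull_Conf(1)[OF assms(1)], of u w] assms by auto

lemma inc_mono:
  assumes "x \<in> Obj E" "s \<in> Hom E w x" "t \<in> Hom E w x" "inc x \<cdot> s = inc x \<cdot> t"
  shows "s = t"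
  using Conf_mono[OF hull_Conf(1)[OF assms(1)], of s w t] assms by auto

lemma prj_lift:
  assumes "x \<in> Obj E" "projective E P" "f \<in> Hom E P (susp x)"
  obtains g where "g \<in> Hom E P (inj_obj x)" "prj x \<cdot> g = f"
  using projective_lift[OF hull_Conf(1)[OF assms(1)], of P f] assms by auto

text \<open>A map from \<open>x\<close> into an injective object extends along the inflation
  \<open>inc x\<close>. Hence factoring through some projective-injective object amounts to
  factoring through the chosen hull of \<open>x\<close>.\<close>

lemma null_maps_iff:
  assumes "x \<in> Obj E"
  shows "n \<in> null_maps E x y \<longleftrightarrow> (\<exists>v \<in> Hom E (inj_obj x) y. n = v \<cdot> inc x)"
proof
  assume "n \<in> null_maps E x y"
  then obtain u v P where P: "injective E P" "u \<in> Hom E x P" "v \<in> Hom E P y" "n = v \<cdot> u"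
    by (auto simp: null_maps_def)
  obtain g where g: "g \<in> Hom E (inj_obj x) P" "g \<cdot> inc x = u"
    using inc_extend[OF assms P(1,2)] .
  have "v \<cdot> g \<in> Hom E (inj_obj x) y" "n = (v \<cdot> g) \<cdot> inc x"
    using P g assms by (auto simp: Hom_iff)
  then show "\<exists>v \<in> Hom E (inj_obj x) y. n = v \<cdot> inc x" ..
next
  assume "\<exists>v \<in> Hom E (inj_obj x) y. n = v \<cdot> inc x"
  then obtain v where "v \<in> Hom E (inj_obj x) y" "n = v \<cdot> inc x" by blast
  moreover have "inc x \<in> Hom E x (inj_obj x)" using assms by (simp add: Hom_iff)
  moreover have "projective E (inj_obj x)" "injective E (inj_obj x)" using assms by simp_all
  ultimately show "n \<in> null_maps E x y" unfolding null_maps_def by (intro CollectI exI conjI)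
qed

text \<open>The null map is kept in the normal form of \<open>null_maps_iff\<close>, as a multiple
  of the chosen \<open>inc\<close>. That this is equality in \<open>stable_category\<close> is
  \<open>stable_arr_eq_iff\<close>.\<close>

definition steq :: "'m \<Rightarrow> 'm \<Rightarrow> bool" (infix "\<approx>" 50) where
  "f \<approx> g \<longleftrightarrow> f \<in> Arr E \<and> g \<in> Arr E \<and> Dom E f = Dom E g \<and> Cod E f = Cod E g \<and>
    (\<exists>v \<in> Hom E (inj_obj (Dom E f)) (Cod E f). f = g \<oplus> v \<cdot> inc (Dom E f))"

section \<open>Stable equality is an additive congruence\<close>

lemma steqD: "f \<approx> g \<Longrightarrow> f \<in> Arr E \<and> g \<in> Arr E \<and> Dom E f = Dom E g \<and> Cod E f = Cod E g"
  by (simp add: steq_def)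

text \<open>The difference may pass through any injective \<open>J\<close>, since \<open>u\<close>
  extends over the hull of \<open>x\<close>; proofs can thus use whichever injective object is at
  hand.\<close>

lemma steqI:
  assumes "g \<in> Hom E x y" "u \<in> Hom E x J" "v \<in> Hom E J y" "injective E J" "f = g \<oplus> v \<cdot> u"
  shows "f \<approx> g"
proof -
  have o: "x \<in> Obj E" using assms by (auto dest: Hom_Obj)
  obtain h where h: "h \<in> Hom E (inj_obj x) J" "h \<cdot> inc x = u" using inc_extend[OF o assms(4,2)] .
  have "v \<cdot> h \<in> Hom E (inj_obj x) y" "f = g \<oplus> (v \<cdot> h) \<cdot> inc x"
    using assms h o by (auto simp: Hom_iff)
  moreover have "f \<in> Arr E" "Dom E f = x" "Cod E f = y" using assms by (auto simp: Hom_iff)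
  moreover have "g \<in> Arr E" "Dom E g = x" "Cod E g = y" using assms by (auto simp: Hom_iff)
  ultimately show ?thesis unfolding steq_def by metis
qed

text \<open>With the equation as first premise, a proved decomposition instantiates
  \<open>f\<close>, \<open>g\<close>, \<open>u\<close> and \<open>v\<close> at once.\<close>

lemmas steqI' = steqI[rotated 4]

lemma steqE:
  assumes "f \<approx> g" "Dom E f = x" "Cod E f = y"
  obtains v where "v \<in> Hom E (inj_obj x) y" "f = g \<oplus> v \<cdot> inc x"
  using assms by (auto simp: steq_def)

lemma steq_refl: "f \<in> Arr E \<Longrightarrow> f \<approx> f"
  by (rule steqI[of _ "Dom E f" "Cod E f" "inc (Dom E f)" "inj_obj (Dom E f)"
        "Zero E (inj_obj (Dom E f)) (Cod E f)"]) (auto simp: Hom_iff)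

lemma steq_sym: assumes "f \<approx> g" shows "g \<approx> f"
proof -
  obtain v where v: "v \<in> Hom E (inj_obj (Dom E f)) (Cod E f)" "f = g \<oplus> v \<cdot> inc (Dom E f)"
    using steqE[OF assms] by blast
  note d = steqD[OF assms]
  have "g = f \<oplus> Neg E v \<cdot> inc (Dom E f)"
    by (subst v(2)) (use d v(1) in \<open>simp add: Hom_iff Add_ac\<close>)
  then show ?thesis using d v(1)
    by (intro steqI[of f "Dom E f" "Cod E f" "inc (Dom E f)" "inj_obj (Dom E f)" "Neg E v"]) (auto simp: Hom_iff)
qed

lemma steq_trans [trans]: assumes "f \<approx> g" "g \<approx> h" shows "f \<approx> h"
proof -
  note d = steqD[OF assms(1)] steqD[OF assms(2)]
  obtain v where v: "v \<in> Hom E (inj_obj (Dom E h)) (Cod E h)" "f = g \<oplus> v \<cdot> inc (Dom E h)"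
    using steqE[OF assms(1), of "Dom E h" "Cod E h"] d by auto
  obtain w where w: "w \<in> Hom E (inj_obj (Dom E h)) (Cod E h)" "g = h \<oplus> w \<cdot> inc (Dom E h)"
    using steqE[OF assms(2), of "Dom E h" "Cod E h"] d by auto
  have "f = h \<oplus> (w \<oplus> v) \<cdot> inc (Dom E h)"
    unfolding v(2) by (subst w(2)) (use d v(1) w(1) in \<open>simp add: Hom_iff Comp_Add Add_ac\<close>)
  then show ?thesis using d v(1) w(1)
    by (intro steqI[of h "Dom E h" "Cod E h" "inc (Dom E h)" "inj_obj (Dom E h)" "w \<oplus> v"]) (auto simp: Hom_iff)
qed

lemma steq_Comp_left:
  assumes "f \<approx> f'" "g \<in> Arr E" "Dom E g = Cod E f"
  shows "g \<cdot> f \<approx> g \<cdot> f'"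
proof -
  obtain v where v: "v \<in> Hom E (inj_obj (Dom E f)) (Cod E f)" "f = f' \<oplus> v \<cdot> inc (Dom E f)"
    using steqE[OF assms(1)] by blast
  note d = steqD[OF assms(1)]
  have "g \<cdot> f = g \<cdot> f' \<oplus> (g \<cdot> v) \<cdot> inc (Dom E f)"
    by (subst v(2)) (use d v(1) assms in \<open>simp add: Hom_iff Comp_Add\<close>)
  then show ?thesis using d v(1) assms
    by (intro steqI[of _ "Dom E f" "Cod E g" "inc (Dom E f)" "inj_obj (Dom E f)" "g \<cdot> v"]) (auto simp: Hom_iff)
qed

lemma steq_Comp_right:
  assumes "g \<approx> g'" "f \<in> Arr E" "Dom E g = Cod E f"
  shows "g \<cdot> f \<approx> g' \<cdot> f"
proof -
  obtain v where v: "v \<in> Hom E (inj_obj (Dom E g)) (Cod E g)" "g = g' \<oplus> v \<cdot> inc (Dom E g)"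
    using steqE[OF assms(1)] by blast
  note d = steqD[OF assms(1)]
  have "g \<cdot> f = g' \<cdot> f \<oplus> v \<cdot> (inc (Dom E g) \<cdot> f)"
    by (subst v(2)) (use d v(1) assms in \<open>simp add: Hom_iff Comp_Add\<close>)
  then show ?thesis using d v(1) assms
    by (intro steqI[of _ "Dom E f" "Cod E g" "inc (Dom E g) \<cdot> f" "inj_obj (Dom E g)" v]) (auto simp: Hom_iff)
qed

lemma steq_Comp:
  assumes "f \<approx> f'" "g \<approx> g'" "Dom E g = Cod E f"
  shows "g \<cdot> f \<approx> g' \<cdot> f'"
  using steq_trans[OF steq_Comp_right[OF assms(2), of f] steq_Comp_left[OF assms(1), of g']]
    steqD[OF assms(1)] steqD[OF assms(2)] assms(3) by simp

lemma steq_Add: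
  assumes "f \<approx> f'" "g \<approx> g'" "Dom E g = Dom E f" "Cod E g = Cod E f"
  shows "f \<oplus> g \<approx> f' \<oplus> g'"
proof -
  note d = steqD[OF assms(1)] steqD[OF assms(2)]
  obtain v where v: "v \<in> Hom E (inj_obj (Dom E f)) (Cod E f)" "f = f' \<oplus> v \<cdot> inc (Dom E f)"
    using steqE[OF assms(1)] by blast
  obtain w where w: "w \<in> Hom E (inj_obj (Dom E f)) (Cod E f)" "g = g' \<oplus> w \<cdot> inc (Dom E f)"
    using steqE[OF assms(2)] assms by metis
  have "f \<oplus> g = (f' \<oplus> g') \<oplus> (v \<oplus> w) \<cdot> inc (Dom E f)"
    by (subst v(2), subst w(2)) (use d v(1) w(1) assms in \<open>simp add: Hom_iff Comp_Add Add_ac\<close>)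
  then show ?thesis using d v(1) w(1) assms
    by (intro steqI[of _ "Dom E f" "Cod E f" "inc (Dom E f)" "inj_obj (Dom E f)" "v \<oplus> w"]) (auto simp: Hom_iff)
qed

end

section \<open>The suspension\<close>

context frobenius_category
begin

text \<open>\<open>g\<close> is the map on cokernels induced by some extension \<open>h\<close> of
  \<open>f\<close> to the hulls. The extension is not unique, so this is a relation; it is
  single-valued up to \<approx> by \<open>shift_steq\<close>.\<close>

definition shift :: "'m \<Rightarrow> 'm \<Rightarrow> bool" where
  "shift f g \<longleftrightarrow> f \<in> Arr E \<and> g \<in> Hom E (susp (Dom E f)) (susp (Cod E f)) \<and>
    (\<exists>h \<in> Hom E (inj_obj (Dom E f)) (inj_obj (Cod E f)).
      h \<cdot> inc (Dom E f) = inc (Cod E f) \<cdot> f \<and> g \<cdot> prj (Dom E f) = prj (Cod E f) \<cdot> h)"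

lemma shiftI:
  assumes "f \<in> Hom E x y" "g \<in> Hom E (susp x) (susp y)" "h \<in> Hom E (inj_obj x) (inj_obj y)"
    "h \<cdot> inc x = inc y \<cdot> f" "g \<cdot> prj x = prj y \<cdot> h"
  shows "shift f g"
  using assms unfolding shift_def by (auto simp: Hom_iff)

lemma shiftE:
  assumes "shift f g" "f \<in> Hom E x y"
  obtains h where "g \<in> Hom E (susp x) (susp y)" "h \<in> Hom E (inj_obj x) (inj_obj y)"
    "h \<cdot> inc x = inc y \<cdot> f" "g \<cdot> prj x = prj y \<cdot> h"
  using assms unfolding shift_def by (auto simp: Hom_iff)

lemma shift_ex:
  assumes "f \<in> Hom E x y"
  obtains g where "shift f g"
proof -
  have o: "x \<in> Obj E" "y \<in> Obj E" using assms Hom_Obj by auto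
  obtain h where h: "h \<in> Hom E (inj_obj x) (inj_obj y)" "h \<cdot> inc x = inc y \<cdot> f"
    using inc_extend[OF o(1) injective_inj_obj[OF o(2)], of "inc y \<cdot> f"] assms o by (auto simp: Hom_iff)
  have "(prj y \<cdot> h) \<cdot> inc x = Zero E x (susp y)"
    using assms h(1) o Comp_eq_Arr[OF hull_simps(9)[OF o(2)]] by (simp add: Hom_iff h(2))
  then obtain g where g: "g \<in> Hom E (susp x) (susp y)" "g \<cdot> prj x = prj y \<cdot> h"
    using prj_desc[OF o(1), of "prj y \<cdot> h" "susp y"] h o by (auto simp: Hom_iff)
  show ?thesis using that[OF shiftI[OF assms g(1) h g(2)]] .
qed

text \<open>If \<open>f\<close> is \<open>f'\<close> plus \<open>v \<cdot> inc x\<close>, then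
  \<open>h\<close> and \<open>h' \<oplus> inc y \<cdot> v\<close> agree on \<open>inc x\<close> and
  differ by some \<open>t \<cdot> prj x\<close>. After composing with \<open>prj y\<close> the term
  with \<open>v\<close> dies, and \<open>g\<close> differs from \<open>g'\<close> by
  \<open>prj y \<cdot> t\<close>, which passes through the hull of \<open>y\<close>.\<close>

lemma shift_steq:
  assumes "shift f g" "shift f' g'" "f \<approx> f'"
  shows "g \<approx> g'"
proof -
  define x y where "x = Dom E f" and "y = Cod E f"
  have f: "f \<in> Hom E x y" "f' \<in> Hom E x y" using steqD[OF assms(3)] by (auto simp: x_def y_def Hom_iff)
  have o: "x \<in> Obj E" "y \<in> Obj E" using f Hom_Obj by auto
  obtain h where h: "g \<in> Hom E (susp x) (susp y)" "h \<in> Hom E (inj_obj x) (inj_obj y)"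
    "h \<cdot> inc x = inc y \<cdot> f" "g \<cdot> prj x = prj y \<cdot> h"
    using shiftE[OF assms(1) f(1)] .
  obtain h' where h': "g' \<in> Hom E (susp x) (susp y)" "h' \<in> Hom E (inj_obj x) (inj_obj y)"
    "h' \<cdot> inc x = inc y \<cdot> f'" "g' \<cdot> prj x = prj y \<cdot> h'"
    using shiftE[OF assms(2) f(2)] .
  obtain v where v: "v \<in> Hom E (inj_obj x) y" "f = f' \<oplus> v \<cdot> inc x"
    using steqE[OF assms(3)] unfolding x_def y_def by blast
  have "h \<cdot> inc x = (h' \<oplus> inc y \<cdot> v) \<cdot> inc x"
    using h' v o f h by (simp add: Hom_iff Comp_Add)
  then obtain t where t: "t \<in> Hom E (susp x) (inj_obj y)" "h = (h' \<oplus> inc y \<cdot> v) \<oplus> t \<cdot> prj x"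
    using prj_diff[OF o(1) h(2), of "h' \<oplus> inc y \<cdot> v"] h' v o by (auto simp: Hom_iff)
  have "g \<cdot> prj x = (g' \<oplus> prj y \<cdot> t) \<cdot> prj x"
    unfolding h(4) t(2) using h' v o f h t(1) Comp_eq_Arr[OF hull_simps(9)[OF o(2)]]
    by (simp add: Hom_iff Comp_Add)
  then have "g = g' \<oplus> prj y \<cdot> t"
    by (rule prj_epi[OF o(1), rotated 2]) (use h h' t o in \<open>auto simp: Hom_iff\<close>)
  then show ?thesis
    by (rule steqI'[OF _ h'(1) t(1) _ injective_inj_obj[OF o(2)]])(use o in \<open>auto simp: Hom_iff\<close>)
qed

lemma shift_Idt: assumes "x \<in> Obj E" shows "shift (Idt E x) (Idt E (susp x))"
  by (rule shiftI[of _ x x _ "Idt E (inj_obj x)"]) (use assms in \<open>auto simp: Hom_iff\<close>)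

lemma shift_Comp:
  assumes "shift f f'" "shift g g'" "Dom E g = Cod E f"
  shows "shift (g \<cdot> f) (g' \<cdot> f')"
proof -
  define x y z where "x = Dom E f" and "y = Cod E f" and "z = Cod E g"
  have f: "f \<in> Hom E x y" "g \<in> Hom E y z" using assms by (auto simp: x_def y_def z_def shift_def Hom_iff)
  have o: "x \<in> Obj E" "y \<in> Obj E" "z \<in> Obj E" using f Hom_Obj by auto
  obtain h where h: "f' \<in> Hom E (susp x) (susp y)" "h \<in> Hom E (inj_obj x) (inj_obj y)"
    "h \<cdot> inc x = inc y \<cdot> f" "f' \<cdot> prj x = prj y \<cdot> h"
    using shiftE[OF assms(1) f(1)] .
  obtain k where k: "g' \<in> Hom E (susp y) (susp z)" "k \<in> Hom E (inj_obj y) (inj_obj z)"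
    "k \<cdot> inc y = inc z \<cdot> g" "g' \<cdot> prj y = prj z \<cdot> k"
    using shiftE[OF assms(2) f(2)] .
  show ?thesis
    by (rule shiftI[of _ x z _ "k \<cdot> h"])
      (use f o h k Comp_eq_Comp[OF k(3)] Comp_eq_Comp[OF k(4)] in \<open>auto simp: Hom_iff\<close>)
qed

lemma shift_Add:
  assumes "shift f f'" "shift g g'" "Dom E g = Dom E f" "Cod E g = Cod E f"
  shows "shift (f \<oplus> g) (f' \<oplus> g')"
proof -
  define x y where "x = Dom E f" and "y = Cod E f"
  have f: "f \<in> Hom E x y" "g \<in> Hom E x y" using assms by (auto simp: x_def y_def shift_def Hom_iff)
  have o: "x \<in> Obj E" "y \<in> Obj E" using f Hom_Obj by auto
  obtain h where h: "f' \<in> Hom E (susp x) (susp y)" "h \<in> Hom E (inj_obj x) (inj_obj y)"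
    "h \<cdot> inc x = inc y \<cdot> f" "f' \<cdot> prj x = prj y \<cdot> h"
    using shiftE[OF assms(1) f(1)] .
  obtain k where k: "g' \<in> Hom E (susp x) (susp y)" "k \<in> Hom E (inj_obj x) (inj_obj y)"
    "k \<cdot> inc x = inc y \<cdot> g" "g' \<cdot> prj x = prj y \<cdot> k"
    using shiftE[OF assms(2) f(2)] .
  show ?thesis
    by (rule shiftI[of _ x y _ "h \<oplus> k"]) (use f o h k in \<open>auto simp: Hom_iff Comp_Add\<close>)
qed

text \<open>Here hulls are used as projectives. The null map relating \<open>g\<close> and
  \<open>g'\<close> lifts through \<open>prj y\<close>; once \<open>h'\<close> is corrected by the
  lift, its difference from \<open>h\<close> is killed by \<open>prj y\<close> and so factors
  through \<open>inc y\<close> by some \<open>l\<close>. This \<open>l\<close> exhibits the stable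
  equality of \<open>f\<close> and \<open>f'\<close>.\<close>

lemma shift_faithful:
  assumes "shift f g" "shift f' g'" "g \<approx> g'" "f \<in> Hom E x y" "f' \<in> Hom E x y"
  shows "f \<approx> f'"
proof -
  have o: "x \<in> Obj E" "y \<in> Obj E" using assms Hom_Obj by auto
  obtain h where h: "g \<in> Hom E (susp x) (susp y)" "h \<in> Hom E (inj_obj x) (inj_obj y)"
    "h \<cdot> inc x = inc y \<cdot> f" "g \<cdot> prj x = prj y \<cdot> h"
    using shiftE[OF assms(1,4)] .
  obtain h' where h': "g' \<in> Hom E (susp x) (susp y)" "h' \<in> Hom E (inj_obj x) (inj_obj y)"
    "h' \<cdot> inc x = inc y \<cdot> f'" "g' \<cdot> prj x = prj y \<cdot> h'"
    using shiftE[OF assms(2,5)] .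
  let ?s = "susp x"
  obtain v where v: "v \<in> Hom E (inj_obj ?s) (susp y)" "g = g' \<oplus> v \<cdot> inc ?s"
    using steqE[OF assms(3), of ?s "susp y"] h(1) by (auto simp: Hom_iff)
  obtain c where c: "c \<in> Hom E (inj_obj ?s) (inj_obj y)" "prj y \<cdot> c = v"
    using prj_lift[OF o(2) _ v(1)] o by auto
  \<comment> \<open>The correction restores equality after \<open>prj y\<close> without changing the
    restriction to \<open>inc x\<close>, because \<open>prj x \<cdot> inc x\<close> is zero.\<close>
  let ?k = "h' \<oplus> c \<cdot> (inc ?s \<cdot> prj x)"
  have "prj y \<cdot> h = g \<cdot> prj x" using h by simp
  also have "\<dots> = prj y \<cdot> ?k"
    unfolding v(2) using o h' c v(1) Comp_eq_Arr[OF c(2)] by (simp add: Hom_iff Comp_Add)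
  finally have "prj y \<cdot> (h \<oplus> Neg E ?k) = Zero E (inj_obj x) (susp y)"
    using o h(2) h'(2) c(1) by (auto simp: Hom_iff Comp_Add)
  then obtain l where l: "l \<in> Hom E (inj_obj x) y" "inc y \<cdot> l = h \<oplus> Neg E ?k"
    using inc_lift[OF o(2), of "h \<oplus> Neg E ?k" "inj_obj x"] o h(2) h'(2) c(1) by (auto simp: Hom_iff)
  have hk: "h = ?k \<oplus> inc y \<cdot> l" unfolding l(2) using o h(2) h'(2) c(1) by (simp add: Hom_iff Add_ac)
  have "inc y \<cdot> f = h \<cdot> inc x" using h by simp
  also have "\<dots> = inc y \<cdot> (f' \<oplus> l \<cdot> inc x)"
    by (subst hk) (use o h'(2,3) c(1) l(1) assms(5) in \<open>simp add: Hom_iff Comp_Add\<close>)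
  finally have "f = f' \<oplus> l \<cdot> inc x"
    by (rule inc_mono[OF o(2), rotated 2]) (use assms(4,5) o l(1) in \<open>auto simp: Hom_iff\<close>)
  then show ?thesis
    by (rule steqI'[OF _ assms(5) _ l(1) injective_inj_obj[OF o(1)]]) (use o in \<open>auto simp: Hom_iff\<close>)
qed

text \<open>The hull of \<open>x\<close> is projective, so \<open>g \<cdot> prj x\<close> lifts
  through \<open>prj y\<close>. The lift sends \<open>inc x\<close> into the kernel of
  \<open>prj y\<close>, and this restriction is the required \<open>f\<close>.\<close>

lemma shift_full:
  assumes "x \<in> Obj E" "y \<in> Obj E" "g \<in> Hom E (susp x) (susp y)"
  obtains f where "f \<in> Hom E x y" "shift f g"
proof -
  obtain h where h: "h \<in> Hom E (inj_obj x) (inj_obj y)" "prj y \<cdot> h = g \<cdot> prj x"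
    using prj_lift[OF assms(2) projective_inj_obj[OF assms(1)], of "g \<cdot> prj x"] assms by (auto simp: Hom_iff)
  have "prj y \<cdot> (h \<cdot> inc x) = Zero E x (susp y)"
    using Comp_eq_Comp[OF h(2), of "inc x"] h(1) assms by (simp add: Hom_iff)
  then obtain f where f: "f \<in> Hom E x y" "inc y \<cdot> f = h \<cdot> inc x"
    using inc_lift[OF assms(2), of "h \<cdot> inc x" x] h(1) assms by (auto simp: Hom_iff)
  show ?thesis
    by (rule that[OF f(1) shiftI[OF f(1) assms(3) h(1)]]) (use f h in auto)
qed

definition stable_inverse :: "'m \<Rightarrow> 'm \<Rightarrow> bool" where
  "stable_inverse f g \<longleftrightarrow> f \<in> Arr E \<and> g \<in> Hom E (Cod E f) (Dom E f) \<and>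
    g \<cdot> f \<approx> Idt E (Dom E f) \<and> f \<cdot> g \<approx> Idt E (Cod E f)"

text \<open>Let \<open>x\<close> be the kernel of a deflation from a projective onto
  \<open>z\<close>. The projective is also injective, so this conflation is a second injective hull
  of \<open>x\<close>. Comparing it with the chosen one, in the manner of Schanuel's lemma,
  identifies \<open>z\<close> stably with the suspension of \<open>x\<close>.\<close>

lemma susp_surj:
  assumes "z \<in> Obj E"
  obtains x f g where "x \<in> Obj E" "f \<in> Hom E (susp x) z" "stable_inverse f g"
proof -
  obtain i q where iq: "(i, q) \<in> Conf E" "Cod E q = z" and P: "projective E (Dom E q)" "injective E (Dom E q)"
    using enough_projectives[OF assms] projective_iff_injective by (auto simp: adm_epi_def)
  note C = Conf_simps[OF iq(1)]
  define x p where "x = Dom E i" and "p = Cod E i"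
  note d = C[unfolded C(3), folded x_def p_def] and d' = x_def[symmetric] p_def[symmetric] C(3)[folded p_def]
  have o: "x \<in> Obj E" "p \<in> Obj E" using C by (auto simp: x_def p_def)
  have J: "injective E p" using P C by (simp add: p_def)
  obtain a where a: "a \<in> Hom E p (inj_obj x)" "a \<cdot> i = inc x"
    using injective_extend[OF iq(1) injective_inj_obj[OF o(1)], of "inc x"] o d' by (auto simp: Hom_iff)
  obtain b where b: "b \<in> Hom E (inj_obj x) p" "b \<cdot> inc x = i"
    using inc_extend[OF o(1) J, of i] C d' by (auto simp: Hom_iff)
  have ab: "a \<in> Arr E" "Dom E a = p" "Cod E a = inj_obj x" "b \<in> Arr E" "Dom E b = inj_obj x" "Cod E b = p"
    using a b by (auto simp: Hom_iff)
  have "(prj x \<cdot> a) \<cdot> i = Zero E x (susp x)" using d d' a o ab by simp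
  then obtain a' where a': "a' \<in> Hom E z (susp x)" "a' \<cdot> q = prj x \<cdot> a"
    using Conf_cokernel[OF iq(1), of "prj x \<cdot> a" "susp x"] d' iq(2) ab o by (auto simp: Hom_iff)
  have "(q \<cdot> b) \<cdot> inc x = Zero E x z" using d d' b o ab iq(2) by simp
  then obtain b' where b': "b' \<in> Hom E (susp x) z" "b' \<cdot> prj x = q \<cdot> b"
    using prj_desc[OF o(1), of "q \<cdot> b" z] d d' iq(2) ab o by (auto simp: Hom_iff)
  have ab': "a' \<in> Arr E" "Dom E a' = z" "Cod E a' = susp x" "b' \<in> Arr E" "Dom E b' = susp x" "Cod E b' = z"
    using a' b' by (auto simp: Hom_iff)
  \<comment> \<open>Going to the other hull and back is the identity on \<open>x\<close>, hence
    differs from the identity of \<open>p\<close> by a map through the cokernel \<open>q\<close>; on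
    \<open>z\<close> this difference becomes the null map \<open>q \<cdot> s\<close>.\<close>
  have "(b \<cdot> a) \<cdot> i = Idt E p \<cdot> i" using a b ab d d' o by simp
  then obtain s where s: "s \<in> Hom E z p" "b \<cdot> a = Idt E p \<oplus> s \<cdot> q"
    using Conf_diff[OF iq(1), of "b \<cdot> a" p "Idt E p"] ab o d' iq(2) by (auto simp: Hom_iff)
  have "(b' \<cdot> a') \<cdot> q = q \<cdot> (b \<cdot> a)"
    using ab ab' d d' iq(2) o a'(2) Comp_eq_Comp[OF b'(2)] by simp
  also have "\<dots> = (Idt E z \<oplus> q \<cdot> s) \<cdot> q"
    unfolding s(2) using d d' iq(2) s(1) assms o by (simp add: Hom_iff Comp_Add)
  finally have "b' \<cdot> a' = Idt E z \<oplus> q \<cdot> s"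
    by (rule Conf_epi[OF iq(1), rotated 2]) (use d d' iq(2) s(1) assms ab' in \<open>auto simp: Hom_iff\<close>)
  then have 1: "b' \<cdot> a' \<approx> Idt E z"
    by (rule steqI'[OF _ _ s(1) _ J]) (use assms d d' iq(2) in \<open>auto simp: Hom_iff\<close>)
  have "(a \<cdot> b) \<cdot> inc x = Idt E (inj_obj x) \<cdot> inc x" using a b ab d d' o by simp
  then obtain r where r: "r \<in> Hom E (susp x) (inj_obj x)" "a \<cdot> b = Idt E (inj_obj x) \<oplus> r \<cdot> prj x"
    using prj_diff[OF o(1), of "a \<cdot> b" "inj_obj x" "Idt E (inj_obj x)"] ab o by (auto simp: Hom_iff)
  have "(a' \<cdot> b') \<cdot> prj x = prj x \<cdot> (a \<cdot> b)"
    using ab ab' d d' iq(2) o b'(2) Comp_eq_Comp[OF a'(2)] by simp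
  also have "\<dots> = (Idt E (susp x) \<oplus> prj x \<cdot> r) \<cdot> prj x"
    unfolding r(2) using r(1) o by (simp add: Hom_iff Comp_Add)
  finally have "a' \<cdot> b' = Idt E (susp x) \<oplus> prj x \<cdot> r"
    by (rule prj_epi[OF o(1), rotated 2]) (use r(1) o ab' in \<open>auto simp: Hom_iff\<close>)
  then have 2: "a' \<cdot> b' \<approx> Idt E (susp x)"
    by (rule steqI'[OF _ _ r(1) _ injective_inj_obj[OF o(1)]]) (use o in \<open>auto simp: Hom_iff\<close>)
  show ?thesis
    by (rule that[OF o(1) b'(1), of a']) (use 1 2 a' ab' in \<open>auto simp: stable_inverse_def\<close>)
qed

end

section \<open>Cones\<close>

context frobenius_category
begin

text \<open>The pushout of the hull inclusion along \<open>u\<close> has legs \<open>v\<close> and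
  \<open>m\<close>; \<open>w\<close> is the map out of it that is zero on the first leg and
  \<open>prj\<close> on the second. Everything is an argument of the predicate, so any pushout may
  serve as a cone.\<close>

definition cone :: "'m \<Rightarrow> 'o \<Rightarrow> 'm \<Rightarrow> 'm \<Rightarrow> 'm \<Rightarrow> bool" where
  "cone u c v w m \<longleftrightarrow> u \<in> Arr E \<and> c \<in> Obj E \<and> v \<in> Hom E (Cod E u) c \<and>
    w \<in> Hom E c (susp (Dom E u)) \<and> m \<in> Hom E (inj_obj (Dom E u)) c \<and>
    m \<cdot> inc (Dom E u) = v \<cdot> u \<and>
    w \<cdot> v = Zero E (Cod E u) (susp (Dom E u)) \<and> w \<cdot> m = prj (Dom E u) \<and>
    (\<forall>z. \<forall>a \<in> Hom E (Cod E u) z. \<forall>b \<in> Hom E (inj_obj (Dom E u)) z.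
      b \<cdot> inc (Dom E u) = a \<cdot> u \<longrightarrow> (\<exists>!t. t \<in> Hom E c z \<and> t \<cdot> v = a \<and> t \<cdot> m = b))"

lemma coneD:
  assumes "cone u c v w m" "u \<in> Hom E x y"
  shows "v \<in> Hom E y c" "w \<in> Hom E c (susp x)" "m \<in> Hom E (inj_obj x) c"
    "m \<cdot> inc x = v \<cdot> u" "w \<cdot> v = Zero E y (susp x)" "w \<cdot> m = prj x" "c \<in> Obj E" "x \<in> Obj E" "y \<in> Obj E"
  using assms by (auto simp: cone_def Hom_iff)

lemma cone_map:
  assumes "cone u c v w m" "u \<in> Hom E x y" "a \<in> Hom E y z" "b \<in> Hom E (inj_obj x) z"
    "b \<cdot> inc x = a \<cdot> u"
  obtains t where "t \<in> Hom E c z" "t \<cdot> v = a" "t \<cdot> m = b"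
proof -
  have "\<exists>!t. t \<in> Hom E c z \<and> t \<cdot> v = a \<and> t \<cdot> m = b"
    using assms unfolding cone_def by (auto simp: Hom_iff)
  then show ?thesis using that by blast
qed

lemma cone_eq:
  assumes "cone u c v w m" "u \<in> Hom E x y" "s \<in> Hom E c z" "t \<in> Hom E c z"
    "s \<cdot> v = t \<cdot> v" "s \<cdot> m = t \<cdot> m"
  shows "s = t"
proof -
  note d = coneD[OF assms(1,2), unfolded Hom_iff]
  have "(s \<cdot> m) \<cdot> inc x = (s \<cdot> v) \<cdot> u" "s \<cdot> v \<in> Hom E y z" "s \<cdot> m \<in> Hom E (inj_obj x) z"
    using assms(2,3) d by (auto simp: Hom_iff)
  then have "\<exists>!r. r \<in> Hom E c z \<and> r \<cdot> v = s \<cdot> v \<and> r \<cdot> m = s \<cdot> m"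
    using assms(1,2) unfolding cone_def by (auto simp: Hom_iff)
  then show ?thesis using assms by metis
qed

lemma cone_ex:
  assumes "u \<in> Arr E"
  obtains c v w m where "cone u c v w m"
proof -
  define x y where "x = Dom E u" and "y = Cod E u"
  have u: "u \<in> Hom E x y" using assms by (simp add: x_def y_def Hom_iff)
  have o: "x \<in> Obj E" "y \<in> Obj E" using u Hom_Obj by auto
  have "adm_mono E (inc x)" using hull_Conf(1)[OF o(1)] by (auto simp: adm_mono_def)
  then obtain v m where p: "is_pushout E (inc x) u v m"
    using adm_mono_pushout[OF _ assms, of "inc x"] hull_simps(2)[OF o(1)] unfolding x_def[symmetric] by metis
  define c where "c = Cod E v"
  have ty: "v \<in> Hom E y c" "m \<in> Hom E (inj_obj x) c" and eq: "m \<cdot> inc x = v \<cdot> u"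
    and ump: "\<And>z a b. \<lbrakk>a \<in> Hom E y z; b \<in> Hom E (inj_obj x) z; b \<cdot> inc x = a \<cdot> u\<rbrakk>
      \<Longrightarrow> \<exists>!t. t \<in> Hom E c z \<and> t \<cdot> m = b \<and> t \<cdot> v = a"
    using p u o unfolding is_pushout_def c_def by (auto simp: Hom_iff)
  have "\<exists>!t. t \<in> Hom E c (susp x) \<and> t \<cdot> m = prj x \<and> t \<cdot> v = Zero E y (susp x)"
    by (rule ump) (use o u in \<open>auto simp: Hom_iff\<close>)
  then obtain w where w: "w \<in> Hom E c (susp x)" "w \<cdot> m = prj x" "w \<cdot> v = Zero E y (susp x)"
    by blast
  have ump': "\<exists>!t. t \<in> Hom E c z \<and> t \<cdot> v = a \<and> t \<cdot> m = b"
    if "a \<in> Hom E y z" "b \<in> Hom E (inj_obj x) z" "b \<cdot> inc x = a \<cdot> u" for z a b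
    using ump[OF that] by metis
  have "c \<in> Obj E" using ty Hom_Obj by auto
  then have "cone u c v w m"
    using assms ty eq ump' w unfolding cone_def x_def[symmetric] y_def[symmetric] by blast
  then show ?thesis by (rule that)
qed

text \<open>Let \<open>e\<close> extend \<open>inc y\<close> over the cone. Subtracting
  \<open>n \<cdot> e\<close>, a null map, makes \<open>f\<close> vanish strictly on
  \<open>v\<close>. What remains on the leg \<open>m\<close> then vanishes on \<open>inc x\<close>
  and descends to the suspension.\<close>

lemma cone_weak_cokernel:
  assumes "cone u c v w m" "u \<in> Hom E x y" "f \<in> Hom E c z" "f \<cdot> v \<approx> Zero E y z"
  obtains k where "k \<in> Hom E (susp x) z" "f \<approx> k \<cdot> w"
proof -
  note d = coneD[OF assms(1,2)] and ty = coneD(1-3,7-9)[OF assms(1,2), unfolded Hom_iff]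
    assms(2,3)[unfolded Hom_iff]
  have o: "z \<in> Obj E" using assms(3) Hom_Obj by auto
  note R = d(4-6)[THEN Comp_eq_Arr] d(4-6)
  obtain n where n: "n \<in> Hom E (inj_obj y) z" "f \<cdot> v = Zero E y z \<oplus> n \<cdot> inc y"
    using steqE[OF assms(4)] ty by auto
  have fv: "f \<cdot> v = n \<cdot> inc y" using n ty o by (simp add: Hom_iff)
  obtain h where h: "h \<in> Hom E (inj_obj x) (inj_obj y)" "h \<cdot> inc x = inc y \<cdot> u"
    using inc_extend[OF d(8) injective_inj_obj[OF d(9)], of "inc y \<cdot> u"] ty by (auto simp: Hom_iff)
  have "inc y \<in> Hom E y (inj_obj y)" using ty by (simp add: Hom_iff)
  from cone_map[OF assms(1,2) this h]
  obtain e where e: "e \<in> Hom E c (inj_obj y)" "e \<cdot> v = inc y" "e \<cdot> m = h" by blast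
  define g where "g = f \<oplus> Neg E (n \<cdot> e)"
  have ty': "n \<in> Arr E" "Dom E n = inj_obj y" "Cod E n = z" "e \<in> Arr E" "Dom E e = c" "Cod E e = inj_obj y"
    using n e by (auto simp: Hom_iff)
  have g: "g \<in> Arr E" "Dom E g = c" "Cod E g = z" using ty ty' by (auto simp: g_def)
  have gv: "g \<cdot> v = Zero E y z" using ty ty' o fv e by (simp add: g_def Comp_Add)
  have "(g \<cdot> m) \<cdot> inc x = Zero E x z" using ty g o R Comp_eq_Arr[OF gv] by simp
  then obtain k where k: "k \<in> Hom E (susp x) z" "k \<cdot> prj x = g \<cdot> m"
    using prj_desc[OF d(8), of "g \<cdot> m" z] g ty by (auto simp: Hom_iff)
  have "g = k \<cdot> w"
    by (rule cone_eq[OF assms(1,2)]) (use g ty k gv R in \<open>auto simp: Hom_iff\<close>)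
  have "f = k \<cdot> w \<oplus> n \<cdot> e"
    unfolding \<open>g = k \<cdot> w\<close>[symmetric] g_def using ty ty' by (simp add: Add_ac)
  then have "f \<approx> k \<cdot> w"
    by (rule steqI'[OF _ _ e(1) n(1)]) (use k ty in \<open>auto simp: Hom_iff\<close>)
  then show ?thesis using that k(1) by blast
qed

text \<open>The given square commutes only stably. Its null map, written as
  \<open>s \<cdot> inc x\<close>, is absorbed by sending the leg \<open>m\<close> to
  \<open>m' \<cdot> h \<oplus> v' \<cdot> s\<close>. After this repair the other two squares commute
  strictly.\<close>

lemma cone_morphism:
  assumes "cone u c v w m" "u \<in> Hom E x y" "cone u' c' v' w' m'" "u' \<in> Hom E x' y'"
    "a \<in> Hom E x x'" "b \<in> Hom E y y'" "b \<cdot> u \<approx> u' \<cdot> a" "shift a a'"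
  obtains t where "t \<in> Hom E c c'" "t \<cdot> v = v' \<cdot> b" "w' \<cdot> t = a' \<cdot> w"
proof -
  note d = coneD[OF assms(1,2)] and d' = coneD[OF assms(3,4)]
  obtain h where h: "a' \<in> Hom E (susp x) (susp x')" "h \<in> Hom E (inj_obj x) (inj_obj x')"
    "h \<cdot> inc x = inc x' \<cdot> a" "a' \<cdot> prj x = prj x' \<cdot> h"
    using shiftE[OF assms(8,5)] .
  obtain s where s: "s \<in> Hom E (inj_obj x) y'" "b \<cdot> u = u' \<cdot> a \<oplus> s \<cdot> inc x"
    using steqE[OF assms(7), of x y'] assms by (auto simp: Hom_iff)
  note ty = d(1-3,7-9)[unfolded Hom_iff] d'(1-3,7-9)[unfolded Hom_iff] assms(2,4,5,6)[unfolded Hom_iff]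
    h(1,2)[unfolded Hom_iff] s(1)[unfolded Hom_iff]
  note R = d(4-6) d'(4-6) h(3,4) s(2)
  note R = R R[THEN Comp_eq_Arr]
  have 1: "v' \<cdot> b \<in> Hom E y c'" using ty by (simp add: Hom_iff)
  have 2: "m' \<cdot> h \<oplus> v' \<cdot> s \<in> Hom E (inj_obj x) c'" using ty by (simp add: Hom_iff)
  have 3: "(m' \<cdot> h \<oplus> v' \<cdot> s) \<cdot> inc x = (v' \<cdot> b) \<cdot> u" using ty by (simp add: R Comp_Add)
  obtain t where t: "t \<in> Hom E c c'" "t \<cdot> v = v' \<cdot> b" "t \<cdot> m = m' \<cdot> h \<oplus> v' \<cdot> s"
    using cone_map[OF assms(1,2) 1 2 3] .
  have "w' \<cdot> t = a' \<cdot> w"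
    by (rule cone_eq[OF assms(1,2)])
      (use ty t(1) in \<open>auto simp: Hom_iff R t(2,3) t(2,3)[THEN Comp_eq_Arr] Comp_Add\<close>)
  then show ?thesis using that t by blast
qed

text \<open>The second cone glues the hull of \<open>y\<close> to \<open>c\<close> along
  \<open>y\<close>, and \<open>r\<close> collapses that hull to zero. Since \<open>e\<close> extends
  \<open>inc y\<close> over \<open>c\<close>, the leg \<open>m'\<close> has a retraction
  \<open>k\<close>, and \<open>z\<close>, the identity minus \<open>m' \<cdot> k\<close>, kills both
  \<open>m'\<close> and \<open>v' \<cdot> v\<close>. So \<open>z\<close> descends to a map
  \<open>s\<close> from the suspension of \<open>x\<close>. Then \<open>r \<cdot> s\<close> is
  strictly the identity, and \<open>s \<cdot> r = z\<close> is the identity up to a null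
  map.\<close>

lemma cone_rotate:
  assumes "cone u c v w m" "u \<in> Hom E x y" "cone v c' v' w' m'" "shift u u'"
  obtains r s where "r \<in> Hom E c' (susp x)" "stable_inverse r s" "r \<cdot> v' = w" "Neg E u' \<cdot> r \<approx> w'"
proof -
  note d = coneD[OF assms(1,2)] and d' = coneD[OF assms(3) coneD(1)[OF assms(1,2)]]
  obtain h where h: "u' \<in> Hom E (susp x) (susp y)" "h \<in> Hom E (inj_obj x) (inj_obj y)"
    "h \<cdot> inc x = inc y \<cdot> u" "u' \<cdot> prj x = prj y \<cdot> h"
    using shiftE[OF assms(4,2)] .
  note ty = d(1-3,7-9)[unfolded Hom_iff] d'(1-3,7-9)[unfolded Hom_iff] assms(2)[unfolded Hom_iff]
    h(1,2)[unfolded Hom_iff]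
  note R = d(4-6) d'(4-6) h(3,4)
  note R = R R[THEN Comp_eq_Arr]
  note m = cone_map[OF assms(3) d(1)] and e' = cone_eq[OF assms(3) d(1)]
  obtain e where e: "e \<in> Hom E c (inj_obj y)" "e \<cdot> v = inc y" "e \<cdot> m = h"
    by (rule cone_map[OF assms(1,2), of "inc y" "inj_obj y" h]) (use ty R in \<open>auto simp: Hom_iff\<close>)
  obtain k where k: "k \<in> Hom E c' (inj_obj y)" "k \<cdot> v' = e" "k \<cdot> m' = Idt E (inj_obj y)"
    by (rule m[of e "inj_obj y" "Idt E (inj_obj y)"]) (use ty R e in \<open>auto simp: Hom_iff\<close>)
  obtain r where r: "r \<in> Hom E c' (susp x)" "r \<cdot> v' = w" "r \<cdot> m' = Zero E (inj_obj y) (susp x)"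
    by (rule m[of w "susp x" "Zero E (inj_obj y) (susp x)"]) (use ty R in \<open>auto simp: Hom_iff\<close>)
  have py: "prj y \<cdot> e = u' \<cdot> w"
    by (rule cone_eq[OF assms(1,2)]) (use ty R e in \<open>auto simp: Hom_iff\<close>)
  note ty = ty e(1)[unfolded Hom_iff] k(1)[unfolded Hom_iff] r(1)[unfolded Hom_iff]
  note R = R e(2,3) k(2,3) r(2,3) py e(2,3)[THEN Comp_eq_Arr] k(2,3)[THEN Comp_eq_Arr]
     r(2,3)[THEN Comp_eq_Arr] py[THEN Comp_eq_Arr]
  \<comment> \<open>This is the source of the sign in rotation: \<open>r\<close> is zero on
    \<open>m'\<close> while \<open>w'\<close> is \<open>prj y\<close> there, so
    \<open>prj y \<cdot> k\<close> must be subtracted from \<open>w'\<close>, and on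
    \<open>v'\<close> this leaves \<open>Neg E u' \<cdot> w\<close>.\<close>
  have "Neg E u' \<cdot> r = w' \<oplus> Neg E (prj y) \<cdot> k"
    by (rule e') (use ty in \<open>auto simp: Hom_iff R Comp_Add\<close>)
  then have w': "Neg E u' \<cdot> r \<approx> w'"
    by (rule steqI'[OF _ d'(2) k(1)]) (use ty in \<open>auto simp: Hom_iff\<close>)
  define z where "z = Idt E c' \<oplus> Neg E (m' \<cdot> k)"
  have z: "z \<in> Arr E" "Dom E z = c'" "Cod E z = c'" using ty by (auto simp: z_def)
  have zm: "z \<cdot> m' = Zero E (inj_obj y) c'" using ty by (simp add: z_def Comp_Add R)
  have zv: "z \<cdot> v' \<cdot> v = Zero E y c'"
    unfolding d'(4)[symmetric] using ty z by (simp add: zm[THEN Comp_eq_Arr])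
  have "((z \<cdot> v') \<cdot> m) \<cdot> inc x = (z \<cdot> v' \<cdot> v) \<cdot> u" using ty z by (simp add: R)
  also have "\<dots> = Zero E x c'" unfolding zv using ty by simp
  finally have "((z \<cdot> v') \<cdot> m) \<cdot> inc x = Zero E x c'" .
  then obtain s where s: "s \<in> Hom E (susp x) c'" "s \<cdot> prj x = z \<cdot> v' \<cdot> m"
    using prj_desc[OF d(8), of "z \<cdot> v' \<cdot> m" c'] ty z by (auto simp: Hom_iff)
  note s' = s(1)[unfolded Hom_iff]
  have sw: "s \<cdot> w = z \<cdot> v'"
    by (rule cone_eq[OF assms(1,2)]) (use ty z s(2) s' R in \<open>auto simp: Hom_iff zv\<close>)
  have sr: "s \<cdot> r = z"
    by (rule e') (use ty z s' R sw in \<open>auto simp: Hom_iff zm\<close>)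
  have "(r \<cdot> s) \<cdot> prj x = Idt E (susp x) \<cdot> prj x"
    using ty z s' s(2) by (simp add: R z_def Comp_Add)
  then have rs: "r \<cdot> s = Idt E (susp x)"
    by (rule prj_epi[OF d(8), rotated 2]) (use ty s' in \<open>auto simp: Hom_iff\<close>)
  have "z = Idt E c' \<oplus> Neg E m' \<cdot> k" using ty by (simp add: z_def)
  then have "s \<cdot> r \<approx> Idt E c'"
    unfolding sr by (rule steqI'[OF _ _ k(1)]) (use ty in \<open>auto simp: Hom_iff\<close>)
  then have "stable_inverse r s"
    using ty s' rs by (auto simp: stable_inverse_def Hom_iff intro: steq_refl)
  then show ?thesis using that r w' by blast
qed

text \<open>The maps \<open>f\<close>, \<open>g\<close>, \<theta> and \<phi> are all prescribed on
  pushout legs, and the equations stated with equality hold strictly. The hulls of \<open>x\<close>,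
  \<open>y\<close> and \<open>cu\<close> are unrelated choices, so extensions between them compose
  only up to maps through a suspension. These defects, \<open>n\<close> and \<open>r\<close>,
  account for every \<approx> in the conclusion and for \<theta> being only a stable
  equivalence.\<close>

lemma cone_octahedron:
  assumes "cone u cu i i' mu" "u \<in> Hom E x y" "cone v cv j j' mv" "v \<in> Hom E y z"
    "cone (v \<cdot> u) cw k k' mw" "shift u u'" "shift i s"
  obtains f g d q t m \<theta> \<phi> where
    "f \<in> Hom E cu cw" "f \<cdot> i = k \<cdot> v" "k' \<cdot> f = i'"
    "g \<in> Hom E cw cv" "g \<cdot> k = j" "j' \<cdot> g = u' \<cdot> k'"
    "cone f d q t m" "\<theta> \<in> Hom E cv d" "stable_inverse \<theta> \<phi>" "\<theta> \<cdot> g \<approx> q" "t \<cdot> \<theta> = s \<cdot> j'"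
proof -
  have vu: "v \<cdot> u \<in> Hom E x z" using assms(2,4) by (auto simp: Hom_iff)
  note du = coneD[OF assms(1,2)] and dv = coneD[OF assms(3,4)] and dw = coneD[OF assms(5) vu]
  obtain hu where hu: "u' \<in> Hom E (susp x) (susp y)" "hu \<in> Hom E (inj_obj x) (inj_obj y)"
    "hu \<cdot> inc x = inc y \<cdot> u" "u' \<cdot> prj x = prj y \<cdot> hu"
    using shiftE[OF assms(6,2)] .
  obtain hi where hi: "s \<in> Hom E (susp y) (susp cu)" "hi \<in> Hom E (inj_obj y) (inj_obj cu)"
    "hi \<cdot> inc y = inc cu \<cdot> i" "s \<cdot> prj y = prj cu \<cdot> hi"
    using shiftE[OF assms(7) du(1)] .
  note ty = du(1-3,7-9)[unfolded Hom_iff] dv(1-3,7-9)[unfolded Hom_iff] dw(1-3,7-9)[unfolded Hom_iff]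
    assms(2,4)[unfolded Hom_iff] hu(1,2)[unfolded Hom_iff] hi(1,2)[unfolded Hom_iff]
  have ip: "inc w \<in> Hom E w (inj_obj w)" "prj w \<in> Hom E (inj_obj w) (susp w)" if "w \<in> Obj E" for w
    using that by (auto simp: Hom_iff)
  note R = du(4-6) dv(4-6) dw(4-6) hu(3,4) hi(3,4)
  note R = R R[THEN Comp_eq_Arr]
  obtain f where f: "f \<in> Hom E cu cw" "f \<cdot> i = k \<cdot> v" "f \<cdot> mu = mw"
    by (rule cone_map[OF assms(1,2), of "k \<cdot> v" cw mw]) (use ty in \<open>auto simp: Hom_iff R\<close>)
  obtain g where g: "g \<in> Hom E cw cv" "g \<cdot> k = j" "g \<cdot> mw = mv \<cdot> hu"
    by (rule cone_map[OF assms(5) vu, of j cv "mv \<cdot> hu"]) (use ty in \<open>auto simp: Hom_iff R\<close>)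
  obtain e where e: "e \<in> Hom E cu (inj_obj y)" "e \<cdot> i = inc y" "e \<cdot> mu = hu"
    by (rule cone_map[OF assms(1,2), of "inc y" "inj_obj y" hu]) (use ty in \<open>auto simp: Hom_iff R\<close>)
  \<comment> \<open>A map between the hulls of \<open>cu\<close> and \<open>y\<close> in the
    direction opposite to \<open>hi\<close>. It prescribes \<phi> on the leg \<open>m\<close>, which
    is compatible with \<open>g\<close> on the leg \<open>q\<close> because
    \<open>g \<cdot> f = mv \<cdot> e\<close>.\<close>
  obtain et where et: "et \<in> Hom E (inj_obj cu) (inj_obj y)" "et \<cdot> inc cu = e"
    using inc_extend[OF du(7) injective_inj_obj[OF du(9)] e(1)] .
  obtain d q t m where D: "cone f d q t m" using cone_ex f(1) unfolding Hom_iff by blast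
  note df = coneD[OF D f(1)]
  note ty = ty f(1)[unfolded Hom_iff] g(1)[unfolded Hom_iff] e(1)[unfolded Hom_iff] et(1)[unfolded Hom_iff]
    df(1-3,7-9)[unfolded Hom_iff]
  note R' = f(2,3) g(2,3) e(2,3) et(2) df(4-6)
  note R = R R' R'[THEN Comp_eq_Arr]
  have k'f: "k' \<cdot> f = i'"
    by (rule cone_eq[OF assms(1,2)]) (use ty in \<open>auto simp: Hom_iff R\<close>)
  have j'g: "j' \<cdot> g = u' \<cdot> k'"
    by (rule cone_eq[OF assms(5) vu]) (use ty in \<open>auto simp: Hom_iff R\<close>)
  have gf: "g \<cdot> f = mv \<cdot> e"
    by (rule cone_eq[OF assms(1,2)]) (use ty in \<open>auto simp: Hom_iff R\<close>)
  note R' = k'f gf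
  note R = R R' R'[THEN Comp_eq_Arr]
  obtain \<theta> where th: "\<theta> \<in> Hom E cv d" "\<theta> \<cdot> j = q \<cdot> k" "\<theta> \<cdot> mv = m \<cdot> hi"
    by (rule cone_map[OF assms(3,4), of "q \<cdot> k" d "m \<cdot> hi"]) (use ty in \<open>auto simp: Hom_iff R\<close>)
  obtain \<phi> where ph: "\<phi> \<in> Hom E d cv" "\<phi> \<cdot> q = g" "\<phi> \<cdot> m = mv \<cdot> et"
    by (rule cone_map[OF D f(1), of g cv "mv \<cdot> et"]) (use ty in \<open>auto simp: Hom_iff R\<close>)
  note ty = ty th(1)[unfolded Hom_iff] ph(1)[unfolded Hom_iff]
  note R' = th(2,3) ph(2,3)
  note R = R R' R'[THEN Comp_eq_Arr]
  have t\<theta>: "t \<cdot> \<theta> = s \<cdot> j'"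
    by (rule cone_eq[OF assms(3,4)]) (use ty in \<open>auto simp: Hom_iff R\<close>)
  \<comment> \<open>Both maps extend \<open>inc cu \<cdot> i \<cdot> u\<close> to the hull of
    \<open>x\<close>, hence differ by a map through its suspension. This \<open>n\<close> separates
    \<open>q\<close> from \<open>\<theta> \<cdot> g\<close>.\<close>
  obtain n where n: "n \<in> Hom E (susp x) (inj_obj cu)" "inc cu \<cdot> mu = hi \<cdot> hu \<oplus> n \<cdot> prj x"
    by (rule prj_diff[OF du(8), of "inc cu \<cdot> mu" "inj_obj cu" "hi \<cdot> hu"]) (use ty in \<open>auto simp: Hom_iff R\<close>)
  \<comment> \<open>Passing from the hull of \<open>y\<close> to that of \<open>cu\<close> and back
    fixes \<open>inc y\<close>; the defect \<open>r\<close> is what separates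
    \<open>\<phi> \<cdot> \<theta>\<close> from the identity.\<close>
  obtain r where r: "r \<in> Hom E (susp y) (inj_obj y)" "Idt E (inj_obj y) = et \<cdot> hi \<oplus> r \<cdot> prj y"
    by (rule prj_diff[OF du(9), of "Idt E (inj_obj y)" "inj_obj y" "et \<cdot> hi"]) (use ty in \<open>auto simp: Hom_iff R\<close>)
  note ty = ty n(1)[unfolded Hom_iff] r(1)[unfolded Hom_iff]
  have "q \<cdot> mw = m \<cdot> (hi \<cdot> hu \<oplus> n \<cdot> prj x)"
    unfolding n(2)[symmetric] using ty by (simp add: R)
  then have qmw: "q \<cdot> mw = m \<cdot> hi \<cdot> hu \<oplus> m \<cdot> n \<cdot> prj x" using ty by (simp add: Comp_Add)
  have q: "q = \<theta> \<cdot> g \<oplus> m \<cdot> n \<cdot> k'"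
    by (rule cone_eq[OF assms(5) vu]) (use ty in \<open>auto simp: Hom_iff R qmw Comp_Add\<close>)
  have nk: "n \<cdot> k' \<in> Hom E cw (inj_obj cu)" using ty by (auto simp: Hom_iff)
  have "q \<approx> \<theta> \<cdot> g"
    by (rule steqI'[OF q _ nk df(3)]) (use ty in \<open>auto simp: Hom_iff\<close>)
  then have 1: "\<theta> \<cdot> g \<approx> q" by (rule steq_sym)
  have "mv \<cdot> Idt E (inj_obj y) = mv \<cdot> (et \<cdot> hi \<oplus> r \<cdot> prj y)" by (simp only: r(2))
  then have mv: "mv = mv \<cdot> et \<cdot> hi \<oplus> mv \<cdot> r \<cdot> prj y" using ty by (simp add: Comp_Add)
  have "Idt E cv = \<phi> \<cdot> \<theta> \<oplus> mv \<cdot> r \<cdot> j'"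
    by (rule cone_eq[OF assms(3,4)]) (use ty mv[symmetric] in \<open>auto simp: Hom_iff R Comp_Add\<close>)
  moreover have rj: "r \<cdot> j' \<in> Hom E cv (inj_obj y)" using ty by (auto simp: Hom_iff)
  ultimately have "Idt E cv \<approx> \<phi> \<cdot> \<theta>"
    by (intro steqI'[OF _ _ rj dv(3)]) (use ty in \<open>auto simp: Hom_iff\<close>)
  then have 2: "\<phi> \<cdot> \<theta> \<approx> Idt E cv" by (rule steq_sym)
  have comp: "(Idt E (inj_obj cu) \<oplus> Neg E (hi \<cdot> et)) \<cdot> inc cu = (n \<cdot> k') \<cdot> f"
    by (rule cone_eq[OF assms(1,2)]) (use ty in \<open>auto simp: Hom_iff R n(2) Comp_Add Add_ac\<close>)
  \<comment> \<open>The null map for the other composite is \<open>m \<cdot> l\<close>: its value on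
    \<open>q\<close> cancels the defect coming from \<open>n\<close>, and its value on
    \<open>m\<close> the defect of \<open>hi \<cdot> et\<close>. The equation \<open>comp\<close>
    says that the two prescriptions agree on \<open>cu\<close>.\<close>
  obtain l where l: "l \<in> Hom E d (inj_obj cu)" "l \<cdot> q = n \<cdot> k'"
      "l \<cdot> m = Idt E (inj_obj cu) \<oplus> Neg E (hi \<cdot> et)"
    by (rule cone_map[OF D f(1) nk _ comp]) (use ty in \<open>auto simp: Hom_iff\<close>)
  note ty = ty l(1)[unfolded Hom_iff]
  have "Idt E d = \<theta> \<cdot> \<phi> \<oplus> m \<cdot> l"
    by (rule cone_eq[OF D f(1)]) (use ty l q[symmetric] in \<open>auto simp: Hom_iff R Comp_Add Add_ac\<close>)
  then have "Idt E d \<approx> \<theta> \<cdot> \<phi>"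
    by (rule steqI'[OF _ _ l(1) df(3)]) (use ty in \<open>auto simp: Hom_iff\<close>)
  then have "\<theta> \<cdot> \<phi> \<approx> Idt E d" by (rule steq_sym)
  with 2 have "stable_inverse \<theta> \<phi>" using ty by (auto simp: stable_inverse_def Hom_iff)
  then show ?thesis
    by (rule that[OF f(1,2) k'f g(1,2) j'g D th(1) _ 1 t\<theta>])
qed

end

section \<open>Triangulations generated by standard triangles\<close>

text \<open>Conditions on a class of triangles under which its closure under isomorphism is a
  triangulation. They ask for less than the axioms: a standard triangle rotates to one isomorphic to
  a standard one, and the octahedron is required for one choice of triangles, the last being
  standard only up to \<open>r\<close>. The weak cokernel condition replaces the long exact Hom
  sequences in the five lemma.\<close>

locale standard_triangles = additive_category T
  for T :: "('o, 'm, 'z) preadditive_data_scheme" (structure)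
    and S :: "('o, 'm, 'o, 'm) functor_data"
    and Std :: "'m triangle set" +
  assumes S_additive: "is_additive_functor T T S"
    and S_full: "\<lbrakk>x \<in> Obj T; y \<in> Obj T; g \<in> Hom T (on_obj S x) (on_obj S y)\<rbrakk>
      \<Longrightarrow> \<exists>f \<in> Hom T x y. on_arr S f = g"
    and S_faithful: "\<lbrakk>f \<in> Hom T x y; g \<in> Hom T x y; on_arr S f = on_arr S g\<rbrakk> \<Longrightarrow> f = g"
    and S_dense: "z \<in> Obj T \<Longrightarrow> \<exists>x \<in> Obj T. \<exists>f \<in> Hom T (on_obj S x) z. is_iso T f"
    and Std_is_triangle: "t \<in> Std \<Longrightarrow> is_triangle T S t"
    and Std_ex: "f \<in> Arr T \<Longrightarrow> \<exists>g h. (f, g, h) \<in> Std"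
    and Std_Idt: "x \<in> Obj T \<Longrightarrow> \<exists>g h. (Idt T x, g, h) \<in> Std \<and> zero_object T (Cod T g)"
    and Std_morphism: "\<lbrakk>(f, g, h) \<in> Std; (f', g', h') \<in> Std;
        a \<in> Hom T (Dom T f) (Dom T f'); b \<in> Hom T (Cod T f) (Cod T f'); b \<cdot> f = f' \<cdot> a\<rbrakk>
      \<Longrightarrow> \<exists>c. triangle_morphism T S (f, g, h) (f', g', h') a b c"
    and Std_weak_cokernel: "\<lbrakk>(f, g, h) \<in> Std; k \<in> Hom T (Cod T g) z; k \<cdot> g = Zero T (Dom T g) z\<rbrakk>
      \<Longrightarrow> \<exists>l \<in> Hom T (Cod T h) z. k = l \<cdot> h"
    and Std_rotate: "(f, g, h) \<in> Std \<Longrightarrow> \<exists>g' h' r. (g, g', h') \<in> Std \<and>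
        r \<in> Hom T (Cod T g') (Cod T h) \<and> is_iso T r \<and> r \<cdot> g' = h \<and> Neg T (on_arr S f) \<cdot> r = h'"
    and Std_octahedron: "\<lbrakk>u \<in> Arr T; v \<in> Arr T; Cod T u = Dom T v\<rbrakk>
      \<Longrightarrow> \<exists>i i' j j' k k' f g q t r. (u, i, i') \<in> Std \<and> (v, j, j') \<in> Std \<and> (v \<cdot> u, k, k') \<in> Std \<and>
        (f, q, t) \<in> Std \<and> triangle_morphism T S (u, i, i') (v \<cdot> u, k, k') (Idt T (Dom T u)) v f \<and>
        triangle_morphism T S (v \<cdot> u, k, k') (v, j, j') u (Idt T (Cod T v)) g \<and>
        r \<in> Hom T (Cod T j) (Cod T q) \<and> is_iso T r \<and> r \<cdot> g = q \<and> t \<cdot> r = on_arr S i \<cdot> j'"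
begin

section \<open>The shift and morphisms of triangles\<close>

lemma S_functor: "is_functor T T S"
  using S_additive by (simp add: is_additive_functor_def)

lemmas S_simps [simp] = is_functorD[OF S_functor]

lemma S_Add:
  "\<lbrakk>f \<in> Arr T; g \<in> Arr T; Dom T g = Dom T f; Cod T g = Cod T f\<rbrakk>
    \<Longrightarrow> on_arr S (f \<oplus> g) = on_arr S f \<oplus> on_arr S g"
  using S_additive unfolding is_additive_functor_def
  by (metis Hom_iff Dom_in_Obj Cod_in_Obj)

lemma S_Zero [simp]:
  assumes "x \<in> Obj T" "y \<in> Obj T"
  shows "on_arr S (Zero T x y) = Zero T (on_obj S x) (on_obj S y)"
proof -
  let ?z = "on_arr S (Zero T x y)"
  have "?z \<oplus> ?z = ?z \<oplus> Zero T (on_obj S x) (on_obj S y)"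
    using S_Add[of "Zero T x y" "Zero T x y"] assms by simp
  then show ?thesis by (rule Add_left_cancel) (use assms in auto)
qed

lemma S_Neg [simp]: "f \<in> Arr T \<Longrightarrow> on_arr S (Neg T f) = Neg T (on_arr S f)"
  by (rule Neg_unique) (use S_Add[of f "Neg T f"] in auto)

lemma S_is_iso:
  assumes "is_iso T f" "f \<in> Hom T x y"
  shows "is_iso T (on_arr S f)"
proof -
  obtain g where g: "g \<in> Hom T y x" "g \<cdot> f = Idt T x" "f \<cdot> g = Idt T y" using is_isoE[OF assms] .
  note ty = assms(2)[unfolded Hom_iff] g(1)[unfolded Hom_iff] Hom_Obj[OF g(1)]
  have "on_arr S g \<cdot> on_arr S f = on_arr S (g \<cdot> f)" "on_arr S f \<cdot> on_arr S g = on_arr S (f \<cdot> g)"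
    using ty by simp_all
  then show ?thesis
    by (intro is_isoI[of _ _ "on_obj S x" "on_obj S y" "on_arr S g"])
      (use ty in \<open>auto simp: Hom_iff g(2,3)\<close>)
qed

lemma triangle_iff:
  "is_triangle T S (f, g, h) \<longleftrightarrow> f \<in> Arr T \<and> g \<in> Arr T \<and> h \<in> Arr T \<and>
    Dom T g = Cod T f \<and> Dom T h = Cod T g \<and> Cod T h = on_obj S (Dom T f)"
  by (auto simp: is_triangle_def)

lemma triangle_morphism_iff:
  "triangle_morphism T S (f, g, h) (f', g', h') a b c \<longleftrightarrow>
    a \<in> Hom T (Dom T f) (Dom T f') \<and> b \<in> Hom T (Dom T g) (Dom T g') \<and> c \<in> Hom T (Dom T h) (Dom T h') \<and>
    b \<cdot> f = f' \<cdot> a \<and> c \<cdot> g = g' \<cdot> b \<and> on_arr S a \<cdot> h = h' \<cdot> c"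
  by (simp add: triangle_morphism_def)

lemma triangle_morphism_Idt:
  "is_triangle T S (f, g, h) \<Longrightarrow> triangle_morphism T S (f, g, h) (f, g, h)
    (Idt T (Dom T f)) (Idt T (Cod T f)) (Idt T (Cod T g))"
  by (auto simp: triangle_iff triangle_morphism_iff Hom_iff)

lemma triangle_morphism_Comp:
  assumes "is_triangle T S (f, g, h)" "is_triangle T S (f', g', h')" "is_triangle T S (f'', g'', h'')"
    "triangle_morphism T S (f, g, h) (f', g', h') a b c"
    "triangle_morphism T S (f', g', h') (f'', g'', h'') a' b' c'"
  shows "triangle_morphism T S (f, g, h) (f'', g'', h'') (a' \<cdot> a) (b' \<cdot> b) (c' \<cdot> c)"
proof -
  note ty = assms(1-3)[unfolded triangle_iff]
  note m = assms(4)[unfolded triangle_morphism_iff Hom_iff]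
  note n = assms(5)[unfolded triangle_morphism_iff Hom_iff]
  have "b \<cdot> f = f' \<cdot> a" "c \<cdot> g = g' \<cdot> b" "on_arr S a \<cdot> h = h' \<cdot> c" using m by auto
  note R = this
  have "b' \<cdot> f' = f'' \<cdot> a'" "c' \<cdot> g' = g'' \<cdot> b'" "on_arr S a' \<cdot> h' = h'' \<cdot> c'" using n by auto
  note R = R this[THEN Comp_eq_Arr]
  show ?thesis
    unfolding triangle_morphism_iff Hom_iff using ty m n by (simp add: R)
qed

lemma triangle_morphism_inverse:
  assumes "is_triangle T S (f, g, h)" "is_triangle T S (f', g', h')"
    "triangle_morphism T S (f, g, h) (f', g', h') a b c"
    "a' \<in> Hom T (Dom T f') (Dom T f)" "b' \<in> Hom T (Cod T f') (Cod T f)" "c' \<in> Hom T (Cod T g') (Cod T g)"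
    "a' \<cdot> a = Idt T (Dom T f)" "a \<cdot> a' = Idt T (Dom T f')"
    "b' \<cdot> b = Idt T (Cod T f)" "b \<cdot> b' = Idt T (Cod T f')"
    "c' \<cdot> c = Idt T (Cod T g)" "c \<cdot> c' = Idt T (Cod T g')"
  shows "triangle_morphism T S (f', g', h') (f, g, h) a' b' c'"
proof -
  note ty = assms(1-2)[unfolded triangle_iff]
  note m = assms(3)[unfolded triangle_morphism_iff Hom_iff]
  note n = assms(4-6)[unfolded Hom_iff]
  have "b' \<cdot> f' = f \<cdot> a'"
    by (rule inverse_square[of b f f' a "Dom T f" "Cod T f" "Dom T f'" "Cod T f'"])
      (use ty m n assms(7-) in \<open>auto simp: Hom_iff\<close>)
  moreover have "c' \<cdot> g' = g \<cdot> b'"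
    by (rule inverse_square[of c g g' b "Cod T f" "Cod T g" "Cod T f'" "Cod T g'"])
      (use ty m n assms(7-) in \<open>auto simp: Hom_iff\<close>)
  moreover have "on_arr S a' \<cdot> h' = h \<cdot> c'"
  proof (rule inverse_square[of "on_arr S a" h h' c "Cod T g" "Cod T h" "Cod T g'" "Cod T h'"])
    have "on_arr S a' \<cdot> on_arr S a = on_arr S (a' \<cdot> a)" using ty m n by simp
    then show "on_arr S a' \<cdot> on_arr S a = Idt T (Cod T h)" unfolding assms(7) using ty by simp
  qed (use ty m n assms(12) in \<open>auto simp: Hom_iff\<close>)
  ultimately show ?thesis
    unfolding triangle_morphism_iff Hom_iff using ty n by auto
qed

definition triangle_iso :: "'m triangle \<Rightarrow> 'm triangle \<Rightarrow> bool" where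
  "triangle_iso t t' \<longleftrightarrow> is_triangle T S t \<and> is_triangle T S t' \<and>
    (\<exists>a b c. triangle_morphism T S t t' a b c \<and> is_iso T a \<and> is_iso T b \<and> is_iso T c)"

lemma triangle_isoE:
  assumes "triangle_iso (f, g, h) (f', g', h')"
  obtains a b c a' b' c' where "triangle_morphism T S (f, g, h) (f', g', h') a b c"
    "triangle_morphism T S (f', g', h') (f, g, h) a' b' c'"
    "a' \<cdot> a = Idt T (Dom T f)" "a \<cdot> a' = Idt T (Dom T f')"
    "b' \<cdot> b = Idt T (Cod T f)" "b \<cdot> b' = Idt T (Cod T f')"
    "c' \<cdot> c = Idt T (Cod T g)" "c \<cdot> c' = Idt T (Cod T g')"
    "is_iso T a" "is_iso T b" "is_iso T c"
proof -
  obtain a b c where m: "triangle_morphism T S (f, g, h) (f', g', h') a b c"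
    and i: "is_iso T a" "is_iso T b" "is_iso T c" and t: "is_triangle T S (f, g, h)" "is_triangle T S (f', g', h')"
    using assms by (auto simp: triangle_iso_def)
  note d = m[unfolded triangle_morphism_iff Hom_iff] t[unfolded triangle_iff]
  have ty: "a \<in> Hom T (Dom T f) (Dom T f')" "b \<in> Hom T (Cod T f) (Cod T f')" "c \<in> Hom T (Cod T g) (Cod T g')"
    using d by (auto simp: Hom_iff)
  obtain a' where a': "a' \<in> Hom T (Dom T f') (Dom T f)" "a' \<cdot> a = Idt T (Dom T f)" "a \<cdot> a' = Idt T (Dom T f')"
    using is_isoE[OF i(1) ty(1)] .
  obtain b' where b': "b' \<in> Hom T (Cod T f') (Cod T f)" "b' \<cdot> b = Idt T (Cod T f)" "b \<cdot> b' = Idt T (Cod T f')"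
    using is_isoE[OF i(2) ty(2)] .
  obtain c' where c': "c' \<in> Hom T (Cod T g') (Cod T g)" "c' \<cdot> c = Idt T (Cod T g)" "c \<cdot> c' = Idt T (Cod T g')"
    using is_isoE[OF i(3) ty(3)] .
  show ?thesis
    by (rule that[OF m triangle_morphism_inverse[OF t m a'(1) b'(1) c'(1) a'(2,3) b'(2,3) c'(2,3)] a'(2,3) b'(2,3) c'(2,3) i])
qed

lemma triangle_iso_refl: "is_triangle T S (f, g, h) \<Longrightarrow> triangle_iso (f, g, h) (f, g, h)"
  unfolding triangle_iso_def using triangle_morphism_Idt[of f g h] by (auto intro!: exI is_iso_Idt simp: triangle_iff)

lemma triangle_iso_trans:
  assumes "triangle_iso (f, g, h) (f', g', h')" "triangle_iso (f', g', h') (f'', g'', h'')"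
  shows "triangle_iso (f, g, h) (f'', g'', h'')"
proof -
  have t: "is_triangle T S (f, g, h)" "is_triangle T S (f', g', h')" "is_triangle T S (f'', g'', h'')"
    using assms by (auto simp: triangle_iso_def)
  obtain a b c where m: "triangle_morphism T S (f, g, h) (f', g', h') a b c" "is_iso T a" "is_iso T b" "is_iso T c"
    using assms(1) by (auto simp: triangle_iso_def)
  obtain a' b' c' where n: "triangle_morphism T S (f', g', h') (f'', g'', h'') a' b' c'"
    "is_iso T a'" "is_iso T b'" "is_iso T c'"
    using assms(2) by (auto simp: triangle_iso_def)
  note d = m(1)[unfolded triangle_morphism_iff] n(1)[unfolded triangle_morphism_iff] t[unfolded triangle_iff]
  have "is_iso T (a' \<cdot> a)" "is_iso T (b' \<cdot> b)" "is_iso T (c' \<cdot> c)"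
    using is_iso_Comp[of a a'] is_iso_Comp[of b b'] is_iso_Comp[of c c'] m n d by blast+
  then show ?thesis
    unfolding triangle_iso_def using t triangle_morphism_Comp[OF t m(1) n(1)] by blast
qed

section \<open>Closure of the standard triangles under isomorphism\<close>

definition distinguished :: "'m triangle set" where
  "distinguished = {t. \<exists>s \<in> Std. triangle_iso s t}"

lemma distinguished_is_triangle: "t \<in> distinguished \<Longrightarrow> is_triangle T S t"
  by (auto simp: distinguished_def triangle_iso_def)

lemma Std_distinguished: "t \<in> Std \<Longrightarrow> t \<in> distinguished"
  unfolding distinguished_def using Std_is_triangle triangle_iso_refl by (cases t) blast

lemma distinguished_iso:
  assumes "(f, g, h) \<in> distinguished" "triangle_iso (f, g, h) (f', g', h')"
  shows "(f', g', h') \<in> distinguished"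
proof -
  obtain s where "s \<in> Std" "triangle_iso s (f, g, h)" using assms(1) by (auto simp: distinguished_def)
  then show ?thesis using triangle_iso_trans[OF _ assms(2)] unfolding distinguished_def by (cases s) blast
qed

lemma distinguishedE:
  assumes "(f, g, h) \<in> distinguished"
  obtains f0 g0 h0 where "(f0, g0, h0) \<in> Std" "triangle_iso (f0, g0, h0) (f, g, h)"
  using assms unfolding distinguished_def by auto

text \<open>The square is conjugated into one between standard triangles, completed there, and the
  completion is conjugated back; on the first two components the isomorphisms cancel.\<close>

lemma distinguished_morphism:
  assumes "(f, g, h) \<in> distinguished" "(f', g', h') \<in> distinguished"
    "a \<in> Hom T (Dom T f) (Dom T f')" "b \<in> Hom T (Cod T f) (Cod T f')" "b \<cdot> f = f' \<cdot> a"
  obtains c where "triangle_morphism T S (f, g, h) (f', g', h') a b c"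
proof -
  obtain f1 g1 h1 where 1: "(f1, g1, h1) \<in> Std" "triangle_iso (f1, g1, h1) (f, g, h)"
    using distinguishedE[OF assms(1)] .
  obtain f2 g2 h2 where 2: "(f2, g2, h2) \<in> Std" "triangle_iso (f2, g2, h2) (f', g', h')"
    using distinguishedE[OF assms(2)] .
  obtain a1 b1 c1 a1' b1' c1' where m1: "triangle_morphism T S (f1, g1, h1) (f, g, h) a1 b1 c1"
    "triangle_morphism T S (f, g, h) (f1, g1, h1) a1' b1' c1'"
    and i1: "a1' \<cdot> a1 = Idt T (Dom T f1)" "a1 \<cdot> a1' = Idt T (Dom T f)"
      "b1' \<cdot> b1 = Idt T (Cod T f1)" "b1 \<cdot> b1' = Idt T (Cod T f)"
      "c1' \<cdot> c1 = Idt T (Cod T g1)" "c1 \<cdot> c1' = Idt T (Cod T g)"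
      "is_iso T a1" "is_iso T b1" "is_iso T c1"
    using triangle_isoE[OF 1(2)] .
  obtain a2 b2 c2 a2' b2' c2' where m2: "triangle_morphism T S (f2, g2, h2) (f', g', h') a2 b2 c2"
    "triangle_morphism T S (f', g', h') (f2, g2, h2) a2' b2' c2'"
    and i2: "a2' \<cdot> a2 = Idt T (Dom T f2)" "a2 \<cdot> a2' = Idt T (Dom T f')"
      "b2' \<cdot> b2 = Idt T (Cod T f2)" "b2 \<cdot> b2' = Idt T (Cod T f')"
      "c2' \<cdot> c2 = Idt T (Cod T g2)" "c2 \<cdot> c2' = Idt T (Cod T g')"
      "is_iso T a2" "is_iso T b2" "is_iso T c2"
    using triangle_isoE[OF 2(2)] .
  have t: "is_triangle T S (f1, g1, h1)" "is_triangle T S (f, g, h)" "is_triangle T S (f2, g2, h2)"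
    "is_triangle T S (f', g', h')"
    using 1 2 by (auto simp: triangle_iso_def)
  note d = m1[unfolded triangle_morphism_iff Hom_iff] m2[unfolded triangle_morphism_iff Hom_iff]
    t[unfolded triangle_iff] assms(3,4)[unfolded Hom_iff]
  have e: "b1 \<cdot> f1 = f \<cdot> a1" "b2' \<cdot> f' = f2 \<cdot> a2'" using d by auto
  have "(b2' \<cdot> b \<cdot> b1) \<cdot> f1 = f2 \<cdot> (a2' \<cdot> a \<cdot> a1)"
    using d by (simp add: e assms(5)[THEN Comp_eq_Arr] e(2)[THEN Comp_eq_Arr])
  then obtain c where c: "triangle_morphism T S (f1, g1, h1) (f2, g2, h2) (a2' \<cdot> a \<cdot> a1) (b2' \<cdot> b \<cdot> b1) c"
    using Std_morphism[OF 1(1) 2(1), of "a2' \<cdot> a \<cdot> a1" "b2' \<cdot> b \<cdot> b1"] d by (auto simp: Hom_iff)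
  have "triangle_morphism T S (f, g, h) (f', g', h')
    (a2 \<cdot> ((a2' \<cdot> a \<cdot> a1) \<cdot> a1')) (b2 \<cdot> ((b2' \<cdot> b \<cdot> b1) \<cdot> b1')) (c2 \<cdot> (c \<cdot> c1'))"
    using triangle_morphism_Comp[OF t(2,3,4) triangle_morphism_Comp[OF t(2,1,3) m1(2) c] m2(1)] .
  moreover have "a2 \<cdot> ((a2' \<cdot> a \<cdot> a1) \<cdot> a1') = a" "b2 \<cdot> ((b2' \<cdot> b \<cdot> b1) \<cdot> b1') = b"
    using d by (simp_all add: i1(2,4) i2(2,4) i2(2,4)[THEN Comp_eq_Arr])
  ultimately show ?thesis using that by simp
qed

lemma distinguished_weak_cokernel:
  assumes "(f, g, h) \<in> distinguished" "k \<in> Hom T (Cod T g) z" "k \<cdot> g = Zero T (Dom T g) z"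
  obtains l where "l \<in> Hom T (Cod T h) z" "k = l \<cdot> h"
proof -
  obtain f1 g1 h1 where 1: "(f1, g1, h1) \<in> Std" "triangle_iso (f1, g1, h1) (f, g, h)"
    using distinguishedE[OF assms(1)] .
  obtain a1 b1 c1 a1' b1' c1' where m1: "triangle_morphism T S (f1, g1, h1) (f, g, h) a1 b1 c1"
    "triangle_morphism T S (f, g, h) (f1, g1, h1) a1' b1' c1'"
    and i1: "a1' \<cdot> a1 = Idt T (Dom T f1)" "a1 \<cdot> a1' = Idt T (Dom T f)"
      "b1' \<cdot> b1 = Idt T (Cod T f1)" "b1 \<cdot> b1' = Idt T (Cod T f)"
      "c1' \<cdot> c1 = Idt T (Cod T g1)" "c1 \<cdot> c1' = Idt T (Cod T g)"
      "is_iso T a1" "is_iso T b1" "is_iso T c1"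
    using triangle_isoE[OF 1(2)] .
  have t: "is_triangle T S (f1, g1, h1)" "is_triangle T S (f, g, h)"
    using 1 by (auto simp: triangle_iso_def)
  note d = m1[unfolded triangle_morphism_iff Hom_iff] t[unfolded triangle_iff] assms(2)[unfolded Hom_iff]
    Hom_Obj[OF assms(2)]
  have e: "c1 \<cdot> g1 = g \<cdot> b1" "on_arr S a1' \<cdot> h = h1 \<cdot> c1'" using d by auto
  have kc: "k \<cdot> c1 \<in> Hom T (Cod T g1) z" using d by (auto simp: Hom_iff)
  have "(k \<cdot> c1) \<cdot> g1 = Zero T (Dom T g1) z" using d by (simp add: e(1) assms(3)[THEN Comp_eq_Arr])
  then obtain l where l: "l \<in> Hom T (Cod T h1) z" "k \<cdot> c1 = l \<cdot> h1"
    using Std_weak_cokernel[OF 1(1) kc] by blast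
  have "k = (k \<cdot> c1) \<cdot> c1'" using d by (simp add: i1(6))
  also have "\<dots> = (l \<cdot> on_arr S a1') \<cdot> h" unfolding l(2) using d l(1) by (simp add: Hom_iff e(2))
  finally show ?thesis
    by (intro that[of "l \<cdot> on_arr S a1'"]) (use d l(1) in \<open>auto simp: Hom_iff\<close>)
qed

text \<open>The difference \<open>k\<close> of \<open>e\<close> and the identity satisfies
  \<open>k \<cdot> g = 0\<close> and \<open>h \<cdot> k = 0\<close>. The first equation gives
  \<open>k = l \<cdot> h\<close>, so \<open>k \<cdot> k = l \<cdot> h \<cdot> k = 0\<close> by the
  second. Thus \<open>e\<close> is the identity plus a map of square zero, with inverse the identity
  minus that map.\<close>

lemma distinguished_endo_is_iso:
  assumes "(f, g, h) \<in> distinguished"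
    "triangle_morphism T S (f, g, h) (f, g, h) (Idt T (Dom T f)) (Idt T (Cod T f)) e"
  shows "is_iso T e"
proof -
  let ?c = "Cod T g"
  note ty = distinguished_is_triangle[OF assms(1), unfolded triangle_iff]
    assms(2)[unfolded triangle_morphism_iff Hom_iff]
  define k where "k = e \<oplus> Neg T (Idt T ?c)"
  have k: "k \<in> Arr T" "Dom T k = ?c" "Cod T k = ?c" using ty by (auto simp: k_def)
  have ek: "e = k \<oplus> Idt T ?c" using ty by (simp add: k_def Add_ac)
  have "k \<cdot> g = Zero T (Dom T g) ?c" using ty by (simp add: k_def Comp_Add)
  then obtain l where l: "l \<in> Hom T (Cod T h) ?c" "k = l \<cdot> h"
    using distinguished_weak_cokernel[OF assms(1), of k ?c] k by (auto simp: Hom_iff)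
  have "h \<cdot> e = h" using ty by (metis Comp_Idt(2) S_simps(2) Dom_in_Obj)
  then have "h \<cdot> k = Zero T ?c (Cod T h)" using ty by (simp add: k_def Comp_Add)
  then have "l \<cdot> (h \<cdot> k) = Zero T ?c ?c" using l(1) ty by (simp add: Hom_iff)
  then have kk: "k \<cdot> k = Zero T ?c ?c"
    using l(1) ty k Comp_Comp[of k h l] by (simp add: Hom_iff l(2)[symmetric])
  show ?thesis
    by (rule is_isoI[of _ _ ?c ?c "Idt T ?c \<oplus> Neg T k"])
      (use ty k kk in \<open>auto simp: ek Hom_iff Comp_Add Add_ac Neg_Add\<close>)
qed

text \<open>The inverses of \<open>a\<close> and \<open>b\<close> complete to a morphism of
  triangles in the other direction. Both composites are the identity on the first two objects, so
  \<open>distinguished_endo_is_iso\<close> makes their third components invertible.\<close>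

lemma distinguished_is_iso:
  assumes "(f, g, h) \<in> distinguished" "(f', g', h') \<in> distinguished"
    "triangle_morphism T S (f, g, h) (f', g', h') a b c" "is_iso T a" "is_iso T b"
  shows "is_iso T c"
proof -
  note t = distinguished_is_triangle[OF assms(1)] distinguished_is_triangle[OF assms(2)]
  note d = t[unfolded triangle_iff] assms(3)[unfolded triangle_morphism_iff Hom_iff]
  have ty: "a \<in> Hom T (Dom T f) (Dom T f')" "b \<in> Hom T (Cod T f) (Cod T f')" "c \<in> Hom T (Cod T g) (Cod T g')"
    and sq: "b \<cdot> f = f' \<cdot> a" and fty: "f \<in> Hom T (Dom T f) (Cod T f)" "f' \<in> Hom T (Dom T f') (Cod T f')"
    using d by (auto simp: Hom_iff)
  obtain a' where a': "a' \<in> Hom T (Dom T f') (Dom T f)" "a' \<cdot> a = Idt T (Dom T f)" "a \<cdot> a' = Idt T (Dom T f')"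
    using is_isoE[OF assms(4) ty(1)] .
  obtain b' where b': "b' \<in> Hom T (Cod T f') (Cod T f)" "b' \<cdot> b = Idt T (Cod T f)" "b \<cdot> b' = Idt T (Cod T f')"
    using is_isoE[OF assms(5) ty(2)] .
  obtain c' where c': "triangle_morphism T S (f', g', h') (f, g, h) a' b' c'"
    using distinguished_morphism[OF assms(2,1) a'(1) b'(1)
        inverse_square[OF sq fty ty(1,2) a'(1) b'(1) a'(3) b'(2)]] .
  have "is_iso T (c' \<cdot> c)"
    using distinguished_endo_is_iso[OF assms(1)] triangle_morphism_Comp[OF t(1,2,1) assms(3) c'] a' b' by simp
  moreover have "is_iso T (c \<cdot> c')"
    using distinguished_endo_is_iso[OF assms(2)] triangle_morphism_Comp[OF t(2,1,2) c' assms(3)] a' b' by simp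
  ultimately show ?thesis
    by (rule is_iso_of_two_sided[OF _ _ ty(3)]) (use c' d in \<open>auto simp: triangle_morphism_iff Hom_iff\<close>)
qed

lemma triangle_isoI:
  assumes "is_triangle T S (f, g, h)" "is_triangle T S (f', g', h')"
    "triangle_morphism T S (f, g, h) (f', g', h') a b c" "is_iso T a" "is_iso T b" "is_iso T c"
  shows "triangle_iso (f, g, h) (f', g', h')"
  using assms unfolding triangle_iso_def by blast

section \<open>Verification of the axioms\<close>

lemma distinguished_Idt:
  assumes "x \<in> Obj T" "zero_object T z"
  shows "(Idt T x, Zero T x z, Zero T z (on_obj S x)) \<in> distinguished"
proof -
  obtain g h where gh: "(Idt T x, g, h) \<in> Std" "zero_object T (Cod T g)" using Std_Idt[OF assms(1)] by blast
  have zo: "z \<in> Obj T" using assms(2) by (simp add: zero_object_def)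
  note t = Std_is_triangle[OF gh(1)]
  note ty = t[unfolded triangle_iff]
  have t': "is_triangle T S (Idt T x, Zero T x z, Zero T z (on_obj S x))"
    using zo assms(1) by (simp add: triangle_iff)
  let ?c = "Zero T (Cod T g) z"
  have c: "?c \<in> Hom T (Cod T g) z" using ty zo by (auto simp: Hom_iff)
  have h: "h = Zero T (Cod T g) (on_obj S x)"
    by (rule zero_object_unique_from[OF gh(2)]) (use ty assms(1) in \<open>auto simp: Hom_iff\<close>)
  have "triangle_morphism T S (Idt T x, g, h) (Idt T x, Zero T x z, Zero T z (on_obj S x)) (Idt T x) (Idt T x) ?c"
    unfolding triangle_morphism_iff using ty assms(1) zo c h by (auto simp: Hom_iff)
  from triangle_isoI[OF t t' this] have "triangle_iso (Idt T x, g, h) (Idt T x, Zero T x z, Zero T z (on_obj S x))"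
    using is_iso_Idt[OF assms(1)] zero_object_iso[OF gh(2) assms(2) c] by blast
  then show ?thesis using distinguished_iso[OF Std_distinguished[OF gh(1)]] by blast
qed

lemma distinguished_rotate:
  assumes "(f, g, h) \<in> distinguished"
  shows "(g, h, Neg T (on_arr S f)) \<in> distinguished"
proof -
  obtain f1 g1 h1 where 1: "(f1, g1, h1) \<in> Std" "triangle_iso (f1, g1, h1) (f, g, h)"
    using distinguishedE[OF assms(1)] .
  obtain a b c where m: "triangle_morphism T S (f1, g1, h1) (f, g, h) a b c"
    and i: "is_iso T a" "is_iso T b" "is_iso T c"
    using 1(2) unfolding triangle_iso_def by blast
  obtain g2 h2 r where r: "(g1, g2, h2) \<in> Std" "r \<in> Hom T (Cod T g2) (Cod T h1)" "is_iso T r"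
    "r \<cdot> g2 = h1" "Neg T (on_arr S f1) \<cdot> r = h2"
    using Std_rotate[OF 1(1)] by blast
  have t: "is_triangle T S (f1, g1, h1)" "is_triangle T S (f, g, h)" "is_triangle T S (g1, g2, h2)"
    using 1(2) Std_is_triangle[OF r(1)] by (auto simp: triangle_iso_def)
  note d = t[unfolded triangle_iff] m[unfolded triangle_morphism_iff Hom_iff] r(2)[unfolded Hom_iff]
  have t': "is_triangle T S (g, h, Neg T (on_arr S f))" using d by (simp add: triangle_iff)
  have e: "b \<cdot> f1 = f \<cdot> a" using d by auto
  have "on_arr S b \<cdot> on_arr S f1 = on_arr S (b \<cdot> f1)"
    by (rule S_simps(6)[symmetric]) (use d in auto)
  also have "\<dots> = on_arr S f \<cdot> on_arr S a" unfolding e using d by simp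
  finally have e': "on_arr S b \<cdot> on_arr S f1 = on_arr S f \<cdot> on_arr S a" .
  have "on_arr S b \<cdot> h2 = Neg T (on_arr S f) \<cdot> (on_arr S a \<cdot> r)"
    unfolding r(5)[symmetric] using d by (simp add: e'[THEN Comp_eq_Arr])
  then have "triangle_morphism T S (g1, g2, h2) (g, h, Neg T (on_arr S f)) b c (on_arr S a \<cdot> r)"
    unfolding triangle_morphism_iff using d by (auto simp: Hom_iff r(4))
  moreover have "is_iso T (on_arr S a \<cdot> r)"
    by (rule is_iso_Comp[OF r(3) S_is_iso[OF i(1), of "Dom T f1" "Dom T f"] r(2)])
      (use d in \<open>auto simp: Hom_iff\<close>)
  ultimately have "triangle_iso (g1, g2, h2) (g, h, Neg T (on_arr S f))"
    using triangle_isoI[OF t(3) t'] i by blast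
  then show ?thesis using distinguished_iso[OF Std_distinguished[OF r(1)]] by blast
qed

text \<open>Rotating three times turns a triangle into its negated shift, so that the comparison of the
  given triangle with one that starts with \<open>f\<close> can be transported along the full and faithful \<open>S\<close>.\<close>

lemma distinguished_unrotate:
  assumes "(g, h, Neg T (on_arr S f)) \<in> distinguished" "is_triangle T S (f, g, h)"
  shows "(f, g, h) \<in> distinguished"
proof -
  have fa: "f \<in> Arr T" using assms(2) by (simp add: triangle_iff)
  obtain g' h' where s: "(f, g', h') \<in> Std" using Std_ex[OF fa] by blast
  note D = Std_distinguished[OF s]
  have t: "is_triangle T S (f, g', h')" using Std_is_triangle[OF s] .
  note d = t[unfolded triangle_iff] assms(2)[unfolded triangle_iff]
  let ?n = "\<lambda>f. Neg T (on_arr S f)"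
  \<comment> \<open>The hypothesis is already rotated once, so two more rotations bring it level
    with three rotations of the standard triangle; both now begin with the same morphism.\<close>
  have D1: "(?n f, ?n g, ?n h) \<in> distinguished"
    using distinguished_rotate[OF distinguished_rotate[OF assms(1)]] .
  have D2: "(?n f, ?n g', ?n h') \<in> distinguished"
    using distinguished_rotate[OF distinguished_rotate[OF distinguished_rotate[OF D]]] .
  have x: "Dom T f \<in> Obj T" "Cod T f \<in> Obj T" "Cod T g \<in> Obj T" "Cod T g' \<in> Obj T" using d by auto
  obtain c where c: "triangle_morphism T S (?n f, ?n g, ?n h) (?n f, ?n g', ?n h')
      (Idt T (on_obj S (Dom T f))) (Idt T (on_obj S (Cod T f))) c"
    by (rule distinguished_morphism[OF D1 D2, of "Idt T (on_obj S (Dom T f))" "Idt T (on_obj S (Cod T f))"])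
      (use d in \<open>auto simp: Hom_iff\<close>)
  have ci: "is_iso T c"
    by (rule distinguished_is_iso[OF D1 D2 c]) (use d in \<open>auto intro: is_iso_Idt\<close>)
  note cd = c[unfolded triangle_morphism_iff]
  have cty: "c \<in> Hom T (on_obj S (Cod T g)) (on_obj S (Cod T g'))" using cd d by (auto simp: Hom_iff)
  obtain k where k: "k \<in> Hom T (Cod T g) (Cod T g')" "on_arr S k = c" using S_full[OF x(3,4) cty] by blast
  obtain c' where c': "c' \<in> Hom T (on_obj S (Cod T g')) (on_obj S (Cod T g))"
    "c' \<cdot> c = Idt T (on_obj S (Cod T g))" "c \<cdot> c' = Idt T (on_obj S (Cod T g'))"
    using is_isoE[OF ci cty] .
  obtain k' where k': "k' \<in> Hom T (Cod T g') (Cod T g)" "on_arr S k' = c'" using S_full[OF x(4,3) c'(1)] by blast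
  note kty = k(1)[unfolded Hom_iff] k'(1)[unfolded Hom_iff] cty[unfolded Hom_iff]
  have k'k: "k' \<cdot> k = Idt T (Cod T g)"
    by (rule S_faithful[of _ "Cod T g" "Cod T g"]) (use kty k k' c' x in \<open>auto simp: Hom_iff\<close>)
  have kk': "k \<cdot> k' = Idt T (Cod T g')"
    by (rule S_faithful[of _ "Cod T g'" "Cod T g'"]) (use kty k k' c' x in \<open>auto simp: Hom_iff\<close>)
  \<comment> \<open>All three morphisms carry a sign after three rotations, and it is cancelled
    before descending along \<open>S\<close>.\<close>
  have "Neg T (c \<cdot> on_arr S g) = Neg T (on_arr S g')" using cd d kty by (auto simp: Hom_iff)
  from Neg_inject[OF this] have cg: "c \<cdot> on_arr S g = on_arr S g'" using d kty by simp
  have "Neg T (on_arr S h) = Neg T (on_arr S h' \<cdot> c)" using cd d kty by (auto simp: Hom_iff)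
  from Neg_inject[OF this] have hc: "on_arr S h = on_arr S h' \<cdot> c" using d kty by simp
  note e = cg hc
  have kg: "k \<cdot> g = g'"
    by (rule S_faithful[of _ "Dom T g" "Cod T g'"]) (use kty k d e in \<open>auto simp: Hom_iff\<close>)
  have hk: "h' \<cdot> k = h"
    by (rule S_faithful[of _ "Cod T g" "Cod T h"]) (use kty k d e in \<open>auto simp: Hom_iff\<close>)
  have "triangle_morphism T S (f, g, h) (f, g', h') (Idt T (Dom T f)) (Idt T (Cod T f)) k"
    unfolding triangle_morphism_iff using d kty kg hk by (auto simp: Hom_iff)
  from triangle_morphism_inverse[OF assms(2) t this, of "Idt T (Dom T f)" "Idt T (Cod T f)" k']
  have "triangle_morphism T S (f, g', h') (f, g, h) (Idt T (Dom T f)) (Idt T (Cod T f)) k'"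
    using d kty k'k kk' by (auto simp: Hom_iff)
  from triangle_isoI[OF t assms(2) this] have "triangle_iso (f, g', h') (f, g, h)"
    using x is_iso_Idt is_isoI[OF k'(1) k(1) kk' k'k] by blast
  then show ?thesis using distinguished_iso[OF D] by blast
qed

lemma distinguished_unique:
  assumes "(f, g, h) \<in> distinguished" "(f, g', h') \<in> distinguished"
  obtains c c' where "c \<in> Hom T (Cod T g) (Cod T g')" "c' \<in> Hom T (Cod T g') (Cod T g)"
    "c' \<cdot> c = Idt T (Cod T g)" "c \<cdot> c' = Idt T (Cod T g')" "c \<cdot> g = g'" "h' \<cdot> c = h"
    "is_iso T c"
proof -
  note d = assms[THEN distinguished_is_triangle, unfolded triangle_iff]
  have x: "Dom T f \<in> Obj T" "Cod T f \<in> Obj T" using d by auto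
  obtain c where c: "triangle_morphism T S (f, g, h) (f, g', h') (Idt T (Dom T f)) (Idt T (Cod T f)) c"
    by (rule distinguished_morphism[OF assms, of "Idt T (Dom T f)" "Idt T (Cod T f)"])
      (use d in \<open>auto simp: Hom_iff\<close>)
  note cd = c[unfolded triangle_morphism_iff]
  have cty: "c \<in> Hom T (Cod T g) (Cod T g')" and "c \<cdot> g = g'" "h' \<cdot> c = h"
    using cd d by auto
  moreover have ci: "is_iso T c" by (rule distinguished_is_iso[OF assms c]) (use x is_iso_Idt in auto)
  ultimately show ?thesis using is_isoE[OF ci cty] that by metis
qed

text \<open>Each given triangle is compared by \<open>distinguished_unique\<close> with the standard
  one on the same first morphism. Conjugating the standard octahedron by the comparisons \<alpha>,
  \<beta>, \<gamma> gives one on the given triangles.\<close>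

lemma octahedron:
  assumes "(u, i, i') \<in> distinguished" "(v, j, j') \<in> distinguished" "(v \<cdot> u, k, k') \<in> distinguished"
    "Cod T u = Dom T v"
  shows "\<exists>f g. (f, g, on_arr S i \<cdot> j') \<in> distinguished \<and>
        triangle_morphism T S (u, i, i') (v \<cdot> u, k, k') (Idt T (Dom T u)) v f \<and>
        triangle_morphism T S (v \<cdot> u, k, k') (v, j, j') u (Idt T (Cod T v)) g"
proof -
  note t = assms(1-3)[THEN distinguished_is_triangle, unfolded triangle_iff]
  have uv: "u \<in> Arr T" "v \<in> Arr T" using t by auto
  obtain i0 i0' j0 j0' k0 k0' f0 g0 q s r where st: "(u, i0, i0') \<in> Std" "(v, j0, j0') \<in> Std"
    "(v \<cdot> u, k0, k0') \<in> Std" "(f0, q, s) \<in> Std"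
    and m1: "triangle_morphism T S (u, i0, i0') (v \<cdot> u, k0, k0') (Idt T (Dom T u)) v f0"
    and m2: "triangle_morphism T S (v \<cdot> u, k0, k0') (v, j0, j0') u (Idt T (Cod T v)) g0"
    and r: "r \<in> Hom T (Cod T j0) (Cod T q)" "is_iso T r" "r \<cdot> g0 = q" "s \<cdot> r = on_arr S i0 \<cdot> j0'"
    using Std_octahedron[OF uv assms(4)] by blast
  note tst = st[THEN Std_is_triangle, unfolded triangle_iff]
  obtain \<alpha> \<alpha>' where a: "\<alpha> \<in> Hom T (Cod T i0) (Cod T i)" "\<alpha>' \<in> Hom T (Cod T i) (Cod T i0)"
    "\<alpha>' \<cdot> \<alpha> = Idt T (Cod T i0)" "\<alpha> \<cdot> \<alpha>' = Idt T (Cod T i)" "\<alpha> \<cdot> i0 = i" "i' \<cdot> \<alpha> = i0'" "is_iso T \<alpha>"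
    using distinguished_unique[OF Std_distinguished[OF st(1)] assms(1)] .
  obtain \<beta> \<beta>' where b: "\<beta> \<in> Hom T (Cod T j0) (Cod T j)" "\<beta>' \<in> Hom T (Cod T j) (Cod T j0)"
    "\<beta>' \<cdot> \<beta> = Idt T (Cod T j0)" "\<beta> \<cdot> \<beta>' = Idt T (Cod T j)" "\<beta> \<cdot> j0 = j" "j' \<cdot> \<beta> = j0'" "is_iso T \<beta>"
    using distinguished_unique[OF Std_distinguished[OF st(2)] assms(2)] .
  obtain \<gamma> \<gamma>' where c: "\<gamma> \<in> Hom T (Cod T k0) (Cod T k)" "\<gamma>' \<in> Hom T (Cod T k) (Cod T k0)"
    "\<gamma>' \<cdot> \<gamma> = Idt T (Cod T k0)" "\<gamma> \<cdot> \<gamma>' = Idt T (Cod T k)" "\<gamma> \<cdot> k0 = k" "k' \<cdot> \<gamma> = k0'" "is_iso T \<gamma>"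
    using distinguished_unique[OF Std_distinguished[OF st(3)] assms(3)] .
  obtain r' where r': "r' \<in> Hom T (Cod T q) (Cod T j0)" "r' \<cdot> r = Idt T (Cod T j0)" "r \<cdot> r' = Idt T (Cod T q)"
    using is_isoE[OF r(2,1)] .
  note ty = t tst assms(4) a(1,2)[unfolded Hom_iff] b(1,2)[unfolded Hom_iff] c(1,2)[unfolded Hom_iff]
    r(1)[unfolded Hom_iff] r'(1)[unfolded Hom_iff]
  have fty: "f0 \<in> Arr T" "Dom T f0 = Cod T i0" "Cod T f0 = Cod T k0"
    "g0 \<in> Arr T" "Dom T g0 = Cod T k0" "Cod T g0 = Cod T j0"
    using m1 m2 ty by (auto simp: triangle_morphism_iff Hom_iff)
  have ai: "\<alpha>' \<cdot> i = i0" "i0' \<cdot> \<alpha>' = i'"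
    unfolding a(5,6)[symmetric] using ty by (simp_all add: a(3,4) a(3)[THEN Comp_eq_Arr])
  have ck: "\<gamma>' \<cdot> k = k0" "k0' \<cdot> \<gamma>' = k'"
    unfolding c(5,6)[symmetric] using ty by (simp_all add: c(3,4) c(3)[THEN Comp_eq_Arr])
  have mm: "f0 \<cdot> i0 = k0 \<cdot> v" "k0' \<cdot> f0 = i0'" "g0 \<cdot> k0 = j0" "j0' \<cdot> g0 = on_arr S u \<cdot> k0'"
    using m1 m2 ty fty unfolding triangle_morphism_iff by (metis Comp_Idt(1), metis Comp_Idt(2) S_simps(2) Dom_in_Obj, metis Comp_Idt(1), metis)
  note ty = ty fty
  have rq: "r' \<cdot> q = g0" unfolding r(3)[symmetric] using ty by (simp add: r'(2)[THEN Comp_eq_Arr])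
  define f where "f = \<gamma> \<cdot> f0 \<cdot> \<alpha>'"
  define g where "g = \<beta> \<cdot> g0 \<cdot> \<gamma>'"
  have fg: "f \<in> Arr T" "Dom T f = Cod T i" "Cod T f = Cod T k" "g \<in> Arr T" "Dom T g = Cod T k" "Cod T g = Cod T j"
    using ty by (auto simp: f_def g_def)
  note R = a(3-6) b(3-6) c(3-6) r'(2,3) ai ck mm rq r(4)
  note R = R R[THEN Comp_eq_Arr]
  have "f \<cdot> i = k \<cdot> v" "k' \<cdot> f = i'" "g \<cdot> k = j" "j' \<cdot> g = on_arr S u \<cdot> k'"
    unfolding f_def g_def using ty by (simp_all add: R)
  then have M: "triangle_morphism T S (u, i, i') (v \<cdot> u, k, k') (Idt T (Dom T u)) v f"
    "triangle_morphism T S (v \<cdot> u, k, k') (v, j, j') u (Idt T (Cod T v)) g"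
    unfolding triangle_morphism_iff using ty fg by (auto simp: Hom_iff)
  have t': "is_triangle T S (f, g, on_arr S i \<cdot> j')" using ty fg by (auto simp: triangle_iff)
  have "s = s \<cdot> r \<cdot> r'" using ty by (simp add: r'(3))
  also have "\<dots> = on_arr S i0 \<cdot> j0' \<cdot> r'" using ty by (simp add: r(4)[THEN Comp_eq_Arr])
  finally have s: "s = on_arr S i0 \<cdot> j0' \<cdot> r'" .
  have Sa: "on_arr S \<alpha> \<cdot> on_arr S i0 = on_arr S i" unfolding a(5)[symmetric] using ty by simp
  \<comment> \<open>The third component is \<open>\<beta> \<cdot> r'\<close>, not \<beta>: the
    standard triangle on \<open>f0\<close> ends in the codomain of \<open>q\<close>, and
    \<open>r'\<close> leads from there to the codomain of \<open>j0\<close>.\<close>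
  have "on_arr S \<alpha> \<cdot> s = (on_arr S i \<cdot> j') \<cdot> (\<beta> \<cdot> r')"
    unfolding s using ty by (simp add: R Sa[THEN Comp_eq_Arr])
  moreover have "\<gamma> \<cdot> f0 = f \<cdot> \<alpha>" "(\<beta> \<cdot> r') \<cdot> q = g \<cdot> \<gamma>"
    unfolding f_def g_def using ty by (simp_all add: R)
  ultimately have m: "triangle_morphism T S (f0, q, s) (f, g, on_arr S i \<cdot> j') \<alpha> \<gamma> (\<beta> \<cdot> r')"
    unfolding triangle_morphism_iff using ty fg by (auto simp: Hom_iff)
  have "is_iso T (\<beta> \<cdot> r')"
    by (rule is_iso_Comp[OF is_isoI[OF r'(1) r(1) r'(3,2)] b(7) r'(1) b(1)])
  then have "triangle_iso (f0, q, s) (f, g, on_arr S i \<cdot> j')"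
    using triangle_isoI[OF Std_is_triangle[OF st(4)] t' m] a c by blast
  then show ?thesis using M distinguished_iso[OF Std_distinguished[OF st(4)]] by blast
qed

theorem triangulated: "triangulated_category T S distinguished"
proof
  show "is_additive_functor T T S" by (rule S_additive)
  show "is_equivalence T T S"
    by (rule is_equivalenceI[OF category_axioms category_axioms S_functor S_full S_faithful S_dense])
  show "is_triangle T S t" if "t \<in> distinguished" for t using that by (rule distinguished_is_triangle)
  show "t' \<in> distinguished" if "t \<in> distinguished" "is_triangle T S t'" "triangle_morphism T S t t' a b c"
      "is_iso T a" "is_iso T b" "is_iso T c" for t t' a b c
    using that triangle_isoI distinguished_iso distinguished_is_triangle by (cases t, cases t') blast
  show "(Idt T x, Zero T x z, Zero T z (on_obj S x)) \<in> distinguished" if "x \<in> Obj T" "zero_object T z" for x z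
    using that by (rule distinguished_Idt)
  show "\<exists>g h. (f, g, h) \<in> distinguished" if "f \<in> Arr T" for f
    using Std_ex[OF that] Std_distinguished by blast
  show "(f, g, h) \<in> distinguished \<longleftrightarrow> (g, h, Neg T (on_arr S f)) \<in> distinguished"
    if "is_triangle T S (f, g, h)" for f g h
    using that distinguished_rotate distinguished_unrotate by blast
  show "\<exists>c. triangle_morphism T S (f, g, h) (f', g', h') a b c"
    if "(f, g, h) \<in> distinguished" "(f', g', h') \<in> distinguished" "a \<in> Hom T (Dom T f) (Dom T f')"
      "b \<in> Hom T (Cod T f) (Cod T f')" "b \<cdot> f = f' \<cdot> a" for f g h f' g' h' a b
    using distinguished_morphism[OF that] by blast
qed (rule octahedron)

end

section \<open>Categories presented as stable categories\<close>

text \<open>Describes a category with a full and faithful functor to the stable category that is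
  surjective on objects, with \<open>cls x y\<close> the inverse bijection from stable classes to
  morphisms. It is all that the triangulated structure needs to know about the localization.\<close>

locale stable_quotient = frobenius_category E + H: category H
  for E :: "('o, 'm, 'z) exact_data_scheme" (structure) and H :: "('p, 'n) category_data" +
  fixes ob :: "'p \<Rightarrow> 'o" and cls :: "'p \<Rightarrow> 'p \<Rightarrow> 'm \<Rightarrow> 'n"
  assumes ob_in_Obj: "x \<in> Obj H \<Longrightarrow> ob x \<in> Obj E"
    and ob_surj: "c \<in> Obj E \<Longrightarrow> \<exists>x \<in> Obj H. ob x = c"
    and cls_in_Hom: "\<lbrakk>x \<in> Obj H; y \<in> Obj H; f \<in> Hom E (ob x) (ob y)\<rbrakk> \<Longrightarrow> cls x y f \<in> Hom H x y"
    and cls_surj: "\<phi> \<in> Hom H x y \<Longrightarrow> \<exists>f \<in> Hom E (ob x) (ob y). cls x y f = \<phi>"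
    and cls_eq_iff: "\<lbrakk>x \<in> Obj H; y \<in> Obj H; f \<in> Hom E (ob x) (ob y); g \<in> Hom E (ob x) (ob y)\<rbrakk>
      \<Longrightarrow> cls x y f = cls x y g \<longleftrightarrow> f \<approx> g"
    and cls_Comp: "\<lbrakk>x \<in> Obj H; y \<in> Obj H; z \<in> Obj H; f \<in> Hom E (ob x) (ob y); g \<in> Hom E (ob y) (ob z)\<rbrakk>
      \<Longrightarrow> cls y z g \<cdot>\<^bsub>H\<^esub> cls x y f = cls x z (g \<cdot> f)"
    and cls_Idt: "x \<in> Obj H \<Longrightarrow> cls x x (Idt E (ob x)) = Idt H x"
begin

declare ob_in_Obj [simp]

section \<open>The additive structure on classes\<close>

definition rep :: "'n \<Rightarrow> 'm" where
  "rep \<phi> = (SOME f. f \<in> Hom E (ob (Dom H \<phi>)) (ob (Cod H \<phi>)) \<and> cls (Dom H \<phi>) (Cod H \<phi>) f = \<phi>)"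

text \<open>All fields of \<open>H\<close> are kept and only an addition is added, so that
  truncation gives back \<open>H\<close> itself and not merely an equivalent category.\<close>

definition T :: "('p, 'n) preadditive_data" where
  "T = \<lparr>Obj = Obj H, Arr = Arr H, Dom = Dom H, Cod = Cod H, Idt = Idt H, Comp = Comp H,
    Add = (\<lambda>\<phi> \<psi>. cls (Dom H \<phi>) (Cod H \<phi>) (rep \<phi> \<oplus> rep \<psi>)),
    Zero = (\<lambda>x y. cls x y (Zero E (ob x) (ob y)))\<rparr>"

lemma T_simps [simp]:
  "Obj T = Obj H" "Arr T = Arr H" "Dom T = Dom H" "Cod T = Cod H" "Idt T = Idt H"
  "Comp T = Comp H" "Hom T = Hom H" "Zero T x y = cls x y (Zero E (ob x) (ob y))"
  by (auto simp: T_def Hom_def fun_eq_iff)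

lemma truncate_T: "category_data.truncate T = H"
  by (simp add: T_def category_data.truncate_def)

lemma cls_simps [simp]:
  assumes "x \<in> Obj H" "y \<in> Obj H" "f \<in> Arr E" "Dom E f = ob x" "Cod E f = ob y"
  shows "cls x y f \<in> Arr H" "Dom H (cls x y f) = x" "Cod H (cls x y f) = y"
  using cls_in_Hom[of x y f] assms by (auto simp: Hom_iff)

lemma rep:
  assumes "x \<in> Obj H" "y \<in> Obj H" "f \<in> Hom E (ob x) (ob y)"
  shows "rep (cls x y f) \<approx> f" "rep (cls x y f) \<in> Hom E (ob x) (ob y)"
proof -
  have d: "Dom H (cls x y f) = x" "Cod H (cls x y f) = y" using assms by (auto simp: Hom_iff)
  have "\<exists>g. g \<in> Hom E (ob x) (ob y) \<and> cls x y g = cls x y f" using assms by blast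
  from someI_ex[OF this] have "rep (cls x y f) \<in> Hom E (ob x) (ob y) \<and> cls x y (rep (cls x y f)) = cls x y f"
    by (simp add: rep_def d)
  then show "rep (cls x y f) \<approx> f" "rep (cls x y f) \<in> Hom E (ob x) (ob y)"
    using cls_eq_iff[OF assms(1,2) _ assms(3)] by auto
qed

lemma cls_cases:
  assumes "\<phi> \<in> Hom H x y"
  obtains f where "x \<in> Obj H" "y \<in> Obj H" "f \<in> Hom E (ob x) (ob y)" "\<phi> = cls x y f"
  using cls_surj[OF assms] H.Hom_Obj[OF assms] by blast

lemma cls_eqI:
  assumes "x \<in> Obj H" "y \<in> Obj H" "f \<approx> g" "Dom E f = ob x" "Cod E f = ob y"
  shows "cls x y f = cls x y g"
  using cls_eq_iff[of x y f g] assms steqD[OF assms(3)] by (auto simp: Hom_iff)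

lemma cls_Comp' [simp]:
  "\<lbrakk>x \<in> Obj H; y \<in> Obj H; z \<in> Obj H; f \<in> Arr E; Dom E f = ob x; Cod E f = ob y;
      g \<in> Arr E; Dom E g = ob y; Cod E g = ob z\<rbrakk>
    \<Longrightarrow> cls y z g \<cdot>\<^bsub>H\<^esub> cls x y f = cls x z (g \<cdot> f)"
  by (rule cls_Comp) (auto simp: Hom_iff)

lemma cls_Add:
  assumes "x \<in> Obj H" "y \<in> Obj H" "f \<in> Hom E (ob x) (ob y)" "g \<in> Hom E (ob x) (ob y)"
  shows "cls x y f \<oplus>\<^bsub>T\<^esub> cls x y g = cls x y (f \<oplus> g)"
proof -
  note r = rep[OF assms(1,2,3)] rep[OF assms(1,2,4)]
  have "rep (cls x y f) \<oplus> rep (cls x y g) \<approx> f \<oplus> g"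
    by (rule steq_Add) (use r in \<open>auto simp: Hom_iff\<close>)
  then have "cls x y (rep (cls x y f) \<oplus> rep (cls x y g)) = cls x y (f \<oplus> g)"
    by (rule cls_eqI[OF assms(1,2)]) (use r in \<open>auto simp: Hom_iff\<close>)
  then show ?thesis using assms by (simp add: T_def Hom_iff)
qed

lemma cls_Add' [simp]:
  "\<lbrakk>x \<in> Obj H; y \<in> Obj H; f \<in> Arr E; Dom E f = ob x; Cod E f = ob y;
      g \<in> Arr E; Dom E g = ob x; Cod E g = ob y\<rbrakk>
    \<Longrightarrow> cls x y f \<oplus>\<^bsub>T\<^esub> cls x y g = cls x y (f \<oplus> g)"
  by (rule cls_Add) (auto simp: Hom_iff)

lemma carrier_cases:
  assumes "\<phi> \<in> carrier (hom_group T x y)"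
  obtains f where "f \<in> Hom E (ob x) (ob y)" "\<phi> = cls x y f"
  using cls_surj[of \<phi> x y] assms by (auto simp: hom_group_def)

lemma comm_group_T:
  assumes o: "x \<in> Obj H" "y \<in> Obj H"
  shows "comm_group (hom_group T x y)"
proof (rule comm_groupI)
  let ?G = "hom_group T x y"
  note sel = hom_group_def
  show "\<phi> \<otimes>\<^bsub>?G\<^esub> \<psi> \<in> carrier (?G)"
    if c: "\<phi> \<in> carrier (?G)" "\<psi> \<in> carrier (?G)" for \<phi> \<psi>
  proof -
    obtain f where f: "f \<in> Hom E (ob x) (ob y)" "\<phi> = cls x y f" using carrier_cases[OF c(1)] .
    obtain g where g: "g \<in> Hom E (ob x) (ob y)" "\<psi> = cls x y g" using carrier_cases[OF c(2)] .
    show ?thesis using f g o by (auto simp: sel Hom_iff)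
  qed
  show "\<one>\<^bsub>?G\<^esub> \<in> carrier (?G)"
    using o by (auto simp: sel Hom_iff)
  show "\<phi> \<otimes>\<^bsub>?G\<^esub> \<psi> \<otimes>\<^bsub>?G\<^esub> \<chi> = \<phi> \<otimes>\<^bsub>?G\<^esub> (\<psi> \<otimes>\<^bsub>?G\<^esub> \<chi>)"
    if c: "\<phi> \<in> carrier (?G)" "\<psi> \<in> carrier (?G)" "\<chi> \<in> carrier (?G)" for \<phi> \<psi> \<chi>
  proof -
    obtain f where f: "f \<in> Hom E (ob x) (ob y)" "\<phi> = cls x y f" using carrier_cases[OF c(1)] .
    obtain g where g: "g \<in> Hom E (ob x) (ob y)" "\<psi> = cls x y g" using carrier_cases[OF c(2)] .
    obtain h where h: "h \<in> Hom E (ob x) (ob y)" "\<chi> = cls x y h" using carrier_cases[OF c(3)] .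
    show ?thesis using f g h o by (simp add: sel Hom_iff Add_assoc)
  qed
  show "\<phi> \<otimes>\<^bsub>?G\<^esub> \<psi> = \<psi> \<otimes>\<^bsub>?G\<^esub> \<phi>"
    if c: "\<phi> \<in> carrier (?G)" "\<psi> \<in> carrier (?G)" for \<phi> \<psi>
  proof -
    obtain f where f: "f \<in> Hom E (ob x) (ob y)" "\<phi> = cls x y f" using carrier_cases[OF c(1)] .
    obtain g where g: "g \<in> Hom E (ob x) (ob y)" "\<psi> = cls x y g" using carrier_cases[OF c(2)] .
    show ?thesis using f g o by (simp add: sel Hom_iff Add_commute)
  qed
  show "\<one>\<^bsub>?G\<^esub> \<otimes>\<^bsub>?G\<^esub> \<phi> = \<phi>" if c: "\<phi> \<in> carrier (?G)" for \<phi>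
  proof -
    obtain f where f: "f \<in> Hom E (ob x) (ob y)" "\<phi> = cls x y f" using carrier_cases[OF c(1)] .
    show ?thesis using f o by (simp add: sel Hom_iff)
  qed
  show "\<exists>\<psi> \<in> carrier (?G). \<psi> \<otimes>\<^bsub>?G\<^esub> \<phi> = \<one>\<^bsub>?G\<^esub>"
    if c: "\<phi> \<in> carrier (?G)" for \<phi>
  proof -
    obtain f where f: "f \<in> Hom E (ob x) (ob y)" "\<phi> = cls x y f" using carrier_cases[OF c(1)] .
    show ?thesis by (rule bexI[of _ "cls x y (Neg E f)"]) (use f o in \<open>auto simp: sel Hom_iff\<close>)
  qed
qed

lemma category_T: "category T"
  by unfold_locales (use H.Idt_in_Hom H.Comp_in_Hom H.Comp_assoc H.Idt_right H.Idt_left in auto)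

sublocale T: preadditive_category T
proof -
  show "preadditive_category T"
  proof (intro preadditive_category.intro preadditive_category_axioms.intro category_T)
    show "comm_group (hom_group T x y)" if "x \<in> Obj T" "y \<in> Obj T" for x y
      using that by (simp add: comm_group_T)
    show "\<chi> \<cdot>\<^bsub>T\<^esub> (\<phi> \<oplus>\<^bsub>T\<^esub> \<psi>) = (\<chi> \<cdot>\<^bsub>T\<^esub> \<phi>) \<oplus>\<^bsub>T\<^esub> (\<chi> \<cdot>\<^bsub>T\<^esub> \<psi>)"
      if c: "\<phi> \<in> Hom T x y" "\<psi> \<in> Hom T x y" "\<chi> \<in> Hom T y z" for \<phi> \<psi> \<chi> x y z
    proof -
      obtain f where f: "x \<in> Obj H" "y \<in> Obj H" "f \<in> Hom E (ob x) (ob y)" "\<phi> = cls x y f"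
        using cls_cases[OF c(1)[unfolded T_simps]] by blast
      obtain g where g: "g \<in> Hom E (ob x) (ob y)" "\<psi> = cls x y g" using cls_surj[OF c(2)[unfolded T_simps]] by blast
      obtain h where h: "z \<in> Obj H" "h \<in> Hom E (ob y) (ob z)" "\<chi> = cls y z h"
        using cls_cases[OF c(3)[unfolded T_simps]] by blast
      show ?thesis using f g h by (simp add: Hom_iff Comp_Add)
    qed
    show "(\<psi> \<oplus>\<^bsub>T\<^esub> \<chi>) \<cdot>\<^bsub>T\<^esub> \<phi> = (\<psi> \<cdot>\<^bsub>T\<^esub> \<phi>) \<oplus>\<^bsub>T\<^esub> (\<chi> \<cdot>\<^bsub>T\<^esub> \<phi>)"
      if c: "\<phi> \<in> Hom T x y" "\<psi> \<in> Hom T y z" "\<chi> \<in> Hom T y z" for \<phi> \<psi> \<chi> x y z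
    proof -
      obtain f where f: "x \<in> Obj H" "y \<in> Obj H" "f \<in> Hom E (ob x) (ob y)" "\<phi> = cls x y f"
        using cls_cases[OF c(1)[unfolded T_simps]] by blast
      obtain g where g: "z \<in> Obj H" "g \<in> Hom E (ob y) (ob z)" "\<psi> = cls y z g"
        using cls_cases[OF c(2)[unfolded T_simps]] by blast
      obtain h where h: "h \<in> Hom E (ob y) (ob z)" "\<chi> = cls y z h" using cls_surj[OF c(3)[unfolded T_simps]] by blast
      show ?thesis using f g h by (simp add: Hom_iff Comp_Add)
    qed
  qed
qed

lemma Neg_cls:
  assumes "x \<in> Obj H" "y \<in> Obj H" "f \<in> Hom E (ob x) (ob y)"
  shows "Neg T (cls x y f) = cls x y (Neg E f)"
  by (rule T.Neg_unique[symmetric]) (use assms in \<open>auto simp: Hom_iff\<close>)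

text \<open>Composing any morphism into or out of \<open>z\<close> with the identity of
  \<open>ob z\<close> makes it stably equal to a composite with zero.\<close>

lemma zero_object_T:
  assumes z: "z \<in> Obj H" and 0: "Idt E (ob z) \<approx> Zero E (ob z) (ob z)"
  shows "zero_object T z"
proof -
  have "\<exists>!\<phi>. \<phi> \<in> Hom H z x" if x: "x \<in> Obj H" for x
  proof (rule ex1I)
    show "cls z x (Zero E (ob z) (ob x)) \<in> Hom H z x" using x z by (auto simp: Hom_iff)
    fix \<phi> assume "\<phi> \<in> Hom H z x"
    then obtain f where f: "f \<in> Hom E (ob z) (ob x)" "\<phi> = cls z x f" using cls_surj by blast
    have "f \<cdot> Idt E (ob z) \<approx> f \<cdot> Zero E (ob z) (ob z)"
      by (rule steq_Comp_left[OF 0]) (use f z in \<open>auto simp: Hom_iff\<close>)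
    then show "\<phi> = cls z x (Zero E (ob z) (ob x))"
      unfolding f(2) by (intro cls_eqI) (use f(1) x z in \<open>auto simp: Hom_iff\<close>)
  qed
  moreover have "\<exists>!\<phi>. \<phi> \<in> Hom H x z" if x: "x \<in> Obj H" for x
  proof (rule ex1I)
    show "cls x z (Zero E (ob x) (ob z)) \<in> Hom H x z" using x z by (auto simp: Hom_iff)
    fix \<phi> assume "\<phi> \<in> Hom H x z"
    then obtain f where f: "f \<in> Hom E (ob x) (ob z)" "\<phi> = cls x z f" using cls_surj by blast
    have "Idt E (ob z) \<cdot> f \<approx> Zero E (ob z) (ob z) \<cdot> f"
      by (rule steq_Comp_right[OF 0]) (use f z in \<open>auto simp: Hom_iff\<close>)
    then show "\<phi> = cls x z (Zero E (ob x) (ob z))"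
      unfolding f(2) by (intro cls_eqI) (use f(1) x z in \<open>auto simp: Hom_iff\<close>)
  qed
  ultimately show ?thesis using z by (simp add: zero_object_def)
qed

sublocale T: additive_category T
proof
  obtain z where z: "zero_object E z" using ex_zero_object by blast
  then have zo: "z \<in> Obj E" by (simp add: zero_object_def)
  obtain x where x: "x \<in> Obj H" "ob x = z" using ob_surj[OF zo] by blast
  have "Idt E z = Zero E z z"
    using z zo Idt_in_Hom[OF zo] Zero_simps[OF zo zo] unfolding zero_object_def by (metis Hom_iff)
  then have "zero_object T x"
    by (intro zero_object_T[OF x(1)]) (use x zo steq_refl[of "Idt E z"] in auto)
  then show "\<exists>z. zero_object T z" ..
next
  fix x y assume "x \<in> Obj T" "y \<in> Obj T"
  then have o: "x \<in> Obj H" "y \<in> Obj H" by auto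
  obtain c i j p q where b: "i \<in> Hom E (ob x) c" "j \<in> Hom E (ob y) c" "p \<in> Hom E c (ob x)" "q \<in> Hom E c (ob y)"
    "p \<cdot> i = Idt E (ob x)" "q \<cdot> j = Idt E (ob y)" "p \<cdot> j = Zero E (ob y) (ob x)" "q \<cdot> i = Zero E (ob x) (ob y)"
    "(i \<cdot> p) \<oplus> (j \<cdot> q) = Idt E c"
    using ex_biproduct[of "ob x" "ob y"] o by (auto 0 3)
  have "c \<in> Obj E" using b Hom_Obj by blast
  then obtain w where w: "w \<in> Obj H" "ob w = c" using ob_surj by blast
  show "\<exists>b. \<exists>i \<in> Hom T x b. \<exists>j \<in> Hom T y b. \<exists>p \<in> Hom T b x. \<exists>q \<in> Hom T b y.
        p \<cdot>\<^bsub>T\<^esub> i = Idt T x \<and> q \<cdot>\<^bsub>T\<^esub> j = Idt T y \<and> p \<cdot>\<^bsub>T\<^esub> j = Zero T y x \<and> q \<cdot>\<^bsub>T\<^esub> i = Zero T x y \<and>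
        (i \<cdot>\<^bsub>T\<^esub> p) \<oplus>\<^bsub>T\<^esub> (j \<cdot>\<^bsub>T\<^esub> q) = Idt T b"
    by (rule exI[of _ w], rule bexI[of _ "cls x w i"], rule bexI[of _ "cls y w j"],
        rule bexI[of _ "cls w x p"], rule bexI[of _ "cls w y q"])
      (use o w b in \<open>auto simp: Hom_iff cls_Idt\<close>)
qed

text \<open>Suspensions and cones are objects of \<open>E\<close>; the section names an object of
  \<open>H\<close> lying over each of them.\<close>

definition sec :: "'o \<Rightarrow> 'p" where "sec c = (SOME x. x \<in> Obj H \<and> ob x = c)"

lemma sec [simp]: assumes "c \<in> Obj E" shows "sec c \<in> Obj H" "ob (sec c) = c"
proof -
  have "\<exists>x. x \<in> Obj H \<and> ob x = c" using ob_surj[OF assms] by blast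
  from someI_ex[OF this] show "sec c \<in> Obj H" "ob (sec c) = c" by (simp_all add: sec_def)
qed

definition S :: "('p, 'n, 'p, 'n) functor_data" where
  "S = \<lparr>on_obj = (\<lambda>x. sec (susp (ob x))),
    on_arr = (\<lambda>\<phi>. cls (sec (susp (ob (Dom H \<phi>)))) (sec (susp (ob (Cod H \<phi>)))) (SOME g. shift (rep \<phi>) g))\<rparr>"

lemma S_obj [simp]: "x \<in> Obj H \<Longrightarrow> on_obj S x \<in> Obj H" "x \<in> Obj H \<Longrightarrow> ob (on_obj S x) = susp (ob x)"
  by (auto simp: S_def)

text \<open>Independence of the representative and of the suspension chosen in \<open>S\<close>:
  both ambiguities are stable equalities by \<open>shift_steq\<close>, and \<open>cls\<close>
  identifies them.\<close>

lemma S_cls: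
  assumes "x \<in> Obj H" "y \<in> Obj H" "f \<in> Hom E (ob x) (ob y)" "shift f g"
  shows "on_arr S (cls x y f) = cls (on_obj S x) (on_obj S y) g"
proof -
  note r = rep[OF assms(1-3)]
  obtain g' where "shift (rep (cls x y f)) g'" using shift_ex[OF r(2)] .
  then have s: "shift (rep (cls x y f)) (SOME g. shift (rep (cls x y f)) g)" by (rule someI)
  have "(SOME g. shift (rep (cls x y f)) g) \<approx> g" by (rule shift_steq[OF s assms(4) r(1)])
  moreover have "(SOME g. shift (rep (cls x y f)) g) \<in> Hom E (susp (ob x)) (susp (ob y))"
    using s r(2) by (auto simp: shift_def Hom_iff)
  ultimately have "cls (on_obj S x) (on_obj S y) (SOME g. shift (rep (cls x y f)) g) = cls (on_obj S x) (on_obj S y) g"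
    by (intro cls_eqI) (use assms in \<open>auto simp: Hom_iff\<close>)
  then show ?thesis using assms by (simp add: S_def Hom_iff)
qed

lemma is_iso_cls:
  assumes "x \<in> Obj H" "y \<in> Obj H" "f \<in> Hom E (ob x) (ob y)" "stable_inverse f g"
  shows "is_iso T (cls x y f)"
proof (rule is_isoI[of _ _ x y "cls y x g"])
  have g: "g \<in> Hom E (ob y) (ob x)" "g \<cdot> f \<approx> Idt E (ob x)" "f \<cdot> g \<approx> Idt E (ob y)"
    using assms(3,4) by (auto simp: stable_inverse_def Hom_iff)
  show "cls x y f \<in> Hom T x y" "cls y x g \<in> Hom T y x" using assms(1-3) g(1) by (auto simp: Hom_iff)
  show "cls y x g \<cdot>\<^bsub>T\<^esub> cls x y f = Idt T x" "cls x y f \<cdot>\<^bsub>T\<^esub> cls y x g = Idt T y"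
    using assms(1-3) g cls_eqI[OF assms(1,1) g(2)] cls_eqI[OF assms(2,2) g(3)] by (auto simp: Hom_iff cls_Idt)
qed

lemma is_functor_S: "is_functor T T S"
  unfolding is_functor_def
proof (intro conjI ballI impI)
  fix x assume x: "x \<in> Obj T"
  then show "on_obj S x \<in> Obj T" by simp
  have "on_arr S (cls x x (Idt E (ob x))) = cls (on_obj S x) (on_obj S x) (Idt E (susp (ob x)))"
    by (rule S_cls) (use x shift_Idt in \<open>auto simp: Hom_iff\<close>)
  then show "on_arr S (Idt T x) = Idt T (on_obj S x)"
    using x cls_Idt[of "on_obj S x"] by (simp add: cls_Idt)
next
  fix \<phi> assume "\<phi> \<in> Arr T"
  then have "\<phi> \<in> Hom H (Dom H \<phi>) (Cod H \<phi>)" by (simp add: Hom_iff)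
  from cls_cases[OF this] obtain f where f: "Dom H \<phi> \<in> Obj H" "Cod H \<phi> \<in> Obj H"
    "f \<in> Hom E (ob (Dom H \<phi>)) (ob (Cod H \<phi>))" "\<phi> = cls (Dom H \<phi>) (Cod H \<phi>) f" .
  obtain g where g: "shift f g" using shift_ex[OF f(3)] .
  have "on_arr S \<phi> = cls (on_obj S (Dom H \<phi>)) (on_obj S (Cod H \<phi>)) g"
    using S_cls[OF f(1-3) g] f(4) by simp
  then show "on_arr S \<phi> \<in> Hom T (on_obj S (Dom T \<phi>)) (on_obj S (Cod T \<phi>))"
    using f(1-3) g by (auto simp: Hom_iff shift_def)
next
  fix \<phi> \<psi> assume a: "\<phi> \<in> Arr T" "\<psi> \<in> Arr T" "Cod T \<phi> = Dom T \<psi>"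
  define x y z where "x = Dom H \<phi>" and "y = Cod H \<phi>" and "z = Cod H \<psi>"
  have "\<phi> \<in> Hom H x y" "\<psi> \<in> Hom H y z" using a by (auto simp: Hom_iff x_def y_def z_def)
  then obtain f g where f: "x \<in> Obj H" "y \<in> Obj H" "f \<in> Hom E (ob x) (ob y)" "\<phi> = cls x y f"
    and g: "z \<in> Obj H" "g \<in> Hom E (ob y) (ob z)" "\<psi> = cls y z g"
    using cls_cases by metis
  obtain f' where f': "shift f f'" using shift_ex[OF f(3)] .
  obtain g' where g': "shift g g'" using shift_ex[OF g(2)] .
  have "shift (g \<cdot> f) (g' \<cdot> f')" by (rule shift_Comp[OF f' g']) (use f g in \<open>auto simp: Hom_iff\<close>)
  moreover have "g \<cdot> f \<in> Hom E (ob x) (ob z)" using f g by (auto simp: Hom_iff)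
  ultimately have "on_arr S (cls x z (g \<cdot> f)) = cls (on_obj S x) (on_obj S z) (g' \<cdot> f')"
    using S_cls f g by blast
  moreover have "on_arr S \<phi> = cls (on_obj S x) (on_obj S y) f'" "on_arr S \<psi> = cls (on_obj S y) (on_obj S z) g'"
    using S_cls f g f' g' by auto
  ultimately show "on_arr S (\<psi> \<cdot>\<^bsub>T\<^esub> \<phi>) = on_arr S \<psi> \<cdot>\<^bsub>T\<^esub> on_arr S \<phi>"
    using f g f' g' by (auto simp: shift_def Hom_iff)
qed

lemma is_additive_functor_S: "is_additive_functor T T S"
  unfolding is_additive_functor_def
proof (intro conjI is_functor_S ballI)
  fix x y \<phi> \<psi> assume a: "x \<in> Obj T" "y \<in> Obj T" "\<phi> \<in> Hom T x y" "\<psi> \<in> Hom T x y"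
  then have o: "x \<in> Obj H" "y \<in> Obj H" by auto
  obtain f where f: "f \<in> Hom E (ob x) (ob y)" "\<phi> = cls x y f" using cls_surj[OF a(3)[unfolded T_simps]] by blast
  obtain g where g: "g \<in> Hom E (ob x) (ob y)" "\<psi> = cls x y g" using cls_surj[OF a(4)[unfolded T_simps]] by blast
  obtain f' where f': "shift f f'" using shift_ex[OF f(1)] .
  obtain g' where g': "shift g g'" using shift_ex[OF g(1)] .
  have "shift (f \<oplus> g) (f' \<oplus> g')" by (rule shift_Add[OF f' g']) (use f g in \<open>auto simp: Hom_iff\<close>)
  moreover have "f \<oplus> g \<in> Hom E (ob x) (ob y)" using f g by (auto simp: Hom_iff)
  ultimately have "on_arr S (cls x y (f \<oplus> g)) = cls (on_obj S x) (on_obj S y) (f' \<oplus> g')"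
    using S_cls o by blast
  moreover have "on_arr S \<phi> = cls (on_obj S x) (on_obj S y) f'" "on_arr S \<psi> = cls (on_obj S x) (on_obj S y) g'"
    using S_cls o f g f' g' by auto
  ultimately show "on_arr S (\<phi> \<oplus>\<^bsub>T\<^esub> \<psi>) = on_arr S \<phi> \<oplus>\<^bsub>T\<^esub> on_arr S \<psi>"
    using o f g f' g' by (auto simp: shift_def Hom_iff)
qed

definition Std :: "'n triangle set" where
  "Std = {(cls x y u, cls y (sec c) v, cls (sec c) (on_obj S x) w) | x y u c v w.
    x \<in> Obj H \<and> y \<in> Obj H \<and> u \<in> Hom E (ob x) (ob y) \<and> (\<exists>m. cone u c v w m)}"

lemma StdI:
  "\<lbrakk>x \<in> Obj H; y \<in> Obj H; u \<in> Hom E (ob x) (ob y); cone u c v w m\<rbrakk>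
    \<Longrightarrow> (cls x y u, cls y (sec c) v, cls (sec c) (on_obj S x) w) \<in> Std"
  unfolding Std_def by blast

lemma StdE:
  assumes "(f, g, h) \<in> Std"
  obtains x y u c v w m where "x \<in> Obj H" "y \<in> Obj H" "u \<in> Hom E (ob x) (ob y)" "cone u c v w m"
    "f = cls x y u" "g = cls y (sec c) v" "h = cls (sec c) (on_obj S x) w"
    "Dom H f = x" "Cod H f = y" "Dom H g = y" "Cod H g = sec c" "Dom H h = sec c" "Cod H h = on_obj S x"
proof -
  obtain x y u c v w m where a: "x \<in> Obj H" "y \<in> Obj H" "u \<in> Hom E (ob x) (ob y)" "cone u c v w m"
    "f = cls x y u" "g = cls y (sec c) v" "h = cls (sec c) (on_obj S x) w"
    using assms unfolding Std_def by blast
  note d = coneD(1-3,7)[OF a(4,3), unfolded Hom_iff]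
  show ?thesis by (rule that[OF a]) (use a(1-3,5-7) d in \<open>auto simp: Hom_iff\<close>)
qed

lemma cone_cls:
  assumes "x \<in> Obj H" "y \<in> Obj H" "u \<in> Hom E (ob x) (ob y)" "cone u c v w m"
  shows "v \<in> Hom E (ob y) (ob (sec c))" "w \<in> Hom E (ob (sec c)) (ob (on_obj S x))" "sec c \<in> Obj H" "c \<in> Obj E"
  using coneD(1-3,7)[OF assms(4,3)] assms(1) by auto

lemma is_triangle_Std: "t \<in> Std \<Longrightarrow> is_triangle T S t"
proof -
  assume "t \<in> Std"
  then obtain f g h where t: "t = (f, g, h)" "(f, g, h) \<in> Std" by (cases t) auto
  obtain x y u c v w m where a: "x \<in> Obj H" "y \<in> Obj H" "u \<in> Hom E (ob x) (ob y)" "cone u c v w m"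
    "f = cls x y u" "g = cls y (sec c) v" "h = cls (sec c) (on_obj S x) w"
    using StdE[OF t(2)] by metis
  show ?thesis unfolding t(1) a(5-7)
    using a(1-3) cone_cls[OF a(1-4)] by (auto simp: is_triangle_def Hom_iff)
qed

lemma Std_ex:
  assumes "\<phi> \<in> Arr H"
  shows "\<exists>g h. (\<phi>, g, h) \<in> Std"
proof -
  have "\<phi> \<in> Hom H (Dom H \<phi>) (Cod H \<phi>)" using assms by (simp add: Hom_iff)
  from cls_cases[OF this] obtain f where f: "Dom H \<phi> \<in> Obj H" "Cod H \<phi> \<in> Obj H"
    "f \<in> Hom E (ob (Dom H \<phi>)) (ob (Cod H \<phi>))" "\<phi> = cls (Dom H \<phi>) (Cod H \<phi>) f" .
  obtain c v w m where "cone f c v w m" using cone_ex[of f] f(3) unfolding Hom_iff by metis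
  from StdI[OF f(1-3) this] show ?thesis using f(4) by auto
qed

text \<open>A pushout along an identity changes nothing, so the hull of \<open>x\<close> is a cone
  of the identity of \<open>x\<close>. It is injective and therefore a zero object among stable
  classes.\<close>

lemma cone_Idt:
  assumes "x \<in> Obj E"
  shows "cone (Idt E x) (inj_obj x) (inc x) (prj x) (Idt E (inj_obj x))"
proof -
  have "\<exists>!t. t \<in> Hom E (inj_obj x) z \<and> t \<cdot> inc x = a \<and> t \<cdot> Idt E (inj_obj x) = b"
    if ab: "a \<in> Hom E x z" "b \<in> Hom E (inj_obj x) z" "b \<cdot> inc x = a \<cdot> Idt E x" for z a b
  proof (rule ex1I[of _ b])
    show "b \<in> Hom E (inj_obj x) z \<and> b \<cdot> inc x = a \<and> b \<cdot> Idt E (inj_obj x) = b"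
      using ab by (simp add: Hom_iff)
    show "t = b" if "t \<in> Hom E (inj_obj x) z \<and> t \<cdot> inc x = a \<and> t \<cdot> Idt E (inj_obj x) = b" for t
      using that Comp_Idt(1) unfolding Hom_iff by metis
  qed
  note ump = this
  show ?thesis
    unfolding cone_def Idt_simps(2,3)[OF assms]
  proof (intro conjI allI ballI impI)
    fix z a b assume "a \<in> Hom E x z" "b \<in> Hom E (inj_obj x) z" "b \<cdot> inc x = a \<cdot> Idt E x"
    then show "\<exists>!t. t \<in> Hom E (inj_obj x) z \<and> t \<cdot> inc x = a \<and> t \<cdot> Idt E (inj_obj x) = b" by (rule ump)
  qed (use assms in \<open>simp_all add: Hom_iff\<close>)
qed

lemma inj_obj_steq_Zero: "x \<in> Obj E \<Longrightarrow> Idt E (inj_obj x) \<approx> Zero E (inj_obj x) (inj_obj x)"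
  by (rule steqI[of _ "inj_obj x" "inj_obj x" "Idt E (inj_obj x)" "inj_obj x" "Idt E (inj_obj x)"])
    (auto simp: Hom_iff)

lemma Std_Idt:
  assumes "x \<in> Obj H"
  shows "\<exists>g h. (Idt H x, g, h) \<in> Std \<and> zero_object T (Cod H g)"
proof -
  have "(cls x x (Idt E (ob x)), cls x (sec (inj_obj (ob x))) (inc (ob x)),
      cls (sec (inj_obj (ob x))) (on_obj S x) (prj (ob x))) \<in> Std"
    by (rule StdI[OF assms assms _ cone_Idt]) (use assms in \<open>auto simp: Hom_iff\<close>)
  moreover have "zero_object T (sec (inj_obj (ob x)))"
    by (rule zero_object_T) (use assms inj_obj_steq_Zero in auto)
  moreover have "Cod H (cls x (sec (inj_obj (ob x))) (inc (ob x))) = sec (inj_obj (ob x))"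
    using assms by simp
  ultimately show ?thesis using assms cls_Idt by metis
qed

text \<open>Commutativity of classes is only stable commutativity of representatives, which is
  precisely the hypothesis of \<open>cone_morphism\<close>.\<close>

lemma Std_morphism:
  assumes "(f, g, h) \<in> Std" "(f', g', h') \<in> Std"
    "\<alpha> \<in> Hom H (Dom H f) (Dom H f')" "\<beta> \<in> Hom H (Cod H f) (Cod H f')" "\<beta> \<cdot>\<^bsub>H\<^esub> f = f' \<cdot>\<^bsub>H\<^esub> \<alpha>"
  shows "\<exists>\<gamma>. triangle_morphism T S (f, g, h) (f', g', h') \<alpha> \<beta> \<gamma>"
proof -
  obtain x y u c v w m where 1: "x \<in> Obj H" "y \<in> Obj H" "u \<in> Hom E (ob x) (ob y)" "cone u c v w m"
    "f = cls x y u" "g = cls y (sec c) v" "h = cls (sec c) (on_obj S x) w"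
    "Dom H f = x" "Cod H f = y" "Dom H g = y" "Cod H g = sec c" "Dom H h = sec c" "Cod H h = on_obj S x"
    using StdE[OF assms(1)] .
  obtain x' y' u' c' v' w' m' where 2: "x' \<in> Obj H" "y' \<in> Obj H" "u' \<in> Hom E (ob x') (ob y')" "cone u' c' v' w' m'"
    "f' = cls x' y' u'" "g' = cls y' (sec c') v'" "h' = cls (sec c') (on_obj S x') w'"
    "Dom H f' = x'" "Cod H f' = y'" "Dom H g' = y'" "Cod H g' = sec c'" "Dom H h' = sec c'" "Cod H h' = on_obj S x'"
    using StdE[OF assms(2)] .
  obtain a where a: "a \<in> Hom E (ob x) (ob x')" "\<alpha> = cls x x' a" using cls_surj[OF assms(3)] 1(8) 2(8) by auto
  obtain b where b: "b \<in> Hom E (ob y) (ob y')" "\<beta> = cls y y' b" using cls_surj[OF assms(4)] 1(9) 2(9) by auto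
  have bu: "b \<cdot> u \<in> Hom E (ob x) (ob y')" "u' \<cdot> a \<in> Hom E (ob x) (ob y')"
    using a b 1(3) 2(3) by (auto simp: Hom_iff)
  have "cls x y' (b \<cdot> u) = cls x y' (u' \<cdot> a)"
    using assms(5) cls_Comp[OF 1(1,2) 2(2) 1(3) b(1)] cls_Comp[OF 1(1) 2(1,2) a(1) 2(3)]
    unfolding 1(5) 2(5) a(2) b(2) by simp
  then have "b \<cdot> u \<approx> u' \<cdot> a" using cls_eq_iff[OF 1(1) 2(2) bu] by simp
  moreover obtain a' where a': "shift a a'" using shift_ex[OF a(1)] .
  ultimately obtain t where t: "t \<in> Hom E c c'" "t \<cdot> v = v' \<cdot> b" "w' \<cdot> t = a' \<cdot> w"
    using cone_morphism[OF 1(4,3) 2(4,3) a(1) b(1)] by blast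
  have Sa: "on_arr S \<alpha> = cls (on_obj S x) (on_obj S x') a'"
    unfolding a(2) using S_cls[OF 1(1) 2(1) a(1) a'] .
  have a'ty: "a' \<in> Hom E (susp (ob x)) (susp (ob x'))" using a' a(1) by (auto simp: shift_def Hom_iff)
  note ty = cone_cls[OF 1(1-4), unfolded Hom_iff] cone_cls[OF 2(1-4), unfolded Hom_iff]
    t(1)[unfolded Hom_iff] a'ty[unfolded Hom_iff] a(1)[unfolded Hom_iff] b(1)[unfolded Hom_iff]
  have "cls (sec c) (sec c') t \<in> Hom H (sec c) (sec c')" using ty by (auto simp: Hom_iff)
  moreover have "cls (sec c) (sec c') t \<cdot>\<^bsub>H\<^esub> g = g' \<cdot>\<^bsub>H\<^esub> \<beta>"
    unfolding 1(6) 2(6) b(2) using ty 1(2) 2(2) t(2) by simp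
  moreover have "on_arr S \<alpha> \<cdot>\<^bsub>H\<^esub> h = h' \<cdot>\<^bsub>H\<^esub> cls (sec c) (sec c') t"
    unfolding 1(7) 2(7) Sa using ty 1(1) 2(1) t(3) by simp
  ultimately have "triangle_morphism T S (f, g, h) (f', g', h') \<alpha> \<beta> (cls (sec c) (sec c') t)"
    unfolding triangle_morphism_def using assms(3-5) 1(8-) 2(8-) by simp
  then show ?thesis ..
qed

lemma Std_weak_cokernel:
  assumes "(f, g, h) \<in> Std" "\<kappa> \<in> Hom H (Cod H g) z" "\<kappa> \<cdot>\<^bsub>H\<^esub> g = Zero T (Dom H g) z"
  shows "\<exists>l \<in> Hom H (Cod H h) z. \<kappa> = l \<cdot>\<^bsub>H\<^esub> h"
proof -
  obtain x y u c v w m where 1: "x \<in> Obj H" "y \<in> Obj H" "u \<in> Hom E (ob x) (ob y)" "cone u c v w m"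
    "f = cls x y u" "g = cls y (sec c) v" "h = cls (sec c) (on_obj S x) w"
    "Dom H f = x" "Cod H f = y" "Dom H g = y" "Cod H g = sec c" "Dom H h = sec c" "Cod H h = on_obj S x"
    using StdE[OF assms(1)] .
  have z: "z \<in> Obj H" using H.Hom_Obj[OF assms(2)] by simp
  note ty = cone_cls[OF 1(1-4)]
  obtain k where k: "k \<in> Hom E (ob (sec c)) (ob z)" "\<kappa> = cls (sec c) z k"
    using cls_surj[OF assms(2)] 1(11) by auto
  have "cls y z (k \<cdot> v) = cls y z (Zero E (ob y) (ob z))"
    using assms(3) cls_Comp[OF 1(2) ty(3) z ty(1) k(1)] 1(10) unfolding 1(6) k(2) by simp
  then have "k \<cdot> v \<approx> Zero E (ob y) (ob z)"
    by (subst (asm) cls_eq_iff) (use 1(2) z k(1) ty(1) in \<open>auto simp: Hom_iff\<close>)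
  moreover have "k \<in> Hom E c (ob z)" using k(1) ty(4) by simp
  ultimately obtain l where l: "l \<in> Hom E (susp (ob x)) (ob z)" "k \<approx> l \<cdot> w"
    using cone_weak_cokernel[OF 1(4,3)] by blast
  have "cls (sec c) z k = cls (sec c) z (l \<cdot> w)"
    by (rule cls_eqI[OF ty(3) z l(2)]) (use k(1) in \<open>auto simp: Hom_iff\<close>)
  then have "\<kappa> = cls (on_obj S x) z l \<cdot>\<^bsub>H\<^esub> h"
    unfolding k(2) 1(7) using l(1) ty 1(1) z by (simp add: Hom_iff)
  moreover have "cls (on_obj S x) z l \<in> Hom H (Cod H h) z" using l(1) 1(1,13) z by (auto simp: Hom_iff)
  ultimately show ?thesis by blast
qed

lemma Std_rotate:
  assumes "(f, g, h) \<in> Std"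
  shows "\<exists>g' h' \<rho>. (g, g', h') \<in> Std \<and> \<rho> \<in> Hom H (Cod H g') (Cod H h) \<and> is_iso T \<rho> \<and>
    \<rho> \<cdot>\<^bsub>H\<^esub> g' = h \<and> Neg T (on_arr S f) \<cdot>\<^bsub>H\<^esub> \<rho> = h'"
proof -
  obtain x y u c v w m where 1: "x \<in> Obj H" "y \<in> Obj H" "u \<in> Hom E (ob x) (ob y)" "cone u c v w m"
    "f = cls x y u" "g = cls y (sec c) v" "h = cls (sec c) (on_obj S x) w"
    "Dom H f = x" "Cod H f = y" "Dom H g = y" "Cod H g = sec c" "Dom H h = sec c" "Cod H h = on_obj S x"
    using StdE[OF assms(1)] .
  note ty = cone_cls[OF 1(1-4)]
  have "v \<in> Arr E" using ty(1) by (simp add: Hom_iff)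
  then obtain d v' w' m' where D: "cone v d v' w' m'" using cone_ex[of v] by metis
  note ty' = cone_cls[OF 1(2) ty(3,1) D]
  obtain u' where u': "shift u u'" using shift_ex[OF 1(3)] .
  obtain r s where r: "r \<in> Hom E d (susp (ob x))" "stable_inverse r s" "r \<cdot> v' = w" "Neg E u' \<cdot> r \<approx> w'"
    using cone_rotate[OF 1(4,3) D u'] .
  have u'ty: "u' \<in> Hom E (susp (ob x)) (susp (ob y))" using u' 1(3) by (auto simp: shift_def Hom_iff)
  have Sf: "Neg T (on_arr S f) = cls (on_obj S x) (on_obj S y) (Neg E u')"
    unfolding 1(5) S_cls[OF 1(1-3) u'] by (rule Neg_cls) (use u'ty 1(1,2) in auto)
  note ty'' = ty[unfolded Hom_iff] ty'[unfolded Hom_iff] r(1)[unfolded Hom_iff] u'ty[unfolded Hom_iff]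
  let ?\<rho> = "cls (sec d) (on_obj S x) r"
  have "(g, cls (sec c) (sec d) v', cls (sec d) (on_obj S y) w') \<in> Std"
    unfolding 1(6) by (rule StdI[OF 1(2) ty(3,1) D])
  moreover have "?\<rho> \<in> Hom H (Cod H (cls (sec c) (sec d) v')) (Cod H h)"
    unfolding 1(13) using ty'' 1(1) by (auto simp: Hom_iff)
  moreover have "is_iso T ?\<rho>" by (rule is_iso_cls[OF _ _ _ r(2)]) (use ty'' 1(1) in \<open>auto simp: Hom_iff\<close>)
  moreover have "?\<rho> \<cdot>\<^bsub>H\<^esub> cls (sec c) (sec d) v' = h" unfolding 1(7) using ty'' 1(1) r(3) by simp
  \<comment> \<open>\<open>cone_rotate\<close> relates these two maps only up to \<approx>; passing
    to classes turns this into an equality.\<close>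
  moreover have "cls (sec d) (on_obj S y) (Neg E u' \<cdot> r) = cls (sec d) (on_obj S y) w'"
    by (rule cls_eqI[OF _ _ r(4)]) (use ty'' 1(2) in auto)
  then have "Neg T (on_arr S f) \<cdot>\<^bsub>H\<^esub> ?\<rho> = cls (sec d) (on_obj S y) w'"
    unfolding Sf using ty'' 1(1,2) by simp
  ultimately show ?thesis by blast
qed

lemma Std_octahedron:
  assumes "\<upsilon> \<in> Arr H" "\<nu> \<in> Arr H" "Cod H \<upsilon> = Dom H \<nu>"
  shows "\<exists>i i' j j' k k' f g q t r. (\<upsilon>, i, i') \<in> Std \<and> (\<nu>, j, j') \<in> Std \<and> (\<nu> \<cdot>\<^bsub>H\<^esub> \<upsilon>, k, k') \<in> Std \<and>
        (f, q, t) \<in> Std \<and> triangle_morphism T S (\<upsilon>, i, i') (\<nu> \<cdot>\<^bsub>H\<^esub> \<upsilon>, k, k') (Idt H (Dom H \<upsilon>)) \<nu> f \<and>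
        triangle_morphism T S (\<nu> \<cdot>\<^bsub>H\<^esub> \<upsilon>, k, k') (\<nu>, j, j') \<upsilon> (Idt H (Cod H \<nu>)) g \<and>
        r \<in> Hom H (Cod H j) (Cod H q) \<and> is_iso T r \<and> r \<cdot>\<^bsub>H\<^esub> g = q \<and> t \<cdot>\<^bsub>H\<^esub> r = on_arr S i \<cdot>\<^bsub>H\<^esub> j'"
proof -
  define x y z where "x = Dom H \<upsilon>" and "y = Cod H \<upsilon>" and "z = Cod H \<nu>"
  have "\<upsilon> \<in> Hom H x y" "\<nu> \<in> Hom H y z" using assms by (auto simp: Hom_iff x_def y_def z_def)
  then obtain u v where u: "x \<in> Obj H" "y \<in> Obj H" "u \<in> Hom E (ob x) (ob y)" "\<upsilon> = cls x y u"
    and v: "z \<in> Obj H" "v \<in> Hom E (ob y) (ob z)" "\<nu> = cls y z v"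
    using cls_cases by metis
  have vu: "v \<cdot> u \<in> Hom E (ob x) (ob z)" "\<nu> \<cdot>\<^bsub>H\<^esub> \<upsilon> = cls x z (v \<cdot> u)"
    using u v by (auto simp: Hom_iff)
  have "u \<in> Arr E" "v \<in> Arr E" "v \<cdot> u \<in> Arr E" using u v vu by (auto simp: Hom_iff)
  then obtain cu i i' mu cv j j' mv cw k k' mw where
    C: "cone u cu i i' mu" "cone v cv j j' mv" "cone (v \<cdot> u) cw k k' mw"
    using cone_ex by metis
  note tu = cone_cls[OF u(1-3) C(1)] and tv = cone_cls[OF u(2) v(1,2) C(2)] and tw = cone_cls[OF u(1) v(1) vu(1) C(3)]
  obtain u' where u': "shift u u'" using shift_ex[OF u(3)] .
  obtain s where s: "shift i s" using shift_ex[OF tu(1)] .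
  obtain f g d q t m \<theta> \<phi> where o: "f \<in> Hom E cu cw" "f \<cdot> i = k \<cdot> v" "k' \<cdot> f = i'"
    "g \<in> Hom E cw cv" "g \<cdot> k = j" "j' \<cdot> g = u' \<cdot> k'"
    "cone f d q t m" "\<theta> \<in> Hom E cv d" "stable_inverse \<theta> \<phi>" "\<theta> \<cdot> g \<approx> q" "t \<cdot> \<theta> = s \<cdot> j'"
    using cone_octahedron[OF C(1) u(3) C(2) v(2) C(3) u' s] .
  have fty: "f \<in> Hom E (ob (sec cu)) (ob (sec cw))" using o(1) tu tw by simp
  note td = cone_cls[OF tu(3) tw(3) fty o(7)]
  have sh: "u' \<in> Hom E (susp (ob x)) (susp (ob y))" "s \<in> Hom E (susp (ob y)) (susp cu)"
    using u' s u(3) tu by (auto simp: shift_def Hom_iff)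
  note ty = tu[unfolded Hom_iff] tv[unfolded Hom_iff] tw[unfolded Hom_iff] td[unfolded Hom_iff]
    o(1,4,8)[unfolded Hom_iff] sh[unfolded Hom_iff] u(3)[unfolded Hom_iff] v(2)[unfolded Hom_iff] u(1,2) v(1)
  have Su: "on_arr S \<upsilon> = cls (on_obj S x) (on_obj S y) u'" unfolding u(4) by (rule S_cls[OF u(1-3) u'])
  have Si: "on_arr S (cls y (sec cu) i) = cls (on_obj S y) (on_obj S (sec cu)) s"
    by (rule S_cls[OF u(2) tu(3,1) s])
  have SI: "on_arr S (Idt H x) = Idt H (on_obj S x)" using is_functorD(2)[OF is_functor_S, of x] u(1) by simp
  have Id: "Idt H x \<in> Arr H" "Dom H (Idt H x) = x" "Cod H (Idt H x) = x" "Idt H z \<in> Arr H"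
    "Dom H (Idt H z) = z" "Cod H (Idt H z) = z" using u v by auto
  let ?i = "cls y (sec cu) i" and ?i' = "cls (sec cu) (on_obj S x) i'"
  let ?j = "cls z (sec cv) j" and ?j' = "cls (sec cv) (on_obj S y) j'"
  let ?k = "cls z (sec cw) k" and ?k' = "cls (sec cw) (on_obj S x) k'"
  let ?f = "cls (sec cu) (sec cw) f" and ?g = "cls (sec cw) (sec cv) g" and ?r = "cls (sec cv) (sec d) \<theta>"
  let ?q = "cls (sec cw) (sec d) q" and ?t = "cls (sec d) (on_obj S (sec cu)) t"
  have 1: "(\<upsilon>, ?i, ?i') \<in> Std" "(\<nu>, ?j, ?j') \<in> Std" "(\<nu> \<cdot>\<^bsub>H\<^esub> \<upsilon>, ?k, ?k') \<in> Std" "(?f, ?q, ?t) \<in> Std"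
    unfolding u(4) v(3) vu(2)[unfolded u(4) v(3)] using StdI[OF u(1-3) C(1)] StdI[OF u(2) v(1,2) C(2)]
      StdI[OF u(1) v(1) vu(1) C(3)] StdI[OF tu(3) tw(3) fty o(7)] by auto
  have 2: "triangle_morphism T S (\<upsilon>, ?i, ?i') (\<nu> \<cdot>\<^bsub>H\<^esub> \<upsilon>, ?k, ?k') (Idt H x) \<nu> ?f"
    unfolding triangle_morphism_def vu(2) using ty Id o(2,3) by (simp add: SI Hom_iff u(4) v(3))
  have 3: "triangle_morphism T S (\<nu> \<cdot>\<^bsub>H\<^esub> \<upsilon>, ?k, ?k') (\<nu>, ?j, ?j') \<upsilon> (Idt H z) ?g"
    unfolding triangle_morphism_def vu(2) Su[unfolded u(4)] u(4) using ty Id o(5,6)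
    by (simp add: Su[unfolded u(4)] Hom_iff v(3))
  have 4: "?r \<in> Hom H (Cod H ?j) (Cod H ?q)" using ty by (simp add: Hom_iff)
  have 5: "is_iso T ?r" by (rule is_iso_cls[OF _ _ _ o(9)]) (use ty in \<open>auto simp: Hom_iff\<close>)
  have "cls (sec cw) (sec d) (\<theta> \<cdot> g) = ?q" by (rule cls_eqI[OF _ _ o(10)]) (use ty in auto)
  then have 6: "?r \<cdot>\<^bsub>H\<^esub> ?g = ?q" using ty by simp
  have 7: "?t \<cdot>\<^bsub>H\<^esub> ?r = on_arr S ?i \<cdot>\<^bsub>H\<^esub> ?j'" unfolding Si using ty o(11) by simp
  show ?thesis unfolding x_def[symmetric] z_def[symmetric] using 1 2 3 4 5 6 7 by blast
qed

lemma S_faithful: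
  assumes "\<phi> \<in> Hom H x y" "\<psi> \<in> Hom H x y" "on_arr S \<phi> = on_arr S \<psi>"
  shows "\<phi> = \<psi>"
proof -
  obtain f where f: "x \<in> Obj H" "y \<in> Obj H" "f \<in> Hom E (ob x) (ob y)" "\<phi> = cls x y f"
    using cls_cases[OF assms(1)] .
  obtain g where g: "g \<in> Hom E (ob x) (ob y)" "\<psi> = cls x y g" using cls_surj[OF assms(2)] by blast
  obtain f' where f': "shift f f'" using shift_ex[OF f(3)] .
  obtain g' where g': "shift g g'" using shift_ex[OF g(1)] .
  have "cls (on_obj S x) (on_obj S y) f' = cls (on_obj S x) (on_obj S y) g'"
    using assms(3) S_cls[OF f(1-3) f'] S_cls[OF f(1,2) g(1) g'] f(4) g(2) by simp
  then have "f' \<approx> g'"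
    by (subst (asm) cls_eq_iff) (use f g f' g' in \<open>auto simp: shift_def Hom_iff\<close>)
  then have "f \<approx> g" using shift_faithful[OF f' g'] f g by blast
  then show ?thesis unfolding f(4) g(2) by (intro cls_eqI) (use f in \<open>auto simp: Hom_iff\<close>)
qed

lemma S_full:
  assumes "x \<in> Obj H" "y \<in> Obj H" "\<psi> \<in> Hom H (on_obj S x) (on_obj S y)"
  shows "\<exists>\<phi> \<in> Hom H x y. on_arr S \<phi> = \<psi>"
proof -
  obtain g where g: "g \<in> Hom E (ob (on_obj S x)) (ob (on_obj S y))" "\<psi> = cls (on_obj S x) (on_obj S y) g"
    using cls_surj[OF assms(3)] by blast
  then obtain f where f: "f \<in> Hom E (ob x) (ob y)" "shift f g"
    using shift_full[of "ob x" "ob y" g] assms by auto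
  show ?thesis
    by (rule bexI[of _ "cls x y f"]) (use S_cls[OF assms(1,2) f] cls_in_Hom[OF assms(1,2) f(1)] g(2) in auto)
qed

lemma S_dense:
  assumes "z \<in> Obj H"
  shows "\<exists>x \<in> Obj H. \<exists>\<phi> \<in> Hom H (on_obj S x) z. is_iso T \<phi>"
proof -
  obtain c f g where c: "c \<in> Obj E" "f \<in> Hom E (susp c) (ob z)" "stable_inverse f g"
    using susp_surj[of "ob z"] assms by auto
  have x: "sec c \<in> Obj H" "f \<in> Hom E (ob (on_obj S (sec c))) (ob z)" using c by auto
  have "cls (on_obj S (sec c)) z f \<in> Hom H (on_obj S (sec c)) z" "is_iso T (cls (on_obj S (sec c)) z f)"
    using cls_in_Hom[OF _ assms x(2)] is_iso_cls[OF _ assms x(2) c(3)] x(1) by auto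
  then show ?thesis using x(1) by blast
qed

sublocale standard_triangles T S Std
proof (intro standard_triangles.intro standard_triangles_axioms.intro T.additive_category_axioms)
qed (unfold T_simps(1-7), rule is_additive_functor_S, (rule S_full; assumption),
  (rule S_faithful; assumption), (rule S_dense; assumption), (rule is_triangle_Std; assumption),
  (rule Std_ex; assumption), (rule Std_Idt; assumption), (rule Std_morphism; assumption),
  (rule Std_weak_cokernel; assumption), (rule Std_rotate; assumption),
  (rule Std_octahedron; assumption))

lemma is_triangulated_category_H: "is_triangulated_category H"
  unfolding is_triangulated_category_def using truncate_T triangulated by blast

end

section \<open>Localizations and coslice categories\<close>

context category
begin

section \<open>The localization as a category\<close>

lemma zigzag_Obj: "zigzag C W x p y \<Longrightarrow> x \<in> Obj C \<and> y \<in> Obj C"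
proof (induction p arbitrary: x)
  case (Cons s p)
  then obtain z where z: "step_in C W x s z" "zigzag C W z p y" by auto
  have "x \<in> Obj C" using z(1) by (cases s) (auto dest: Hom_Obj)
  then show ?case using Cons.IH[OF z(2)] by simp
qed simp

lemma zigzag_append: "zigzag C W x (p @ q) z \<longleftrightarrow> (\<exists>y. zigzag C W x p y \<and> zigzag C W y q z)"
  by (induction p arbitrary: x) (use zigzag_Obj in auto)

lemma zigzag_equiv_zigzag: "zigzag_equiv C W x p q y \<Longrightarrow> zigzag C W x p y \<and> zigzag C W x q y"
proof (induction rule: zigzag_equiv.induct)
  case (zz_append x p q y p' q' z)
  then show ?case by (auto simp: zigzag_append)
next
  case (zz_Comp f x y g z)
  then show ?case using Comp_in_Hom by (auto dest: Hom_Obj)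
qed (auto dest: Hom_Obj Idt_in_Hom)

lemma zigzag_class_eq_iff:
  assumes "zigzag C W x p y"
  shows "zigzag_class C W x p y = zigzag_class C W x q y \<longleftrightarrow> zigzag_equiv C W x p q y"
proof
  assume "zigzag_class C W x p y = zigzag_class C W x q y"
  then have "{r. zigzag_equiv C W x p r y} = {r. zigzag_equiv C W x q r y}" by (simp add: zigzag_class_def)
  then have "zigzag_equiv C W x q p y" using zz_refl[OF assms] by blast
  then show "zigzag_equiv C W x p q y" by (rule zz_sym)
next
  assume e: "zigzag_equiv C W x p q y"
  have "zigzag_equiv C W x p r y \<longleftrightarrow> zigzag_equiv C W x q r y" for r
    using zz_trans[OF e] zz_trans[OF zz_sym[OF e]] by blast
  then show "zigzag_class C W x p y = zigzag_class C W x q y" by (simp add: zigzag_class_def)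
qed

lemma localization_simps:
  "Obj (localization C W) = Obj C"
  "Idt (localization C W) x = zigzag_class C W x [] x"
  "\<phi> \<in> Hom (localization C W) x y \<longleftrightarrow> (\<exists>p. zigzag C W x p y \<and> \<phi> = zigzag_class C W x p y)"
  by (auto simp: localization_def Hom_iff zigzag_class_def)

lemma localization_Comp:
  assumes "zigzag C W x p y" "zigzag C W y q z"
  shows "zigzag_class C W y q z \<cdot>\<^bsub>localization C W\<^esub> zigzag_class C W x p y = zigzag_class C W x (p @ q) z"
proof -
  have "(\<exists>p' q'. zigzag_equiv C W x p p' y \<and> zigzag_equiv C W y q q' z \<and> zigzag_equiv C W x (p' @ q') r z)
      \<longleftrightarrow> zigzag_equiv C W x (p @ q) r z" for r
  proof
    assume "\<exists>p' q'. zigzag_equiv C W x p p' y \<and> zigzag_equiv C W y q q' z \<and> zigzag_equiv C W x (p' @ q') r z"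
    then obtain p' q' where "zigzag_equiv C W x p p' y" "zigzag_equiv C W y q q' z"
      "zigzag_equiv C W x (p' @ q') r z" by blast
    from zz_trans[OF zz_append[OF this(1,2)] this(3)] show "zigzag_equiv C W x (p @ q) r z" .
  next
    assume "zigzag_equiv C W x (p @ q) r z"
    then show "\<exists>p' q'. zigzag_equiv C W x p p' y \<and> zigzag_equiv C W y q q' z \<and> zigzag_equiv C W x (p' @ q') r z"
      by (intro exI[of _ p] exI[of _ q] conjI zz_refl[OF assms(1)] zz_refl[OF assms(2)])
  qed
  then show ?thesis by (auto simp: localization_def zigzag_class_def)
qed

lemma category_localization: "category (localization C W)"
proof
  let ?L = "localization C W"
  fix f x y assume f: "f \<in> Hom (?L) x y"
  then obtain p where p: "zigzag C W x p y" "f = zigzag_class C W x p y" by (auto simp: localization_simps)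
  note o = zigzag_Obj[OF p(1)]
  show "f \<cdot>\<^bsub>?L\<^esub> Idt (?L) x = f"
    unfolding p(2) localization_simps using localization_Comp[of W x "[]" x p y] p o by simp
  show "Idt (?L) y \<cdot>\<^bsub>?L\<^esub> f = f"
    unfolding p(2) localization_simps using localization_Comp[of W x p y "[]" y] p o by simp
  fix z g assume g: "g \<in> Hom (?L) y z"
  then obtain q where q: "zigzag C W y q z" "g = zigzag_class C W y q z" by (auto simp: localization_simps)
  have pq: "zigzag C W x (p @ q) z" using p q by (auto simp: zigzag_append)
  then show "g \<cdot>\<^bsub>?L\<^esub> f \<in> Hom (?L) x z"
    unfolding p(2) q(2) localization_Comp[OF p(1) q(1)] localization_simps by blast
  fix w h assume h: "h \<in> Hom (?L) z w"
  then obtain r where r: "zigzag C W z r w" "h = zigzag_class C W z r w" by (auto simp: localization_simps)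
  have qr: "zigzag C W y (q @ r) w" using q r by (auto simp: zigzag_append)
  show "(h \<cdot>\<^bsub>?L\<^esub> g) \<cdot>\<^bsub>?L\<^esub> f =
      h \<cdot>\<^bsub>?L\<^esub> (g \<cdot>\<^bsub>?L\<^esub> f)"
    unfolding p(2) q(2) r(2) localization_Comp[OF p(1) q(1)] localization_Comp[OF q(1) r(1)]
      localization_Comp[OF p(1) qr] localization_Comp[OF pq r(1)] by simp
next
  let ?L = "localization C W"
  fix x assume "x \<in> Obj (?L)"
  then show "Idt (?L) x \<in> Hom (?L) x x"
    unfolding localization_simps by (intro exI[of _ "[]"]) simp
next
  let ?L = "localization C W"
  fix f assume "f \<in> Arr (?L)"
  then have "f \<in> Hom (?L) (Dom (?L) f) (Cod (?L) f)"
    by (simp add: Hom_iff)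
  then obtain p where "zigzag C W (Dom (?L) f) p (Cod (?L) f)"
    by (auto simp: localization_simps)
  then show "Dom (?L) f \<in> Obj (?L)" "Cod (?L) f \<in> Obj (?L)"
    using zigzag_Obj by (auto simp: localization_simps)
qed

section \<open>The coslice category\<close>

lemma coslice_simps:
  "x \<in> Obj (coslice C A) \<longleftrightarrow> x \<in> Arr C \<and> Dom C x = A"
  "\<phi> \<in> Hom (coslice C A) x y \<longleftrightarrow> (\<exists>a. \<phi> = (x, a, y) \<and> x \<in> Arr C \<and> Dom C x = A \<and> y \<in> Arr C \<and>
    a \<in> Hom C (Cod C x) (Cod C y) \<and> y = a \<cdot> x)"
  "Idt (coslice C A) x = (x, Idt C (Cod C x), x)"
  "(y, b, z) \<cdot>\<^bsub>coslice C A\<^esub> (x, a, y') = (x, b \<cdot> a, z)"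
  by (auto simp: coslice_def Hom_iff)

lemma category_coslice: "category (coslice C A)"
proof
  let ?K = "coslice C A"
  show "Dom (?K) f \<in> Obj (?K)" "Cod (?K) f \<in> Obj (?K)"
    if "f \<in> Arr (?K)" for f using that by (auto simp: coslice_def)
  show "Idt (?K) x \<in> Hom (?K) x x" if "x \<in> Obj (?K)" for x
    using that unfolding coslice_simps by (intro exI[of _ "Idt C (Cod C x)"]) (simp add: Hom_iff)
next
  let ?K = "coslice C A"
  fix f x y assume f: "f \<in> Hom (?K) x y"
  obtain a where a: "f = (x, a, y)" "x \<in> Arr C" "Dom C x = A" "y \<in> Arr C" "Dom C y = A"
    "a \<in> Arr C" "Dom C a = Cod C x" "Cod C a = Cod C y" "y = a \<cdot> x"
  proof -
    obtain a where "f = (x, a, y)" "x \<in> Arr C" "Dom C x = A" "y \<in> Arr C"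
      "a \<in> Arr C" "Dom C a = Cod C x" "Cod C a = Cod C y" and y: "y = a \<cdot> x"
      using f unfolding coslice_simps unfolding Hom_iff by blast
    moreover then have "Dom C y = A" unfolding y by simp
    ultimately show ?thesis using that by blast
  qed
  show "f \<cdot>\<^bsub>?K\<^esub> Idt (?K) x = f" "Idt (?K) y \<cdot>\<^bsub>?K\<^esub> f = f"
    using a(1-8) by (simp_all add: coslice_simps)
  fix g z assume g: "g \<in> Hom (?K) y z"
  obtain b where b: "g = (y, b, z)" "z \<in> Arr C" "b \<in> Arr C" "Dom C b = Cod C y" "Cod C b = Cod C z" "z = b \<cdot> y"
    using g unfolding coslice_simps unfolding Hom_iff by blast
  have "z = b \<cdot> (a \<cdot> x)" using b(6) a(9) by simp
  then have "z = (b \<cdot> a) \<cdot> x" using a(2,6,7,8) b(3,4) by simp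
  then show "g \<cdot>\<^bsub>?K\<^esub> f \<in> Hom (?K) x z"
    unfolding a(1) b(1) coslice_simps
    by (intro exI[of _ "b \<cdot> a"]) (use a(2-8) b(2-5) in \<open>simp add: Hom_iff\<close>)
  fix h w assume h: "h \<in> Hom (?K) z w"
  obtain c where c: "h = (z, c, w)" "c \<in> Arr C" "Dom C c = Cod C z"
    using h unfolding coslice_simps unfolding Hom_iff by blast
  show "(h \<cdot>\<^bsub>?K\<^esub> g) \<cdot>\<^bsub>?K\<^esub> f = h \<cdot>\<^bsub>?K\<^esub> (g \<cdot>\<^bsub>?K\<^esub> f)"
    unfolding a(1) b(1) c(1) coslice_simps using a(2-8) b(2-5) c by simp
qed

end

context frobenius_category
begin

section \<open>Weak equivalences in terms of representatives\<close>

lemma stable_class_eq: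
  assumes "f \<in> Arr E"
  shows "stable_class E f = {g. g \<approx> f}"
proof (intro Set.set_eqI iffI CollectI)
  fix g assume "g \<in> stable_class E f"
  then obtain v where v: "v \<in> Hom E (inj_obj (Dom E f)) (Cod E f)" "g = f \<oplus> v \<cdot> inc (Dom E f)"
    using assms by (auto simp: stable_class_def null_maps_iff)
  show "g \<approx> f"
    by (rule steqI'[OF v(2) _ _ v(1)]) (use assms in \<open>auto simp: Hom_iff\<close>)
next
  fix g assume "g \<in> {g. g \<approx> f}"
  then have g: "g \<approx> f" by simp
  note d = steqD[OF g]
  obtain v where "v \<in> Hom E (inj_obj (Dom E f)) (Cod E f)" "g = f \<oplus> v \<cdot> inc (Dom E f)"
    using steqE[OF g, of "Dom E f" "Cod E f"] d by auto
  then show "g \<in> stable_class E f"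
    unfolding stable_class_def using null_maps_iff[of "Dom E f"] d by auto
qed

lemma stable_arr_eq_iff:
  assumes "f \<in> Arr E" "g \<in> Arr E"
  shows "stable_arr E f = stable_arr E g \<longleftrightarrow> f \<approx> g"
proof
  assume "stable_arr E f = stable_arr E g"
  then have "stable_class E f = stable_class E g" by (simp add: stable_arr_def)
  then show "f \<approx> g" using assms steq_refl by (auto simp: stable_class_eq)
next
  assume fg: "f \<approx> g"
  then have "{h. h \<approx> f} = {h. h \<approx> g}" using steq_trans steq_sym by blast
  then show "stable_arr E f = stable_arr E g"
    using steqD[OF fg] by (simp add: stable_arr_def stable_class_eq)
qed

lemma stable_Comp:
  assumes "f \<in> Arr E" "g \<in> Arr E" "Dom E g = Cod E f"
  shows "stable_arr E g \<cdot>\<^bsub>stable_category E\<^esub> stable_arr E f = stable_arr E (g \<cdot> f)"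
proof -
  have "stable_class E (g' \<cdot> f') = stable_class E (g \<cdot> f)" if "g' \<approx> g" "f' \<approx> f" for f' g'
  proof -
    have "g' \<cdot> f' \<approx> g \<cdot> f" by (rule steq_Comp[OF that(2,1)]) (use that[THEN steqD] assms in simp)
    then show ?thesis using stable_arr_eq_iff[of "g' \<cdot> f'" "g \<cdot> f"] steqD by (simp add: stable_arr_def)
  qed
  then have "(\<Union>g' \<in> stable_class E g. \<Union>f' \<in> stable_class E f. stable_class E (g' \<cdot> f')) = stable_class E (g \<cdot> f)"
    unfolding stable_class_eq[OF assms(1)] stable_class_eq[OF assms(2)]
    using steq_refl[OF assms(1)] steq_refl[OF assms(2)] by blast
  then show ?thesis using assms by (simp add: stable_category_def stable_arr_def)
qed

text \<open>An inverse in \<open>stable_category\<close> is the class of some morphism of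
  \<open>E\<close>, and the two inverse laws between classes become \<approx> by
  \<open>stable_Comp\<close> and \<open>stable_arr_eq_iff\<close>.\<close>

lemma stable_equivalence_iff: "stable_equivalence E f \<longleftrightarrow> (\<exists>g. stable_inverse f g)"
proof -
  let ?S = "stable_category E"
  have sel: "Dom ?S (stable_arr E h) = Dom E h" "Cod ?S (stable_arr E h) = Cod E h"
    "Arr ?S = stable_arr E ` Arr E" "Idt ?S x = stable_arr E (Idt E x)" for h x
    by (auto simp: stable_category_def stable_arr_def)
  show ?thesis
  proof
    assume "stable_equivalence E f"
    then obtain G where f: "f \<in> Arr E" and G: "G \<in> Hom ?S (Cod E f) (Dom E f)"
      "G \<cdot>\<^bsub>?S\<^esub> stable_arr E f = stable_arr E (Idt E (Dom E f))"
      "stable_arr E f \<cdot>\<^bsub>?S\<^esub> G = stable_arr E (Idt E (Cod E f))"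
      by (auto simp: stable_equivalence_def is_iso_def sel)
    then obtain g where g: "g \<in> Arr E" "G = stable_arr E g" by (auto simp: Hom_iff sel)
    have gty: "Dom E g = Cod E f" "Cod E g = Dom E f" using G(1) by (auto simp: Hom_iff sel g(2))
    have "g \<cdot> f \<approx> Idt E (Dom E f)" "f \<cdot> g \<approx> Idt E (Cod E f)"
      using G(2,3) f g(1) gty by (simp_all add: g(2) stable_Comp stable_arr_eq_iff)
    then show "\<exists>g. stable_inverse f g" using f g gty by (auto simp: stable_inverse_def Hom_iff)
  next
    assume "\<exists>g. stable_inverse f g"
    then obtain g where g: "f \<in> Arr E" "g \<in> Arr E" "Dom E g = Cod E f" "Cod E g = Dom E f"
      "g \<cdot> f \<approx> Idt E (Dom E f)" "f \<cdot> g \<approx> Idt E (Cod E f)"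
      by (auto simp: stable_inverse_def Hom_iff)
    have "stable_arr E g \<in> Hom ?S (Cod E f) (Dom E f)" using g by (auto simp: Hom_iff sel)
    moreover have "stable_arr E g \<cdot>\<^bsub>?S\<^esub> stable_arr E f = stable_arr E (Idt E (Dom E f))"
      "stable_arr E f \<cdot>\<^bsub>?S\<^esub> stable_arr E g = stable_arr E (Idt E (Cod E f))"
      using g by (simp_all add: stable_Comp stable_arr_eq_iff)
    ultimately show "stable_equivalence E f"
      unfolding stable_equivalence_def is_iso_def sel using g(1) by blast
  qed
qed

lemma stable_inverse_unique:
  assumes "stable_inverse f g" "stable_inverse f h"
  shows "g \<approx> h"
proof -
  have ty: "f \<in> Arr E" "g \<in> Arr E" "Dom E g = Cod E f" "Cod E g = Dom E f"
    "h \<in> Arr E" "Dom E h = Cod E f" "Cod E h = Dom E f"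
    and e: "g \<cdot> f \<approx> Idt E (Dom E f)" "f \<cdot> h \<approx> Idt E (Cod E f)"
    using assms by (auto simp: stable_inverse_def Hom_iff)
  have "g \<cdot> (f \<cdot> h) \<approx> g \<cdot> Idt E (Cod E f)" by (rule steq_Comp_left[OF e(2)]) (use ty in auto)
  moreover have "(g \<cdot> f) \<cdot> h \<approx> Idt E (Dom E f) \<cdot> h" by (rule steq_Comp_right[OF e(1)]) (use ty in auto)
  ultimately have "g \<cdot> f \<cdot> h \<approx> g" "g \<cdot> f \<cdot> h \<approx> h" using ty by simp_all
  then show ?thesis using steq_sym steq_trans by blast
qed

end

section \<open>The homotopy category of the coslice category\<close>

locale coslice_frobenius = frobenius_category E
  for E :: "('o, 'm, 'z) exact_data_scheme" (structure) +
  fixes A :: 'o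
  assumes injective_A: "injective E A"
begin

section \<open>Values of zigzags in the stable category\<close>

lemma A_in_Obj [simp]: "A \<in> Obj E" using injective_A by (simp add: injective_def)

abbreviation K :: "('m, 'm \<times> 'm \<times> 'm) category_data" where "K \<equiv> coslice E A"

definition W :: "('m \<times> 'm \<times> 'm) set" where "W = Weq (coslice_model E A (canonical_model E))"

sublocale K: category K by (rule category_coslice)

lemma K_Obj: "x \<in> Obj K \<longleftrightarrow> x \<in> Arr E \<and> Dom E x = A"
  by (rule coslice_simps)

lemma K_HomI:
  "\<lbrakk>x \<in> Obj K; y \<in> Obj K; a \<in> Hom E (Cod E x) (Cod E y); y = a \<cdot> x\<rbrakk> \<Longrightarrow> (x, a, y) \<in> Hom K x y"
  unfolding K_Obj coslice_simps by blast

lemma K_HomE: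
  assumes "\<phi> \<in> Hom K x y"
  obtains a where "\<phi> = (x, a, y)" "x \<in> Obj K" "y \<in> Obj K" "a \<in> Hom E (Cod E x) (Cod E y)" "y = a \<cdot> x"
  using assms K.Hom_Obj[OF assms] unfolding coslice_simps by blast

lemma W_iff: "(x, a, y) \<in> W \<longleftrightarrow> (x, a, y) \<in> Arr K \<and> (\<exists>b. stable_inverse a b)"
  by (simp add: W_def coslice_model_def canonical_model_def stable_equivalence_iff)

text \<open>A formal inverse must be given a value. Any stable inverse will do, since two of them
  are stably equal by \<open>stable_inverse_unique\<close>.\<close>

definition stable_inv :: "'m \<Rightarrow> 'm" where "stable_inv a = (SOME b. stable_inverse a b)"

lemma stable_inv: "\<exists>b. stable_inverse a b \<Longrightarrow> stable_inverse a (stable_inv a)"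
  unfolding stable_inv_def by (rule someI_ex)

primrec step_val :: "('m \<times> 'm \<times> 'm) step \<Rightarrow> 'm" where
  "step_val (Fwd \<phi>) = fst (snd \<phi>)"
| "step_val (Inv \<phi>) = stable_inv (fst (snd \<phi>))"

primrec step_end :: "('m \<times> 'm \<times> 'm) step \<Rightarrow> 'm" where
  "step_end (Fwd \<phi>) = snd (snd \<phi>)"
| "step_end (Inv \<phi>) = fst \<phi>"

text \<open>The value of a zigzag in the stable category, represented by a morphism of \<open>E\<close>.\<close>

fun zz_val :: "'m \<Rightarrow> ('m \<times> 'm \<times> 'm) step list \<Rightarrow> 'm" where
  "zz_val x [] = Idt E (Cod E x)"
| "zz_val x (s # p) = zz_val (step_end s) p \<cdot> step_val s"

lemma step_in_val:
  assumes "step_in K W x s y"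
  shows "step_end s = y" "step_val s \<in> Hom E (Cod E x) (Cod E y)" "x \<in> Obj K" "y \<in> Obj K"
proof -
  have "step_end s = y \<and> step_val s \<in> Hom E (Cod E x) (Cod E y) \<and> x \<in> Obj K \<and> y \<in> Obj K"
  proof (cases s)
    case (Fwd \<phi>)
    then show ?thesis using assms by (auto elim!: K_HomE)
  next
    case (Inv \<phi>)
    then have \<phi>: "\<phi> \<in> W" "\<phi> \<in> Hom K y x" using assms by auto
    obtain a where a: "\<phi> = (y, a, x)" "y \<in> Obj K" "x \<in> Obj K" "a \<in> Hom E (Cod E y) (Cod E x)"
      using K_HomE[OF \<phi>(2)] .
    then have "stable_inverse a (stable_inv a)" using \<phi>(1) stable_inv by (simp add: W_iff)
    then show ?thesis using a Inv by (auto simp: stable_inverse_def Hom_iff)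
  qed
  then show "step_end s = y" "step_val s \<in> Hom E (Cod E x) (Cod E y)" "x \<in> Obj K" "y \<in> Obj K" by auto
qed

lemma zz_val_Hom: "zigzag K W x p y \<Longrightarrow> zz_val x p \<in> Hom E (Cod E x) (Cod E y)"
proof (induction p arbitrary: x)
  case Nil
  then show ?case by (auto simp: K_Obj Hom_iff)
next
  case (Cons s p)
  then obtain z where z: "step_in K W x s z" "zigzag K W z p y" by auto
  then show ?case using step_in_val[OF z(1)] Cons.IH[OF z(2)] by (auto simp: Hom_iff)
qed

lemma zz_val_append:
  "zigzag K W x p y \<Longrightarrow> zigzag K W y q z \<Longrightarrow> zz_val x (p @ q) = zz_val y q \<cdot> zz_val x p"
proof (induction p arbitrary: x)
  case Nil
  then show ?case using zz_val_Hom[of y q z] by (auto simp: Hom_iff)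
next
  case (Cons s p)
  then obtain w where w: "step_in K W x s w" "zigzag K W w p y" by auto
  note IH = Cons.IH[OF w(2) Cons.prems(2)]
  show ?case
    using step_in_val[OF w(1)] IH zz_val_Hom[OF w(2)] zz_val_Hom[OF Cons.prems(2)] by (simp add: Hom_iff)
qed

text \<open>The concrete form of the universal property: the codomain functor to the stable category
  inverts \<open>W\<close>, so it respects each generator of the congruence. The cancellation rules
  are the two halves of \<open>stable_inverse\<close>.\<close>

lemma zz_val_sound: "zigzag_equiv K W x p q y \<Longrightarrow> zz_val x p \<approx> zz_val x q"
proof (induction rule: zigzag_equiv.induct)
  case (zz_refl x p y)
  then show ?case using zz_val_Hom steq_refl by (auto simp: Hom_iff)
next
  case (zz_sym x p q y)
  from zz_sym.IH show ?case by (rule steq_sym)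
next
  case (zz_trans x p q y r)
  from zz_trans.IH show ?case by (rule steq_trans)
next
  case (zz_append x p q y p' q' z)
  note v = K.zigzag_equiv_zigzag[OF zz_append.hyps(1)] K.zigzag_equiv_zigzag[OF zz_append.hyps(2)]
  have "zz_val y p' \<cdot> zz_val x p \<approx> zz_val y q' \<cdot> zz_val x q"
    by (rule steq_Comp[OF zz_append.IH]) (use v zz_val_Hom in \<open>auto simp: Hom_iff\<close>)
  then show ?case using v zz_val_append[of x p y p' z] zz_val_append[of x q y q' z] by simp
next
  case (zz_Idt x)
  then show ?case by (simp add: coslice_simps K_Obj steq_refl)
next
  case (zz_Comp f x y g z)
  obtain a where a: "f = (x, a, y)" "a \<in> Hom E (Cod E x) (Cod E y)" using K_HomE[OF zz_Comp(1)] by metis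
  obtain b where b: "g = (y, b, z)" "b \<in> Hom E (Cod E y) (Cod E z)" using K_HomE[OF zz_Comp(2)] by metis
  show ?case unfolding a(1) b(1) coslice_simps using a(2) b(2) by (auto simp: Hom_iff intro!: steq_refl)
next
  case (zz_Fwd_Inv w x y)
  obtain a where a: "w = (x, a, y)" "a \<in> Hom E (Cod E x) (Cod E y)" using K_HomE[OF zz_Fwd_Inv(2)] by metis
  have "stable_inverse a (stable_inv a)" using zz_Fwd_Inv(1) a(1) stable_inv by (simp add: W_iff)
  then show ?case using a by (auto simp: stable_inverse_def Hom_iff)
next
  case (zz_Inv_Fwd w x y)
  obtain a where a: "w = (x, a, y)" "a \<in> Hom E (Cod E x) (Cod E y)" using K_HomE[OF zz_Inv_Fwd(2)] by metis
  have "stable_inverse a (stable_inv a)" using zz_Inv_Fwd(1) a(1) stable_inv by (simp add: W_iff)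
  then show ?case using a by (auto simp: stable_inverse_def Hom_iff)
qed

abbreviation zz_equiv :: "'m \<Rightarrow> ('m \<times> 'm \<times> 'm) step list \<Rightarrow> ('m \<times> 'm \<times> 'm) step list \<Rightarrow> 'm \<Rightarrow> bool" where
  "zz_equiv \<equiv> zigzag_equiv K W"

section \<open>Biproducts with \<open>A\<close>\<close>

definition biprod :: "'o \<Rightarrow> 'o \<Rightarrow> 'o \<Rightarrow> 'm \<Rightarrow> 'm \<Rightarrow> 'm \<Rightarrow> 'm \<Rightarrow> bool" where
  "biprod x y b i j p q \<longleftrightarrow> i \<in> Hom E x b \<and> j \<in> Hom E y b \<and> p \<in> Hom E b x \<and> q \<in> Hom E b y \<and>
    p \<cdot> i = Idt E x \<and> q \<cdot> j = Idt E y \<and> p \<cdot> j = Zero E y x \<and> q \<cdot> i = Zero E x y \<and>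
    (i \<cdot> p) \<oplus> (j \<cdot> q) = Idt E b"

lemma biprod_ex: "x \<in> Obj E \<Longrightarrow> y \<in> Obj E \<Longrightarrow> \<exists>b i j p q. biprod x y b i j p q"
  using ex_biproduct unfolding biprod_def by blast

lemma biprodD:
  assumes "biprod x y b i j p q"
  shows "i \<in> Arr E \<and> Dom E i = x \<and> Cod E i = b" "j \<in> Arr E \<and> Dom E j = y \<and> Cod E j = b"
    "p \<in> Arr E \<and> Dom E p = b \<and> Cod E p = x" "q \<in> Arr E \<and> Dom E q = b \<and> Cod E q = y"
    "p \<cdot> i = Idt E x" "q \<cdot> j = Idt E y" "p \<cdot> j = Zero E y x" "q \<cdot> i = Zero E x y"
    "(i \<cdot> p) \<oplus> (j \<cdot> q) = Idt E b" "x \<in> Obj E" "y \<in> Obj E" "b \<in> Obj E"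
  using assms by (auto simp: biprod_def Hom_iff)

definition bp :: "'o \<Rightarrow> 'm \<times> 'm \<times> 'm \<times> 'm" where
  "bp c = (SOME (i, j, p, q). \<exists>b. biprod A c b i j p q)"

definition in\<^sub>A :: "'o \<Rightarrow> 'm" where "in\<^sub>A c = fst (bp c)"
definition in\<^sub>c :: "'o \<Rightarrow> 'm" where "in\<^sub>c c = fst (snd (bp c))"
definition pr\<^sub>A :: "'o \<Rightarrow> 'm" where "pr\<^sub>A c = fst (snd (snd (bp c)))"
definition pr\<^sub>c :: "'o \<Rightarrow> 'm" where "pr\<^sub>c c = snd (snd (snd (bp c)))"
definition sm :: "'o \<Rightarrow> 'o" where "sm c = Cod E (in\<^sub>A c)"

lemma bp:
  assumes "c \<in> Obj E"
  shows "biprod A c (sm c) (in\<^sub>A c) (in\<^sub>c c) (pr\<^sub>A c) (pr\<^sub>c c)"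
proof -
  obtain b i j p q where "biprod A c b i j p q" using biprod_ex[OF A_in_Obj assms] by blast
  then have "\<exists>t. case t of (i, j, p, q) \<Rightarrow> \<exists>b. biprod A c b i j p q" by (intro exI[of _ "(i, j, p, q)"]) auto
  from someI_ex[OF this] obtain b where b: "biprod A c b (in\<^sub>A c) (in\<^sub>c c) (pr\<^sub>A c) (pr\<^sub>c c)"
    by (auto simp: bp_def[symmetric] in\<^sub>A_def in\<^sub>c_def pr\<^sub>A_def pr\<^sub>c_def split: prod.splits)
  then have "b = sm c" using biprodD(1) by (simp add: sm_def)
  then show ?thesis using b by simp
qed

lemmas bpD = biprodD[OF bp]

text \<open>Every object \<open>x\<close> of the coslice is weakly equivalent to the coproduct inclusion of \<open>A\<close> into
  \<open>A \<oplus> Cod x\<close>, from which an arbitrary morphism \<open>Cod x \<rightarrow> Cod y\<close> of \<open>E\<close> extends to a morphism of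
  the coslice.\<close>

definition copair :: "'m \<Rightarrow> 'm \<Rightarrow> 'm \<Rightarrow> 'm \<times> 'm \<times> 'm" where
  "copair x y a = (in\<^sub>A (Cod E x), y \<cdot> pr\<^sub>A (Cod E x) \<oplus> a \<cdot> pr\<^sub>c (Cod E x), y)"

text \<open>The functor sending \<open>c\<close> to the inclusion of \<open>A\<close> into its
  biproduct with \<open>c\<close> is left adjoint to the codomain functor; this is the counit at
  \<open>x\<close>.\<close>

definition counit :: "'m \<Rightarrow> 'm \<times> 'm \<times> 'm" where
  "counit x = copair x x (Idt E (Cod E x))"

text \<open>The normal form of a morphism in the localization: back along the counit, then forward
  by the map under \<open>A\<close> that \<open>a\<close> determines. Since \<open>a\<close> need
  not respect \<open>x\<close> and \<open>y\<close>, it is in general no morphism of the coslice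
  itself.\<close>

definition roof :: "'m \<Rightarrow> 'm \<Rightarrow> 'm \<Rightarrow> ('m \<times> 'm \<times> 'm) step list" where
  "roof x y a = [Inv (counit x), Fwd (copair x y a)]"

lemma in_Obj: "c \<in> Obj E \<Longrightarrow> in\<^sub>A c \<in> Obj K"
  using bpD(1)[of c] by (simp add: K_Obj)

lemma copair_Hom:
  assumes "x \<in> Obj K" "y \<in> Obj K" "a \<in> Hom E (Cod E x) (Cod E y)"
  shows "copair x y a \<in> Hom K (in\<^sub>A (Cod E x)) y"
proof -
  have c: "Cod E x \<in> Obj E" using assms by (simp add: K_Obj)
  note b = bpD(1-8)[OF c]
  show ?thesis unfolding copair_def
    by (rule K_HomI[OF in_Obj[OF c] assms(2)])
      (use b assms[unfolded K_Obj Hom_iff] in \<open>simp_all add: Hom_iff Comp_Add\<close>)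
qed

text \<open>The counit restricts to the identity on the summand \<open>Cod E x\<close>. The
  composite in the other order differs from the identity by a map factoring through the projection
  to \<open>A\<close>, which is null because \<open>A\<close> is injective.\<close>

lemma counit_stable_inverse:
  assumes "x \<in> Obj K"
  shows "stable_inverse (fst (snd (counit x))) (in\<^sub>c (Cod E x))"
proof -
  have c: "Cod E x \<in> Obj E" using assms by (simp add: K_Obj)
  note b = bpD(1-8)[OF c] bpD(9)[OF c]
  note x = assms[unfolded K_Obj]
  let ?i = "in\<^sub>A (Cod E x)" and ?j = "in\<^sub>c (Cod E x)" and ?p = "pr\<^sub>A (Cod E x)" and ?q = "pr\<^sub>c (Cod E x)"
  let ?e = "x \<cdot> ?p \<oplus> ?q"
  have e: "fst (snd (counit x)) = ?e" unfolding counit_def copair_def using b by simp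
  have ej: "?e \<cdot> ?j = Idt E (Cod E x)" using b x by (simp add: Comp_Add)
  have "?j \<cdot> ?e = Idt E (sm (Cod E x)) \<oplus> (?j \<cdot> x \<oplus> Neg E ?i) \<cdot> ?p"
    unfolding b(9)[symmetric] using b(1-8) x
    by (simp add: Comp_Add Add_ac Add_Neg_cancel_left_commute)
  then have "?j \<cdot> ?e \<approx> Idt E (sm (Cod E x))"
    by (rule steqI'[OF _ _ _ _ injective_A]) (use b(1-8) x bpD(12)[OF c] in \<open>simp_all add: Hom_iff\<close>)
  then show ?thesis
    unfolding e stable_inverse_def using b(1-8) x ej steq_refl c by (simp add: Hom_iff)
qed

lemma counit:
  assumes "x \<in> Obj K"
  shows "counit x \<in> Hom K (in\<^sub>A (Cod E x)) x" "counit x \<in> W"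
proof -
  show h: "counit x \<in> Hom K (in\<^sub>A (Cod E x)) x"
    unfolding counit_def by (rule copair_Hom[OF assms assms]) (use assms in \<open>simp add: Hom_iff K_Obj\<close>)
  then have "counit x \<in> Arr K" by (simp add: Hom_iff)
  then show "counit x \<in> W" using counit_stable_inverse[OF assms] W_iff[of "fst (counit x)" "fst (snd (counit x))" "snd (snd (counit x))"]
    by auto
qed

lemma roof_zigzag:
  assumes "x \<in> Obj K" "y \<in> Obj K" "a \<in> Hom E (Cod E x) (Cod E y)"
  shows "zigzag K W x (roof x y a) y"
  unfolding roof_def using counit[OF assms(1)] copair_Hom[OF assms] assms(2) by auto

text \<open>The stable inverse selected for the counit may be replaced by the inclusion of the
  second summand, and on that summand \<open>copair x y a\<close> is \<open>a\<close>.\<close>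

lemma zz_val_roof:
  assumes "x \<in> Obj K" "y \<in> Obj K" "a \<in> Hom E (Cod E x) (Cod E y)"
  shows "zz_val x (roof x y a) \<approx> a"
proof -
  have c: "Cod E x \<in> Obj E" using assms by (simp add: K_Obj)
  note b = bpD(1-8)[OF c]
  note ty = assms[unfolded K_Obj Hom_iff]
  let ?i = "in\<^sub>A (Cod E x)" and ?j = "in\<^sub>c (Cod E x)" and ?p = "pr\<^sub>A (Cod E x)" and ?q = "pr\<^sub>c (Cod E x)"
  let ?l = "y \<cdot> ?p \<oplus> a \<cdot> ?q" and ?e = "fst (snd (counit x))"
  have i: "stable_inverse ?e (stable_inv ?e)" using stable_inv counit_stable_inverse[OF assms(1)] by blast
  have e: "stable_inv ?e \<approx> ?j" by (rule stable_inverse_unique[OF i counit_stable_inverse[OF assms(1)]])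
  note d = steqD[OF e]
  have "?l \<cdot> stable_inv ?e \<approx> ?l \<cdot> ?j" by (rule steq_Comp_left[OF e]) (use b ty d in simp_all)
  also have "?l \<cdot> ?j = a" using b ty by (simp add: Comp_Add)
  finally have "?l \<cdot> stable_inv ?e \<approx> a" .
  moreover have "zz_val x (roof x y a) = ?l \<cdot> stable_inv ?e"
    using b ty d by (simp add: roof_def copair_def)
  ultimately show ?thesis by simp
qed

section \<open>Reduction of zigzags to roofs\<close>

lemma zz_Comp_sym:
  "\<lbrakk>f \<in> Hom K x y; g \<in> Hom K y z\<rbrakk> \<Longrightarrow> zz_equiv x [Fwd (g \<cdot>\<^bsub>K\<^esub> f)] [Fwd f, Fwd g] z"
  by (rule zz_sym, rule zz_Comp)

lemma zz_context:
  assumes "zz_equiv y q q' z" "zigzag K W x p y" "zigzag K W z r w"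
  shows "zz_equiv x (p @ q @ r) (p @ q' @ r) w"
  by (rule zz_append[OF zz_refl[OF assms(2)] zz_append[OF assms(1) zz_refl[OF assms(3)]]])

text \<open>Because \<open>y = a \<cdot> x\<close>, the copairing factors as \<phi> after the
  counit, and the counit cancels against its formal inverse.\<close>

lemma roof_Fwd:
  assumes "\<phi> \<in> Hom K x y" "\<phi> = (x, a, y)"
  shows "zz_equiv x [Fwd \<phi>] (roof x y a) y"
proof -
  have xy: "x \<in> Obj K" "y \<in> Obj K" "a \<in> Hom E (Cod E x) (Cod E y)" "y = a \<cdot> x"
    using K_HomE[OF assms(1)] assms(2) by auto
  have c: "Cod E x \<in> Obj E" using xy by (simp add: K_Obj)
  note b = bpD(1-8)[OF c]
  note e = counit[OF xy(1)]
  have "copair x y a = \<phi> \<cdot>\<^bsub>K\<^esub> counit x"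
    unfolding copair_def counit_def assms(2) coslice_simps
    using b xy(1-3)[unfolded K_Obj Hom_iff] xy(4)[symmetric] Comp_eq_Arr[OF xy(4)[symmetric]]
    by (simp add: Comp_Add)
  then have "zz_equiv x (roof x y a) ([Inv (counit x)] @ [Fwd (counit x), Fwd \<phi>]) y"
    unfolding roof_def
    using zz_append[OF zz_refl[of K W x "[Inv (counit x)]" "in\<^sub>A (Cod E x)"] zz_Comp_sym[OF e(1) assms(1)]] e in_Obj[OF c] by auto
  also have "[Inv (counit x)] @ [Fwd (counit x), Fwd \<phi>] = [] @ [Inv (counit x), Fwd (counit x)] @ [Fwd \<phi>]" by simp
  finally have "zz_equiv x (roof x y a) ([] @ [] @ [Fwd \<phi>]) y"
    by (rule zz_trans[OF _ zz_context[OF zz_Inv_Fwd[OF e(2,1)]]]) (use assms(1) xy(1,2) in auto)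
  then show ?thesis using zz_sym by simp
qed

lemma roof_Idt:
  assumes "x \<in> Obj K"
  shows "zz_equiv x (roof x x (Idt E (Cod E x))) [] x"
proof -
  have "Idt K x \<in> Hom K x x" by (rule K.Idt_in_Hom[OF assms])
  from zz_trans[OF zz_sym[OF roof_Fwd[OF this coslice_simps(3)]] zz_Idt[OF assms]] show ?thesis .
qed

text \<open>The morphism \<open>a\<close> also acts between the biproducts, by \<open>mu\<close>,
  which is the identity on \<open>A\<close> and \<open>a\<close> on the other summand. The forward
  part of the first roof is \<open>mu\<close> followed by the counit of \<open>y\<close>, which
  cancels with the inverse counit opening the second roof; \<open>mu\<close> then merges into the
  last copairing.\<close>

lemma roof_append:
  assumes "x \<in> Obj K" "y \<in> Obj K" "z \<in> Obj K" "a \<in> Hom E (Cod E x) (Cod E y)" "b \<in> Hom E (Cod E y) (Cod E z)"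
  shows "zz_equiv x (roof x y a @ roof y z b) (roof x z (b \<cdot> a)) z"
proof -
  have c: "Cod E x \<in> Obj E" "Cod E y \<in> Obj E" using assms by (simp_all add: K_Obj)
  note B = bpD(1-8)[OF c(1)] bpD(1-8)[OF c(2)]
  note B = B bpD(5-8)[OF c(1), THEN Comp_eq_Arr] bpD(5-8)[OF c(2), THEN Comp_eq_Arr]
    bpD(12)[OF c(1)] bpD(12)[OF c(2)] c
  note ty = assms[unfolded K_Obj Hom_iff] A_in_Obj
  let ?x = "Cod E x" and ?y = "Cod E y"
  define mu where "mu = (in\<^sub>A ?x, in\<^sub>A ?y \<cdot> pr\<^sub>A ?x \<oplus> in\<^sub>c ?y \<cdot> a \<cdot> pr\<^sub>c ?x, in\<^sub>A ?y)"
  have mu: "mu \<in> Hom K (in\<^sub>A ?x) (in\<^sub>A ?y)"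
    unfolding mu_def by (rule K_HomI[OF in_Obj[OF c(1)] in_Obj[OF c(2)]])
      (use B ty in \<open>simp_all add: Hom_iff Comp_Add\<close>)
  have 1: "copair x y a = counit y \<cdot>\<^bsub>K\<^esub> mu"
    unfolding copair_def counit_def mu_def coslice_simps using B ty by (simp add: Comp_Add)
  have 2: "copair y z b \<cdot>\<^bsub>K\<^esub> mu = copair x z (b \<cdot> a)"
    unfolding copair_def mu_def coslice_simps using B ty by (simp add: Comp_Add)
  note e = counit[OF assms(1)] counit[OF assms(2)] and l = copair_Hom[OF assms(2,3,5)]
  have "zz_equiv x ([Inv (counit x)] @ [Fwd (copair x y a)] @ [Inv (counit y), Fwd (copair y z b)])
      ([Inv (counit x)] @ [Fwd mu, Fwd (counit y)] @ [Inv (counit y), Fwd (copair y z b)]) z"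
    unfolding 1 by (rule zz_context[OF zz_Comp_sym[OF mu e(3)]]) (use e l in_Obj c assms in auto)
  then have A: "zz_equiv x (roof x y a @ roof y z b)
      (([Inv (counit x)] @ [Fwd mu]) @ [Fwd (counit y), Inv (counit y)] @ [Fwd (copair y z b)]) z"
    by (simp add: roof_def)
  have B: "zz_equiv x (([Inv (counit x)] @ [Fwd mu]) @ [Fwd (counit y), Inv (counit y)] @ [Fwd (copair y z b)])
      (([Inv (counit x)] @ [Fwd mu]) @ [] @ [Fwd (copair y z b)]) z"
    by (rule zz_context[OF zz_Fwd_Inv[OF e(4,3)]]) (use e l mu in_Obj c assms in auto)
  have C: "zz_equiv x ([Inv (counit x)] @ [Fwd mu, Fwd (copair y z b)] @ [])
      ([Inv (counit x)] @ [Fwd (copair y z b \<cdot>\<^bsub>K\<^esub> mu)] @ []) z"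
    by (rule zz_context[OF zz_Comp[OF mu l]]) (use e l mu in_Obj c assms in auto)
  show ?thesis
    using zz_trans[OF zz_trans[OF A B]] C unfolding 2 by (simp add: roof_def)
qed

text \<open>A section of an inverted morphism is its inverse in the localization. Two sections of
  the same \<open>w\<close> therefore have equivalent zigzags.\<close>

lemma Fwd_cancel:
  assumes "w \<in> W" "w \<in> Hom K y x" "s \<in> Hom K x y" "w \<cdot>\<^bsub>K\<^esub> s = Idt K x"
  shows "zz_equiv x [Fwd s] [Inv w] y"
proof -
  have o: "x \<in> Obj K" "y \<in> Obj K" using K.Hom_Obj[OF assms(3)] by auto
  have A: "zz_equiv x ([Fwd s] @ [Fwd w, Inv w] @ []) ([Fwd s] @ [] @ []) y"
    by (rule zz_context[OF zz_Fwd_Inv[OF assms(1,2)]]) (use assms o in auto)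
  have B: "zz_equiv x ([] @ [Fwd s, Fwd w] @ [Inv w]) ([] @ [Fwd (w \<cdot>\<^bsub>K\<^esub> s)] @ [Inv w]) y"
    by (rule zz_context[OF zz_Comp[OF assms(3,2)]]) (use assms o in auto)
  have C: "zz_equiv x ([] @ [Fwd (Idt K x)] @ [Inv w]) ([] @ [] @ [Inv w]) y"
    by (rule zz_context[OF zz_Idt[OF o(1)]]) (use assms o in auto)
  show ?thesis
    using zz_trans[OF zz_sym[OF A]] zz_trans[OF B[unfolded assms(4)] C] by simp
qed

text \<open>Two sections of one weak equivalence become equal in the localization; this identifies
  \<open>a\<close> with \<open>a \<oplus> v \<cdot> u\<close> when \<open>u\<close> goes to an injective object.\<close>

lemma copair_steq:
  assumes "x \<in> Obj K" "y \<in> Obj K" "a \<in> Hom E (Cod E x) (Cod E y)" "a' \<approx> a"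
  shows "zz_equiv (in\<^sub>A (Cod E x)) [Fwd (copair x y a')] [Fwd (copair x y a)] y"
proof -
  let ?c = "Cod E x"
  have c: "?c \<in> Obj E" using assms by (simp add: K_Obj)
  note ty = assms(1-3)[unfolded K_Obj Hom_iff]
  note B = bpD(1-8,12)[OF c]
  obtain v where v: "v \<in> Hom E (inj_obj ?c) (Cod E y)" "a' = a \<oplus> v \<cdot> inc ?c"
    using steqE[OF assms(4), of ?c "Cod E y"] steqD[OF assms(4)] ty by auto
  \<comment> \<open>Extending the hull inclusion by zero on \<open>A\<close> makes adding
    \<open>j \<cdot> u\<close> to a map invisible on \<open>A\<close>, so that \<open>s1\<close>
    below is still a morphism under \<open>A\<close>.\<close>
  define u where "u = inc ?c \<cdot> pr\<^sub>c ?c"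
  have u: "u \<in> Arr E" "Dom E u = sm ?c" "Cod E u = inj_obj ?c" "u \<cdot> in\<^sub>A ?c = Zero E A (inj_obj ?c)"
    using B c by (simp_all add: u_def)
  obtain d i j p q where D: "biprod (sm ?c) (inj_obj ?c) d i j p q"
    using biprod_ex[OF B(9) hull_simps(7)[OF c]] by blast
  note d = biprodD[OF D]
  note R = d(5-8)[THEN Comp_eq_Arr]
  let ?k = "in\<^sub>A ?c"
  have ko: "?k \<in> Obj K" "i \<cdot> ?k \<in> Obj K" using B d by (auto simp: K_Obj)
  \<comment> \<open>A cylinder-like object: the biproduct with \<open>A\<close> is enlarged by the
    hull of \<open>?c\<close>, and \<open>w\<close> projects the hull away. The sections
    \<open>s0\<close> and \<open>s1\<close> differ by \<open>j \<cdot> u\<close>; the map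
    \<open>t\<close>, equal to \<open>v\<close> on the hull, turns that difference into the
    difference of \<open>a\<close> and \<open>a'\<close>.\<close>
  define w where "w = (i \<cdot> ?k, p, ?k)"
  define s0 where "s0 = (?k, i, i \<cdot> ?k)"
  define s1 where "s1 = (?k, i \<oplus> j \<cdot> u, i \<cdot> ?k)"
  define t where "t = (i \<cdot> ?k, (y \<cdot> pr\<^sub>A ?c \<oplus> a \<cdot> pr\<^sub>c ?c) \<cdot> p \<oplus> v \<cdot> q, y)"
  have w: "w \<in> Hom K (i \<cdot> ?k) ?k"
    unfolding w_def by (rule K_HomI[OF ko(2,1)]) (use B d R in \<open>simp_all add: Hom_iff\<close>)
  have "i \<cdot> p = Idt E d \<oplus> Neg E j \<cdot> q"
    unfolding d(9)[symmetric] using d(1-8) by (simp add: Add_ac)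
  then have "i \<cdot> p \<approx> Idt E d"
    by (rule steqI'[OF _ _ _ _ injective_inj_obj[OF c]]) (use d(1-8,12) in \<open>simp_all add: Hom_iff\<close>)
  then have "stable_inverse p i"
    unfolding stable_inverse_def using d(1-8,10,12) steq_refl by (simp add: Hom_iff)
  then have wW: "w \<in> W" using w by (auto simp: w_def W_iff Hom_iff)
  have s0: "s0 \<in> Hom K ?k (i \<cdot> ?k)"
    unfolding s0_def by (rule K_HomI[OF ko]) (use B d R in \<open>simp_all add: Hom_iff\<close>)
  have s1: "s1 \<in> Hom K ?k (i \<cdot> ?k)"
    unfolding s1_def by (rule K_HomI[OF ko]) (use B d R u in \<open>simp_all add: Hom_iff Comp_Add\<close>)
  have t: "t \<in> Hom K (i \<cdot> ?k) y"
    unfolding t_def by (rule K_HomI[OF ko(2) assms(2)])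
      (use B d R ty v(1)[unfolded Hom_iff] in \<open>simp_all add: Hom_iff Comp_Add\<close>)
  have ws: "w \<cdot>\<^bsub>K\<^esub> s0 = Idt K ?k" "w \<cdot>\<^bsub>K\<^esub> s1 = Idt K ?k"
    unfolding w_def s0_def s1_def coslice_simps using B d R u by (simp_all add: Comp_Add)
  have ts: "t \<cdot>\<^bsub>K\<^esub> s0 = copair x y a" "t \<cdot>\<^bsub>K\<^esub> s1 = copair x y a'"
    unfolding t_def s0_def s1_def copair_def coslice_simps v(2)
    using B d R ty u v(1)[unfolded Hom_iff] c by (simp_all add: Comp_Add Add_ac u_def)
  have "zz_equiv ?k [Fwd s1] [Fwd s0] (i \<cdot> ?k)"
    by (rule zz_trans[OF Fwd_cancel[OF wW w s1 ws(2)] zz_sym[OF Fwd_cancel[OF wW w s0 ws(1)]]])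
  then have "zz_equiv ?k ([Fwd s1] @ [Fwd t]) ([Fwd s0] @ [Fwd t]) y"
    by (rule zz_append[OF _ zz_refl]) (use t assms in auto)
  then have "zz_equiv ?k [Fwd s1, Fwd t] [Fwd s0, Fwd t] y" by simp
  from zz_trans[OF zz_trans[OF zz_sym[OF zz_Comp[OF s1 t]] this] zz_Comp[OF s0 t]]
  show ?thesis unfolding ts .
qed

lemma roof_steq:
  assumes "x \<in> Obj K" "y \<in> Obj K" "a \<in> Hom E (Cod E x) (Cod E y)" "a' \<approx> a"
  shows "zz_equiv x (roof x y a') (roof x y a) y"
proof -
  have "zz_equiv x ([Inv (counit x)] @ [Fwd (copair x y a')]) ([Inv (counit x)] @ [Fwd (copair x y a)]) y"
    by (rule zz_append[OF zz_refl copair_steq[OF assms]])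
      (use counit[OF assms(1)] in_Obj assms(1) in \<open>auto simp: K_Obj\<close>)
  then show ?thesis by (simp add: roof_def)
qed

text \<open>The roof of the stable inverse followed by \<open>w\<close> reduces to the roof of
  \<open>a \<cdot> stable_inv a\<close>, hence by \<open>roof_steq\<close> to that of an identity,
  which is trivial. Appending the formal inverse of \<open>w\<close> then identifies the
  two.\<close>

lemma roof_Inv:
  assumes "w \<in> W" "w \<in> Hom K y x" "w = (y, a, x)"
  shows "zz_equiv x [Inv w] (roof x y (stable_inv a)) y"
proof -
  have a: "y \<in> Obj K" "x \<in> Obj K" "a \<in> Hom E (Cod E y) (Cod E x)"
    using K_HomE[OF assms(2)] assms(3) by auto
  have s: "stable_inverse a (stable_inv a)" using assms(1,3) stable_inv by (simp add: W_iff)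
  then have b: "stable_inv a \<in> Hom E (Cod E x) (Cod E y)" "a \<cdot> stable_inv a \<approx> Idt E (Cod E x)"
    using a(3) by (auto simp: stable_inverse_def Hom_iff)
  let ?g = "roof x y (stable_inv a)"
  note z = roof_zigzag[OF a(2,1) b(1)]
  have 1: "zz_equiv x (?g @ [Fwd w]) (?g @ roof y x a) x"
    by (rule zz_append[OF zz_refl[OF z] roof_Fwd[OF assms(2,3)]])
  have 2: "zz_equiv x (?g @ roof y x a) (roof x x (a \<cdot> stable_inv a)) x"
    by (rule roof_append[OF a(2,1,2) b(1) a(3)])
  have 3: "zz_equiv x (roof x x (a \<cdot> stable_inv a)) (roof x x (Idt E (Cod E x))) x"
    by (rule roof_steq[OF a(2,2) _ b(2)]) (use a(2) in \<open>simp add: K_Obj Hom_iff\<close>)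
  have 4: "zz_equiv x (?g @ [Fwd w]) [] x"
    by (rule zz_trans[OF zz_trans[OF 1 2] zz_trans[OF 3 roof_Idt[OF a(2)]]])
  have zi: "zigzag K W x [Inv w] y" using assms(1,2) a by auto
  have 5: "zz_equiv x ((?g @ [Fwd w]) @ [Inv w]) ([] @ [Inv w]) y" by (rule zz_append[OF 4 zz_refl[OF zi]])
  have "zz_equiv x (?g @ [Fwd w, Inv w] @ []) (?g @ [] @ []) y"
    by (rule zz_context[OF zz_Fwd_Inv[OF assms(1,2)] z]) (use a in auto)
  from zz_trans[OF zz_sym[OF 5]] this show ?thesis by simp
qed

lemma roof_step:
  assumes "step_in K W x s y"
  shows "zz_equiv x [s] (roof x y (step_val s)) y"
proof (cases s)
  case (Fwd \<phi>)
  then have \<phi>: "\<phi> \<in> Hom K x y" using assms by simp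
  from K_HomE[OF this] obtain a where a: "\<phi> = (x, a, y)" by metis
  show ?thesis using roof_Fwd[OF \<phi> a] a Fwd by simp
next
  case (Inv \<phi>)
  then have \<phi>: "\<phi> \<in> W" "\<phi> \<in> Hom K y x" using assms by auto
  from K_HomE[OF this(2)] obtain a where a: "\<phi> = (y, a, x)" by metis
  show ?thesis using roof_Inv[OF \<phi> a] a Inv by simp
qed

text \<open>Every step is equivalent to the roof of its value, and \<open>roof_append\<close> merges
  consecutive roofs just as \<open>zz_val\<close> composes values. With \<open>zz_val_roof\<close>
  this makes roofs and values mutually inverse.\<close>

lemma roof_zz_val: "zigzag K W x p y \<Longrightarrow> zz_equiv x p (roof x y (zz_val x p)) y"
proof (induction p arbitrary: x)
  case Nil
  then have "x \<in> Obj K" "x = y" by auto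
  then show ?case using zz_sym[OF roof_Idt] by simp
next
  case (Cons s p)
  then obtain z where z: "step_in K W x s z" "zigzag K W z p y" by auto
  note s = step_in_val[OF z(1)] and p = zz_val_Hom[OF z(2)]
  have y: "y \<in> Obj K" using K.zigzag_Obj[OF z(2)] by simp
  show ?case
    using zz_trans[OF zz_append[OF roof_step[OF z(1)] Cons.IH[OF z(2)]] roof_append[OF s(3,4) y s(2) p]] s(1) by simp
qed

definition cls :: "'m \<Rightarrow> 'm \<Rightarrow> 'm \<Rightarrow> 'm \<times> ('m \<times> 'm \<times> 'm) step list set \<times> 'm" where
  "cls x y a = zigzag_class K W x (roof x y a) y"

text \<open>Surjectivity of \<open>cls\<close> on morphisms is \<open>roof_zz_val\<close>. Equal
  classes give stably equal morphisms by evaluating both roofs with \<open>zz_val\<close>, and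
  \<open>roof_steq\<close> is the converse.\<close>

lemma stable_quotient_localization: "stable_quotient E (localization K W) (Cod E) cls"
proof (intro stable_quotient.intro stable_quotient_axioms.intro frobenius_category_axioms
    K.category_localization)
  note L = K.localization_simps
  show "Cod E x \<in> Obj E" if "x \<in> Obj (localization K W)" for x
    using that by (simp add: L K_Obj)
  show "\<exists>x \<in> Obj (localization K W). Cod E x = c" if "c \<in> Obj E" for c
    \<comment> \<open>The zero morphism from \<open>A\<close> is an object of the coslice over any
      prescribed codomain.\<close>
    by (rule bexI[of _ "Zero E A c"]) (use that in \<open>simp_all add: L K_Obj\<close>)
  show "cls x y f \<in> Hom (localization K W) x y"
    if "x \<in> Obj (localization K W)" "y \<in> Obj (localization K W)" "f \<in> Hom E (Cod E x) (Cod E y)" for x y f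
    using roof_zigzag[of x y f] that unfolding L cls_def by blast
  show "\<exists>f \<in> Hom E (Cod E x) (Cod E y). cls x y f = \<phi>" if h: "\<phi> \<in> Hom (localization K W) x y" for \<phi> x y
  proof -
    obtain p where p: "zigzag K W x p y" "\<phi> = zigzag_class K W x p y" using h by (auto simp: L)
    show ?thesis
      using zz_val_Hom[OF p(1)] roof_zz_val[OF p(1)] K.zigzag_class_eq_iff[OF p(1)] p(2)
      unfolding cls_def by metis
  qed
  show "cls x y f = cls x y g \<longleftrightarrow> f \<approx> g"
    if o: "x \<in> Obj (localization K W)" "y \<in> Obj (localization K W)"
      and f: "f \<in> Hom E (Cod E x) (Cod E y)" and g: "g \<in> Hom E (Cod E x) (Cod E y)" for x y f g
  proof
    have o: "x \<in> Obj K" "y \<in> Obj K" using o by (simp_all add: L)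
    note e = K.zigzag_class_eq_iff[OF roof_zigzag[OF o f]]
    show "f \<approx> g" if "cls x y f = cls x y g"
    proof -
      have "zz_val x (roof x y f) \<approx> zz_val x (roof x y g)"
        using that e zz_val_sound unfolding cls_def by blast
      from steq_trans[OF steq_trans[OF steq_sym[OF zz_val_roof[OF o f]] this] zz_val_roof[OF o g]] show ?thesis .
    qed
    show "cls x y f = cls x y g" if "f \<approx> g"
      using roof_steq[OF o g that] e unfolding cls_def by blast
  qed
  show "cls y z g \<cdot>\<^bsub>localization K W\<^esub> cls x y f = cls x z (g \<cdot> f)"
    if o: "x \<in> Obj (localization K W)" "y \<in> Obj (localization K W)" "z \<in> Obj (localization K W)"
      and f: "f \<in> Hom E (Cod E x) (Cod E y)" and g: "g \<in> Hom E (Cod E y) (Cod E z)" for x y z f g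
  proof -
    have o: "x \<in> Obj K" "y \<in> Obj K" "z \<in> Obj K" using o by (simp_all add: L)
    note z = roof_zigzag[OF o(1,2) f] roof_zigzag[OF o(2,3) g]
    have "zigzag K W x (roof x y f @ roof y z g) z" using z by (auto simp: K.zigzag_append)
    from K.zigzag_class_eq_iff[OF this] roof_append[OF o f g] show ?thesis
      unfolding cls_def K.localization_Comp[OF z] by blast
  qed
  show "cls x x (Idt E (Cod E x)) = Idt (localization K W) x" if "x \<in> Obj (localization K W)" for x
  proof -
    have x: "x \<in> Obj K" "Idt E (Cod E x) \<in> Hom E (Cod E x) (Cod E x)"
      using that by (simp_all add: L K_Obj Hom_iff)
    show ?thesis
      unfolding cls_def L using roof_Idt[OF x(1)] K.zigzag_class_eq_iff[OF roof_zigzag[OF x(1,1,2)]] by blast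
  qed
qed

end

theorem theorem3p5:
  fixes F :: "('o, 'm) exact_data" and A :: 'o
  assumes "frobenius_category F"
    and "weakly_idempotent_complete F"
    and "projective F A" and "injective F A"
    and "\<not> zero_object F A"
  shows "is_triangulated_category (Ho (coslice F A) (coslice_model F A (canonical_model F)))"
proof -
  interpret frobenius_category F by fact
  interpret coslice_frobenius F A by unfold_locales fact
  interpret stable_quotient F "localization K W" "Cod F" cls by (rule stable_quotient_localization)
  show ?thesis using is_triangulated_category_H by (simp add: Ho_def W_def)
qed

end
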